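(* Let $\alpha>0$ be a countable successor ordinal and $n>1$ an integer. Then the group $\mathrm{Homeo}(X_{\alpha,n})$ equipped with the discrete topology is quasi-isometric to the countably infinite Hamming cube.
   Context: A Stone space is a compact, Hausdorff, totally disconnected space. The Cantor--Bendixson derivative $X'$ of $X$ is $X$ minus its isolated points; $X^{(0)}=X$, $X^{(\beta+1)}=(X^{(\beta)})'$, and $X^{(\lambda)}=\bigcap_{\beta<\lambda}X^{(\beta)}$ for $\lambda$ a limit ordinal. For a nonempty countable Stone space $X$ there are a countable ordinal $\alpha$ and an integer $n\ge1$ such that $X^{(\alpha)}$ has exactly $n$ points; the pair $(\alpha,n)$ determines $X$ up to homeomorphism, and $X_{\alpha,n}$ denotes this space (a model is $\omega^\alpha\cdot n+1$ with the order topology). For a topological group $G$, a continuous left-invariant pseudometric $d$ is maximal if for every continuous left-invariant pseudometric $d'$ on $G$ there are constants $K,C$ with $d'\le Kd+C$; such $d$, if it exists, is unique up to quasi-isometry. "$G$ is quasi-isometric to $Y$" means that $G$ admits a maximal continuous left-invariant pseudometric $d$ and $(G,d)$ is quasi-isometric to $Y$. For a discrete group every left-invariant pseudometric is continuous. The countably infinite Hamming cube is the graph whose vertices are the binary sequences indexed by $\omega$ with finitely many $1$'s, two vertices being joined by an edge iff they differ in exactly one coordinate, with its graph metric. *)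

theory Defs
  imports "HOL-Analysis.Analysis" "HOL-Algebra.Group"
begin

section \<open>Stone spaces and the Cantor--Bendixson derivative\<close>

definition totally_disconnected_space :: "'a topology \<Rightarrow> bool" where
  "totally_disconnected_space X \<longleftrightarrow> (\<forall>S. connectedin X S \<longrightarrow> (\<exists>a. S \<subseteq> {a}))"

definition Stone_space :: "'a topology \<Rightarrow> bool" where
  "Stone_space X \<longleftrightarrow> compact_space X \<and> Hausdorff_space X \<and> totally_disconnected_space X"

text \<open>
  The isolated points removed from \<open>S\<close> are those of \<open>S\<close> as a subspace of \<open>X\<close>.
\<close>

definition CB_derivative :: "'a topology \<Rightarrow> 'a set \<Rightarrow> 'a set" where
  "CB_derivative X S = {x \<in> S. \<not> openin (subtopology X S) {x}}"

text \<open>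
  An ordinal is represented by an element \<open>\<alpha>\<close> of an arbitrary well-ordered type; it stands
  for the order type of \<open>{..<\<alpha>}\<close>. Every ordinal arises in this way, since the type is arbitrary.
\<close>

definition zero_ordinal :: "'o::wellorder \<Rightarrow> bool" where
  "zero_ordinal \<alpha> \<longleftrightarrow> {..<\<alpha>} = {}"

definition successor_of :: "'o::wellorder \<Rightarrow> 'o \<Rightarrow> bool" where
  "successor_of \<beta> \<alpha> \<longleftrightarrow> \<beta> < \<alpha> \<and> {\<beta><..<\<alpha>} = {}"

definition successor_ordinal :: "'o::wellorder \<Rightarrow> bool" where
  "successor_ordinal \<alpha> \<longleftrightarrow> (\<exists>\<beta>. successor_of \<beta> \<alpha>)"

definition countable_ordinal :: "'o::wellorder \<Rightarrow> bool" where
  "countable_ordinal \<alpha> \<longleftrightarrow> countable {..<\<alpha>}"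

lemma successor_of_unique: "successor_of \<beta> \<alpha> \<Longrightarrow> successor_of \<gamma> \<alpha> \<Longrightarrow> \<beta> = \<gamma>"
  by (metis emptyE greaterThanLessThan_iff linorder_neqE successor_of_def)

lemma the_successor_of: "successor_of \<beta> \<alpha> \<Longrightarrow> (THE \<gamma>. successor_of \<gamma> \<alpha>) = \<beta>"
  using successor_of_unique by blast

function CB_deriv :: "'a topology \<Rightarrow> 'o::wellorder \<Rightarrow> 'a set" where
  "CB_deriv X \<alpha> =
    (if zero_ordinal \<alpha> then topspace X
     else if successor_ordinal \<alpha> then CB_derivative X (CB_deriv X (THE \<beta>. successor_of \<beta> \<alpha>))
     else (\<Inter>\<beta>\<in>{..<\<alpha>}. CB_deriv X \<beta>))"
  by auto
termination
proof (relation "{((X, \<beta>), (Y, \<alpha>)). \<beta> < \<alpha>}", goal_cases)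
  case 1
  have "{((X, \<beta>), (Y, \<alpha>)). \<beta> < \<alpha>} = inv_image {(\<beta>::'b, \<alpha>). \<beta> < \<alpha>} (snd :: 'a topology \<times> 'b \<Rightarrow> 'b)"
    by auto
  then show ?case
    using wf wf_inv_image by metis
next
  case (2 X \<alpha>)
  then show ?case
    using the_successor_of by (fastforce simp: successor_ordinal_def successor_of_def)
next
  case (3 X \<alpha> \<beta>)
  then show ?case
    by simp
qed

declare CB_deriv.simps [simp del]

lemma CB_deriv_zero: "zero_ordinal \<alpha> \<Longrightarrow> CB_deriv X \<alpha> = topspace X"
  by (simp add: CB_deriv.simps)

lemma CB_deriv_successor:
  assumes "successor_of \<beta> \<alpha>"
  shows "CB_deriv X \<alpha> = CB_derivative X (CB_deriv X \<beta>)"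
proof -
  have "\<not> zero_ordinal \<alpha>" "successor_ordinal \<alpha>"
    using assms by (auto simp: zero_ordinal_def successor_ordinal_def successor_of_def)
  then show ?thesis
    using the_successor_of[OF assms] by (simp add: CB_deriv.simps[of X \<alpha>])
qed

lemma CB_deriv_limit:
  "\<not> zero_ordinal \<alpha> \<Longrightarrow> \<not> successor_ordinal \<alpha> \<Longrightarrow> CB_deriv X \<alpha> = (\<Inter>\<beta><\<alpha>. CB_deriv X \<beta>)"
  by (simp add: CB_deriv.simps[of X \<alpha>])

text \<open>
  \<open>is_X \<alpha> n X\<close>: the space \<open>X\<close> is (a copy of) the countable Stone space
  \<open>X\<^bsub>\<alpha>,n\<^esub>\<close>, which its characteristic pair determines up to homeomorphism.
\<close>

definition is_X :: "'o::wellorder \<Rightarrow> nat \<Rightarrow> 'a topology \<Rightarrow> bool" where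
  "is_X \<alpha> n X \<longleftrightarrow>
     Stone_space X \<and> countable (topspace X) \<and> topspace X \<noteq> {} \<and>
     countable_ordinal \<alpha> \<and> n \<ge> 1 \<and>
     finite (CB_deriv X \<alpha>) \<and> card (CB_deriv X \<alpha>) = n"

section \<open>The homeomorphism group\<close>

text \<open>
  As for \<open>BijGroup\<close> in HOL-Algebra, self-maps of the space are normalised to be
  extensional outside \<open>topspace X\<close>, so that each homeomorphism occurs once.
\<close>

definition Homeo :: "'a topology \<Rightarrow> ('a \<Rightarrow> 'a) monoid" where
  "Homeo X =
    \<lparr>carrier = {f \<in> extensional (topspace X). homeomorphic_map X X f},
     mult = compose (topspace X),
     one = (\<lambda>x\<in>topspace X. x)\<rparr>"

lemma group_Homeo: "group (Homeo X)"
proof (rule groupI)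
  fix f g
  assume "f \<in> carrier (Homeo X)" "g \<in> carrier (Homeo X)"
  then show "f \<otimes>\<^bsub>Homeo X\<^esub> g \<in> carrier (Homeo X)"
    using homeomorphic_map_compose[of X X g X f]
    by (auto simp: Homeo_def compose_def intro: homeomorphic_map_eq)
next
  show "\<one>\<^bsub>Homeo X\<^esub> \<in> carrier (Homeo X)"
    by (auto simp: Homeo_def intro: homeomorphic_map_eq[of X X id])
next
  fix f g h
  assume "f \<in> carrier (Homeo X)" "g \<in> carrier (Homeo X)" "h \<in> carrier (Homeo X)"
  then have "h \<in> topspace X \<rightarrow> topspace X"
    using homeomorphic_imp_surjective_map by (fastforce simp: Homeo_def)
  then show "f \<otimes>\<^bsub>Homeo X\<^esub> g \<otimes>\<^bsub>Homeo X\<^esub> h = f \<otimes>\<^bsub>Homeo X\<^esub> (g \<otimes>\<^bsub>Homeo X\<^esub> h)"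
    by (auto simp: Homeo_def compose_def fun_eq_iff)
next
  fix f
  assume f: "f \<in> carrier (Homeo X)"
  then have "f \<in> topspace X \<rightarrow> topspace X"
    using homeomorphic_imp_surjective_map by (fastforce simp: Homeo_def)
  with f show "\<one>\<^bsub>Homeo X\<^esub> \<otimes>\<^bsub>Homeo X\<^esub> f = f"
    by (auto simp: Homeo_def Id_compose)
  obtain g where g: "homeomorphic_maps X X f g"
    using f by (auto simp: Homeo_def homeomorphic_map_maps)
  then have "homeomorphic_map X X (restrict g (topspace X))"
    by (auto simp: homeomorphic_maps_map intro: homeomorphic_map_eq[of X X g])
  moreover have "compose (topspace X) (restrict g (topspace X)) f = (\<lambda>x\<in>topspace X. x)"
    using g \<open>f \<in> topspace X \<rightarrow> topspace X\<close>
    by (auto simp: compose_def homeomorphic_maps_def fun_eq_iff)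
  ultimately show "\<exists>g\<in>carrier (Homeo X). g \<otimes>\<^bsub>Homeo X\<^esub> f = \<one>\<^bsub>Homeo X\<^esub>"
    by (intro bexI[of _ "restrict g (topspace X)"]) (auto simp: Homeo_def)
qed

section \<open>Quasi-isometry type of a topological group\<close>

definition pseudometric_on :: "'a set \<Rightarrow> ('a \<Rightarrow> 'a \<Rightarrow> real) \<Rightarrow> bool" where
  "pseudometric_on S d \<longleftrightarrow>
     (\<forall>x\<in>S. \<forall>y\<in>S. d x y \<ge> 0) \<and>
     (\<forall>x\<in>S. d x x = 0) \<and>
     (\<forall>x\<in>S. \<forall>y\<in>S. d x y = d y x) \<and>
     (\<forall>x\<in>S. \<forall>y\<in>S. \<forall>z\<in>S. d x z \<le> d x y + d y z)"

definition quasi_isometric ::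
  "'a set \<Rightarrow> ('a \<Rightarrow> 'a \<Rightarrow> real) \<Rightarrow> 'b set \<Rightarrow> ('b \<Rightarrow> 'b \<Rightarrow> real) \<Rightarrow> bool" where
  "quasi_isometric S d S' d' \<longleftrightarrow>
     (\<exists>f K C. f \<in> S \<rightarrow> S' \<and> K \<ge> 1 \<and> C \<ge> 0 \<and>
        (\<forall>x\<in>S. \<forall>y\<in>S. d x y / K - C \<le> d' (f x) (f y) \<and> d' (f x) (f y) \<le> K * d x y + C) \<and>
        (\<forall>y\<in>S'. \<exists>x\<in>S. d' (f x) y \<le> C))"

text \<open>
  In the following three definitions \<open>T\<close> is the group topology, with
  \<open>topspace T = carrier G\<close>.
\<close>

definition cont_left_inv_pseudometric ::
  "('a, 'm) monoid_scheme \<Rightarrow> 'a topology \<Rightarrow> ('a \<Rightarrow> 'a \<Rightarrow> real) \<Rightarrow> bool" where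
  "cont_left_inv_pseudometric G T d \<longleftrightarrow>
     pseudometric_on (carrier G) d \<and>
     continuous_map (prod_topology T T) euclideanreal (\<lambda>(g, h). d g h) \<and>
     (\<forall>k\<in>carrier G. \<forall>g\<in>carrier G. \<forall>h\<in>carrier G. d (k \<otimes>\<^bsub>G\<^esub> g) (k \<otimes>\<^bsub>G\<^esub> h) = d g h)"

definition maximal_pseudometric ::
  "('a, 'm) monoid_scheme \<Rightarrow> 'a topology \<Rightarrow> ('a \<Rightarrow> 'a \<Rightarrow> real) \<Rightarrow> bool" where
  "maximal_pseudometric G T d \<longleftrightarrow>
     cont_left_inv_pseudometric G T d \<and>
     (\<forall>d'. cont_left_inv_pseudometric G T d' \<longrightarrow>
        (\<exists>K C. \<forall>g\<in>carrier G. \<forall>h\<in>carrier G. d' g h \<le> K * d g h + C))"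

definition group_quasi_isometric_to ::
  "('a, 'm) monoid_scheme \<Rightarrow> 'a topology \<Rightarrow> 'b set \<Rightarrow> ('b \<Rightarrow> 'b \<Rightarrow> real) \<Rightarrow> bool" where
  "group_quasi_isometric_to G T S e \<longleftrightarrow>
     (\<exists>d. maximal_pseudometric G T d \<and> quasi_isometric (carrier G) d S e)"

section \<open>The countably infinite Hamming cube\<close>

definition cube_vertices :: "(nat \<Rightarrow> bool) set" where
  "cube_vertices = {x. finite {i. x i}}"

definition cube_edges :: "((nat \<Rightarrow> bool) \<times> (nat \<Rightarrow> bool)) set" where
  "cube_edges = {(x, y). x \<in> cube_vertices \<and> y \<in> cube_vertices \<and> (\<exists>!i. x i \<noteq> y i)}"

text \<open>
  The length of a shortest path, \<open>E ^^ n\<close> relating the endpoints of walks of length \<open>n\<close>;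
  meaningful for vertices joined by some path, hence throughout a connected graph.
\<close>

definition graph_dist :: "('a \<times> 'a) set \<Rightarrow> 'a \<Rightarrow> 'a \<Rightarrow> nat" where
  "graph_dist E x y = (LEAST n. (x, y) \<in> E ^^ n)"

definition cube_dist :: "(nat \<Rightarrow> bool) \<Rightarrow> (nat \<Rightarrow> bool) \<Rightarrow> real" where
  "cube_dist x y = real (graph_dist cube_edges x y)"

end

(*
  Write \<alpha> = \<beta> + 1 and let c be a locally constant retraction of X onto the n points of X^(\<alpha>).
  The maximal pseudometric counts the points w of rank \<beta> at which the colourings g c g^-1 and
  h c h^-1 differ; it is finite because two such colourings agree near X^(\<alpha>).

  Maximality. By back and forth, clopen sets with exactly one point of X^(\<gamma>) are homeomorphic,
  and so are open sets missing X^(\<alpha>) with infinitely many points of rank \<beta>. Hence each colour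
  class, minus its top point, splits into infinitely many copies of itself, and the classical
  argument of Galvin and Bergman (displacement plus a commutator trick) bounds any length function
  on its homeomorphisms. A general homeomorphism is reduced to a colour preserving one by moving
  one clopen piece with a single point of rank \<beta> from one colour class to another at a time.

  The pseudometric makes the group isometric, up to distance 0, to the finitely supported words over
  an alphabet of n letters with the Hamming metric. To change the alphabet, absorb a letter: since
  a word has infinitely many neighbours, there is a bijection from {..<a} \<times> words b to words b at
  distance at most 1 from the projection. Doing this in infinitely many blocks of coordinates
  simultaneously gives words a \<times> words b \<cong> words b, hence words a \<cong> words b for a, b \<ge> 2.
*)

theory Submission
  imports Defs
begin

text \<open>The count works because \<open>\<alpha>\<close> is a successor: a clopen set missing
  X^(\<alpha>) has only finitely many points of rank \<open>\<beta>\<close>, while every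
  neighbourhood of a point of X^(\<alpha>) has infinitely many. Changes of colour in ranks below
  \<open>\<beta>\<close> cost a bounded amount, however many there are: all points that go from one
  colour to another form one clopen set, which is carried along with a single piece around a point
  of rank \<open>\<beta>\<close>, and there are only finitely many pairs of colours. A move costs a
  bounded amount because all pieces with one point of rank \<open>\<beta>\<close> in the same class
  are equivalent under colour preserving homeomorphisms, whose lengths are bounded. For words, a map
  with additive errors cannot be applied in infinitely many rows at once, since the errors add up. A
  bijection avoids this: distinct words have distance at least 1, so a bounded displacement becomes
  a multiplicative error in each row, and such errors survive summation.\<close>

text \<open>The record of the values of \<open>h\<close> gives metric control: when neither
  \<open>f\<close> nor \<open>g\<close> moves a point far, neither does \<open>h\<close>.\<close>

lemma Schroeder_Bernstein_decomposition:
  assumes f: "inj_on f A" "f ` A \<subseteq> B" and g: "inj_on g B" "g ` B \<subseteq> A"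
  obtains h where "bij_betw h A B" "\<And>x. x \<in> A \<Longrightarrow> h x = f x \<or> x = g (h x)"
proof -
  \<comment> \<open>A fixed point of this map is a set \<open>S\<close> for which \<open>g\<close>
    maps the complement in \<open>B\<close> of the image of \<open>S\<close> under \<open>f\<close>
    onto \<open>A - S\<close>, so that \<open>f\<close> and the inverse of \<open>g\<close> can be
    glued.\<close>
  define S where "S = lfp (\<lambda>S. A - g ` (B - f ` S))"
  have "mono (\<lambda>S. A - g ` (B - f ` S))"
    by (rule monoI) blast
  then have S: "S = A - g ` (B - f ` S)"
    unfolding S_def by (rule lfp_unfold)
  define h where "h = (\<lambda>x. if x \<in> S then f x else inv_into B g x)"
  have SA: "S \<subseteq> A" using S by blast
  have AS: "A - S = g ` (B - f ` S)" using S g by blast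
  have "bij_betw h S (f ` S)"
    by (rule bij_betw_cong[THEN iffD1, of S f])
      (use f SA in \<open>auto simp: h_def bij_betw_def inj_on_subset\<close>)
  moreover have "bij_betw h (A - S) (B - f ` S)"
  proof (rule bij_betw_cong[THEN iffD1])
    have "bij_betw g (B - f ` S) (A - S)"
      unfolding AS using g(1) by (simp add: bij_betw_def inj_on_diff)
    moreover have "inv_into (B - f ` S) g x = inv_into B g x" if "x \<in> A - S" for x
      using that g(1) unfolding AS by (auto simp: inv_into_f_f inj_on_diff)
    ultimately show "bij_betw (inv_into B g) (A - S) (B - f ` S)"
      using bij_betw_cong bij_betw_inv_into by blast
  qed (auto simp: h_def)
  ultimately have "bij_betw h (S \<union> (A - S)) (f ` S \<union> (B - f ` S))"
    by (rule bij_betw_combine) blast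
  moreover have "S \<union> (A - S) = A" "f ` S \<union> (B - f ` S) = B"
    using SA f by auto
  moreover have "h x = f x \<or> x = g (h x)" if "x \<in> A" for x
  proof (cases "x \<in> S")
    case False
    then have "x \<in> g ` B" using that AS by blast
    then show ?thesis using False by (simp add: h_def f_inv_into_f)
  qed (simp add: h_def)
  ultimately show ?thesis using that by metis
qed

section \<open>Homeomorphisms between open subsets\<close>

text \<open>
  Meant for open \<open>U\<close> and \<open>V\<close>, where it says that \<open>f\<close> restricts to a homeomorphism;
  openness of subsets is tested in \<open>X\<close>.
\<close>

definition homeo_on :: "'a topology \<Rightarrow> 'a set \<Rightarrow> 'a set \<Rightarrow> ('a \<Rightarrow> 'a) \<Rightarrow> bool" where
  "homeo_on X U V f \<longleftrightarrow> bij_betw f U V \<and> (\<forall>W\<subseteq>U. openin X (f ` W) \<longleftrightarrow> openin X W)"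

lemma homeo_onD:
  assumes "homeo_on X U V f"
  shows "f ` U = V" "inj_on f U" "W \<subseteq> U \<Longrightarrow> openin X (f ` W) \<longleftrightarrow> openin X W"
    "x \<in> U \<Longrightarrow> f x \<in> V"
  using assms by (auto simp: homeo_on_def bij_betw_def)

lemma homeo_on_cong: "homeo_on X U V f \<Longrightarrow> (\<And>x. x \<in> U \<Longrightarrow> g x = f x) \<Longrightarrow> homeo_on X U V g"
  unfolding homeo_on_def by (smt (verit, best) bij_betw_cong image_cong subsetD)

lemma homeo_on_ident: "(\<And>x. x \<in> U \<Longrightarrow> f x = x) \<Longrightarrow> homeo_on X U U f"
  by (rule homeo_on_cong[of X U U id]) (auto simp: homeo_on_def)

lemma homeo_on_comp: "homeo_on X U V f \<Longrightarrow> homeo_on X V W g \<Longrightarrow> homeo_on X U W (g \<circ> f)"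
  unfolding homeo_on_def
  by (metis bij_betw_imp_surj_on bij_betw_trans image_comp image_mono)

lemma homeo_on_inv:
  assumes "homeo_on X U V f"
  shows "homeo_on X V U (inv_into U f)"
proof -
  have "bij_betw (inv_into U f) V U"
    using assms by (simp add: bij_betw_inv_into homeo_on_def)
  moreover have "openin X (inv_into U f ` W) \<longleftrightarrow> openin X W" if "W \<subseteq> V" for W
  proof -
    have "f ` (inv_into U f ` W) = W"
      using that homeo_onD(1)[OF assms] by (auto simp: image_image f_inv_into_f intro!: image_eqI)
    moreover have "inv_into U f ` W \<subseteq> U"
      using that homeo_onD(1)[OF assms] by (auto simp: inv_into_into)
    ultimately show ?thesis
      using homeo_onD(3)[OF assms] by metis
  qed
  ultimately show ?thesis by (simp add: homeo_on_def)
qed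

lemma homeo_on_sub: "homeo_on X U V f \<Longrightarrow> W \<subseteq> U \<Longrightarrow> homeo_on X W (f ` W) f"
  by (auto simp: homeo_on_def bij_betw_def inj_on_subset)

text \<open>Openness of the pieces allows openness to be tested piece by piece. Injectivity is
  assumed on the whole union, not derived from disjoint images, so that increasing unions are
  covered too.\<close>

lemma homeo_on_UN:
  assumes "\<And>i. i \<in> I \<Longrightarrow> homeo_on X (U i) (V i) f" "\<And>i. i \<in> I \<Longrightarrow> openin X (U i)"
    and "inj_on f (\<Union>i\<in>I. U i)"
  shows "homeo_on X (\<Union>i\<in>I. U i) (\<Union>i\<in>I. V i) f"
proof -
  let ?U = "\<Union>i\<in>I. U i"
  have oV: "openin X (V i)" if "i \<in> I" for i
    using assms(1,2) that homeo_onD(1,3) by (metis order_refl)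
  have bij: "bij_betw f ?U (\<Union>i\<in>I. V i)"
    using assms(3) homeo_onD(1)[OF assms(1)] by (simp add: bij_betw_def image_UN)
  moreover have "openin X (f ` W) \<longleftrightarrow> openin X W" if W: "W \<subseteq> ?U" for W
  proof
    assume o: "openin X W"
    have "W = (\<Union>i\<in>I. W \<inter> U i)" using W by auto
    then have "f ` W = (\<Union>i\<in>I. f ` (W \<inter> U i))" by (metis image_UN)
    moreover have "openin X (f ` (W \<inter> U i))" if "i \<in> I" for i
      using homeo_onD(3)[OF assms(1)[OF that], of "W \<inter> U i"] assms(2)[OF that] o by auto
    ultimately show "openin X (f ` W)" by (metis (no_types, lifting) imageE openin_Union)
  next
    assume o: "openin X (f ` W)"
    have "openin X (W \<inter> U i)" if "i \<in> I" for i
    proof -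
      have "f ` (W \<inter> U i) = f ` W \<inter> f ` U i"
        using assms(3) W that by (intro inj_on_image_Int[of f ?U]) auto
      then have "openin X (f ` (W \<inter> U i))"
        using o oV[OF that] homeo_onD(1)[OF assms(1)[OF that]] by auto
      then show ?thesis
        using homeo_onD(3)[OF assms(1)[OF that], of "W \<inter> U i"] by auto
    qed
    moreover have "W = (\<Union>i\<in>I. W \<inter> U i)" using W by auto
    ultimately show "openin X W" by (metis (no_types, lifting) imageE openin_Union)
  qed
  ultimately show ?thesis by (auto simp: homeo_on_def)
qed

lemma homeo_on_disjoint_UN:
  assumes f: "\<And>i. i \<in> I \<Longrightarrow> homeo_on X (U i) (V i) f" and o: "\<And>i. i \<in> I \<Longrightarrow> openin X (U i)"
    and d: "\<And>i j. i \<in> I \<Longrightarrow> j \<in> I \<Longrightarrow> i \<noteq> j \<Longrightarrow> V i \<inter> V j = {}"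
  shows "homeo_on X (\<Union>i\<in>I. U i) (\<Union>i\<in>I. V i) f"
proof (rule homeo_on_UN[OF f o])
  show "inj_on f (\<Union>i\<in>I. U i)"
  proof (rule inj_onI)
    fix x y assume "x \<in> (\<Union>i\<in>I. U i)" "y \<in> (\<Union>i\<in>I. U i)" and e: "f x = f y"
    then obtain i j where ij: "i \<in> I" "x \<in> U i" "j \<in> I" "y \<in> U j" by auto
    then have "f x \<in> V i" "f y \<in> V j" using homeo_onD(4)[OF f] by auto
    then have "i = j" using d ij e by fastforce
    then show "x = y" using ij e homeo_onD(2)[OF f] by (meson inj_onD)
  qed
qed

lemma homeo_on_Un:
  assumes "homeo_on X U V f" "homeo_on X U' V' f" "openin X U" "openin X U'" "V \<inter> V' = {}"
  shows "homeo_on X (U \<union> U') (V \<union> V') f"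
  using homeo_on_disjoint_UN[of "UNIV :: bool set" X "\<lambda>b. if b then U else U'" "\<lambda>b. if b then V else V'" f]
    assms by (auto simp: UNIV_bool Int_commute Un_commute)

lemma homeo_on_openin: "homeo_on X U V f \<Longrightarrow> openin X U \<Longrightarrow> openin X V"
  using homeo_onD(1,3) by (metis order_refl)

lemma homeo_on_compactin:
  assumes f: "homeo_on X U V f" and o: "openin X U" and C: "compactin X C" "C \<subseteq> U"
  shows "compactin X (f ` C)"
proof -
  have UV: "U \<subseteq> topspace X" "V \<subseteq> topspace X"
    using o homeo_on_openin[OF f o] by (auto dest: openin_subset)
  have "continuous_map (subtopology X U) X f"
    unfolding continuous_map
  proof (intro conjI allI impI)
    show "f ` topspace (subtopology X U) \<subseteq> topspace X"
      using UV homeo_onD(1)[OF f] by auto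
    fix W assume W: "openin X W"
    have "f ` {x \<in> U. f x \<in> W} = V \<inter> W" using homeo_onD(1)[OF f] by auto
    then have "openin X {x \<in> U. f x \<in> W}"
      using homeo_onD(3)[OF f, of "{x \<in> U. f x \<in> W}"] W homeo_on_openin[OF f o] by auto
    moreover have "{x \<in> topspace (subtopology X U). f x \<in> W} = {x \<in> U. f x \<in> W}"
      using UV by auto
    ultimately show "openin (subtopology X U) {x \<in> topspace (subtopology X U). f x \<in> W}"
      by (metis (no_types, lifting) mem_Collect_eq o openin_open_subtopology subsetI)
  qed
  moreover have "compactin (subtopology X U) C"
    using C by (simp add: compactin_subtopology)
  ultimately show ?thesis by (rule image_compactin[rotated])
qed

text \<open>Provides the limit of a back and forth construction. Two points always lie in a common
  stage, which gives injectivity on the union.\<close>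

lemma homeo_on_increasing_UN:
  fixes U V :: "nat \<Rightarrow> 'a set"
  assumes f: "\<And>k. homeo_on X (U k) (V k) (f k)" and o: "\<And>k. openin X (U k)"
    and m: "\<And>k. U k \<subseteq> U (Suc k)" and e: "\<And>k x. x \<in> U k \<Longrightarrow> f (Suc k) x = f k x"
  shows "\<exists>g. homeo_on X (\<Union>k. U k) (\<Union>k. V k) g"
proof -
  have mono: "U i \<subseteq> U j" if "i \<le> j" for i j
    using lift_Suc_mono_le[of U, OF m that] .
  have ext: "f j x = f i x" if "i \<le> j" "x \<in> U i" for i j x
    using that(1)
  proof (induction j rule: dec_induct)
    case (step j)
    then have "x \<in> U j" using mono that by blast
    then show ?case using e step.IH by simp
  qed simp
  define g where "g x = f (LEAST k. x \<in> U k) x" for x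
  have g: "g x = f k x" if "x \<in> U k" for k x
    unfolding g_def by (metis ext that LeastI Least_le)
  show ?thesis
  proof (intro exI homeo_on_UN)
    show "homeo_on X (U k) (V k) g" for k
      using f g by (rule homeo_on_cong)
    show "inj_on g (\<Union>k. U k)"
    proof (rule inj_onI)
      fix x y assume "x \<in> (\<Union>k. U k)" "y \<in> (\<Union>k. U k)" and xy: "g x = g y"
      then obtain i j where "x \<in> U i" "y \<in> U j" by blast
      then have *: "x \<in> U (max i j)" "y \<in> U (max i j)"
        using mono by (meson max.cobounded1 max.cobounded2 subsetD)+
      then show "x = y"
        using xy g homeo_onD(2)[OF f] by (metis inj_onD)
    qed
  qed (use o in auto)
qed

section \<open>Countable compact spaces and their ranks\<close>

definition clopenin :: "'a topology \<Rightarrow> 'a set \<Rightarrow> bool" where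
  "clopenin X U \<longleftrightarrow> openin X U \<and> closedin X U"

lemma clopenin_Un: "clopenin X U \<Longrightarrow> clopenin X V \<Longrightarrow> clopenin X (U \<union> V)"
  and clopenin_Int: "clopenin X U \<Longrightarrow> clopenin X V \<Longrightarrow> clopenin X (U \<inter> V)"
  and clopenin_Diff: "clopenin X U \<Longrightarrow> clopenin X V \<Longrightarrow> clopenin X (U - V)"
  and clopenin_empty: "clopenin X {}"
  and clopenin_topspace: "clopenin X (topspace X)"
  by (auto simp: clopenin_def)

lemma clopenin_UN: "finite I \<Longrightarrow> (\<And>i. i \<in> I \<Longrightarrow> clopenin X (U i)) \<Longrightarrow> clopenin X (\<Union>i\<in>I. U i)"
  by (induction I rule: finite_induct) (auto simp: clopenin_empty clopenin_Un)

lemma clopenin_subset: "clopenin X U \<Longrightarrow> U \<subseteq> topspace X"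
  by (auto simp: clopenin_def dest: openin_subset)

lemma CB_derivative_iff:
  "x \<in> CB_derivative X S \<longleftrightarrow> x \<in> S \<and> (\<nexists>U. openin X U \<and> U \<inter> S = {x})"
  by (auto simp: CB_derivative_def openin_subtopology)

text \<open>The isolated points of \<open>S\<close> are cut out by one open set, the union of all
  open sets that meet \<open>S\<close> in a single point.\<close>

lemma closedin_CB_derivative:
  assumes "closedin X S" shows "closedin X (CB_derivative X S)"
proof -
  have "CB_derivative X S = S - \<Union>{U. openin X U \<and> (\<exists>x. U \<inter> S = {x})}"
  proof (rule Set.set_eqI)
    fix x
    have "(\<exists>U. openin X U \<and> U \<inter> S = {x}) \<longleftrightarrow> (\<exists>U. openin X U \<and> x \<in> U \<and> (\<exists>y. U \<inter> S = {y}))" if "x \<in> S"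
      using that by (metis IntI Int_iff insertI1 singletonD)
    then show "x \<in> CB_derivative X S \<longleftrightarrow> x \<in> S - \<Union>{U. openin X U \<and> (\<exists>x. U \<inter> S = {x})}"
      unfolding CB_derivative_iff by blast
  qed
  then show ?thesis using assms by (auto intro: openin_Union)
qed

lemma CB_deriv_antimono:
  fixes \<gamma> \<delta> :: "'o::wellorder"
  shows "\<gamma> \<le> \<delta> \<Longrightarrow> CB_deriv X \<delta> \<subseteq> CB_deriv X \<gamma>"
proof (induction \<delta> rule: less_induct)
  case (less \<delta>)
  show ?case
  proof (cases "\<gamma> = \<delta>")
    case False
    then have lt: "\<gamma> < \<delta>" using less.prems by simp
    then have nz: "\<not> zero_ordinal \<delta>" by (auto simp: zero_ordinal_def)
    show ?thesis
    proof (cases "successor_ordinal \<delta>")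
      case True
      then obtain \<epsilon> where e: "successor_of \<epsilon> \<delta>" by (auto simp: successor_ordinal_def)
      then have "\<epsilon> < \<delta>" "\<gamma> \<notin> {\<epsilon><..<\<delta>}" by (simp_all add: successor_of_def)
      then have "\<epsilon> < \<delta>" "\<gamma> \<le> \<epsilon>" using lt by auto
      then have "CB_deriv X \<epsilon> \<subseteq> CB_deriv X \<gamma>" by (rule less.IH)
      then show ?thesis unfolding CB_deriv_successor[OF e] CB_derivative_def by blast
    next
      case False
      then show ?thesis using lt by (auto simp: CB_deriv_limit[OF nz])
    qed
  qed simp
qed

lemma closedin_CB_deriv:
  fixes \<delta> :: "'o::wellorder"
  shows "closedin X (CB_deriv X \<delta>)"
proof (induction \<delta> rule: less_induct)
  case (less \<delta>)
  consider "zero_ordinal \<delta>" | "successor_ordinal \<delta>" | "\<not> zero_ordinal \<delta>" "\<not> successor_ordinal \<delta>"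
    by blast
  then show ?case
  proof cases
    case 1 then show ?thesis by (simp add: CB_deriv_zero)
  next
    case 2
    then obtain \<epsilon> where e: "successor_of \<epsilon> \<delta>" by (auto simp: successor_ordinal_def)
    then have "closedin X (CB_deriv X \<epsilon>)" by (intro less.IH) (simp add: successor_of_def)
    then show ?thesis by (simp add: CB_deriv_successor[OF e] closedin_CB_derivative)
  next
    case 3
    then have "{..<\<delta>} \<noteq> {}" by (simp add: zero_ordinal_def)
    then have "closedin X (\<Inter>\<beta><\<delta>. CB_deriv X \<beta>)"
      by (rule closedin_INT) (simp add: less.IH)
    then show ?thesis by (simp only: CB_deriv_limit[OF 3])
  qed
qed

lemma CB_deriv_subset: "CB_deriv X \<delta> \<subseteq> topspace X"
  by (rule closedin_subset[OF closedin_CB_deriv])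

lemma successor_of_exists:
  fixes \<delta> \<gamma> :: "'o::wellorder"
  assumes "\<delta> < \<gamma>"
  obtains \<epsilon> where "successor_of \<delta> \<epsilon>" "\<epsilon> \<le> \<gamma>"
proof (rule that)
  show "successor_of \<delta> (LEAST \<epsilon>. \<delta> < \<epsilon>)"
    using LeastI[of "\<lambda>\<epsilon>. \<delta> < \<epsilon>", OF assms] not_less_Least[of _ "\<lambda>\<epsilon>. \<delta> < \<epsilon>"]
    unfolding successor_of_def by (metis all_not_in_conv greaterThanLessThan_iff)
  show "(LEAST \<epsilon>. \<delta> < \<epsilon>) \<le> \<gamma>"
    using assms by (rule Least_le)
qed

text \<open>The Cantor-Bendixson rank of \<open>x\<close> is exactly \<open>\<delta>\<close>. It is
  phrased by isolation because \<open>\<delta>\<close> may be the largest element of its type, in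
  which case the next derivative has no index.\<close>

definition has_rank :: "'a topology \<Rightarrow> 'o::wellorder \<Rightarrow> 'a \<Rightarrow> bool" where
  "has_rank X \<delta> x \<longleftrightarrow> (\<exists>U. openin X U \<and> U \<inter> CB_deriv X \<delta> = {x})"

lemma has_rank_imp_notin:
  assumes "has_rank X \<delta> x" "\<delta> < \<gamma>"
  shows "x \<notin> CB_deriv X \<gamma>"
proof -
  obtain \<epsilon> where e: "successor_of \<delta> \<epsilon>" "\<epsilon> \<le> \<gamma>" using successor_of_exists[OF assms(2)] .
  have "x \<notin> CB_deriv X \<epsilon>"
    unfolding CB_deriv_successor[OF e(1)] CB_derivative_iff using assms(1) by (auto simp: has_rank_def)
  then show ?thesis using CB_deriv_antimono[OF e(2), of X] by blast
qed

text \<open>The least index whose derivative misses \<open>x\<close> is neither zero nor a limit;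
  its predecessor is the rank.\<close>

lemma has_rank_exists:
  fixes \<gamma> :: "'o::wellorder"
  assumes "x \<in> topspace X" "x \<notin> CB_deriv X \<gamma>"
  obtains \<delta> where "\<delta> < \<gamma>" "has_rank X \<delta> x"
proof -
  define \<mu> :: 'o where "\<mu> = (LEAST \<mu>. x \<notin> CB_deriv X \<mu>)"
  have \<mu>: "x \<notin> CB_deriv X \<mu>" unfolding \<mu>_def by (rule LeastI[of "\<lambda>\<mu>. x \<notin> CB_deriv X \<mu>" \<gamma>]) (rule assms(2))
  have le: "\<mu> \<le> \<gamma>" unfolding \<mu>_def using assms(2) by (rule Least_le)
  have below: "x \<in> CB_deriv X \<epsilon>" if "\<epsilon> < \<mu>" for \<epsilon>
    using that not_less_Least unfolding \<mu>_def by blast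
  have "\<not> zero_ordinal \<mu>" using \<mu> assms(1) CB_deriv_zero by metis
  moreover have "successor_ordinal \<mu>"
  proof (rule ccontr)
    assume "\<not> successor_ordinal \<mu>"
    then have "CB_deriv X \<mu> = (\<Inter>\<beta><\<mu>. CB_deriv X \<beta>)" by (rule CB_deriv_limit[OF calculation])
    then show False using \<mu> below by auto
  qed
  ultimately obtain \<delta> where d: "successor_of \<delta> \<mu>" by (auto simp: successor_ordinal_def)
  then have "\<delta> < \<mu>" by (simp add: successor_of_def)
  moreover have "has_rank X \<delta> x"
    using \<mu> below[OF calculation] unfolding CB_deriv_successor[OF d] CB_derivative_iff has_rank_def
    by blast
  ultimately show ?thesis using le by (intro that[of \<delta>]) auto
qed

section \<open>Clopen neighbourhoods and back and forth in countable compact Hausdorff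
  spaces\<close>

locale countable_compact =
  fixes X :: "'a topology"
  assumes compact: "compact_space X" and Hausdorff: "Hausdorff_space X"
    and countable: "countable (topspace X)"
begin

text \<open>A continuous function separating \<open>x\<close> from the complement of
  \<open>U\<close> has a countable image, so it omits some \<open>t\<close> between 0 and 1, and the
  sublevel set at \<open>t\<close> is both open and closed.\<close>

lemma clopen_nbhd:
  assumes "openin X U" "x \<in> U"
  obtains K where "clopenin X K" "x \<in> K" "K \<subseteq> U"
proof -
  have "completely_regular_space X"
    using compact Hausdorff compact_Hausdorff_imp_regular_space
      compact_Hausdorff_or_regular_imp_normal_space normal_imp_completely_regular_space by blast
  then obtain f where f: "continuous_map X euclideanreal f" "f x = 0" "f ` (topspace X - U) \<subseteq> {1}"
    using assms unfolding completely_regular_space_alt' by meson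
  have "countable (f ` topspace X)" using countable by blast
  then obtain t where t: "0 < t" "t < 1" "t \<notin> f ` topspace X"
    using uncountable_open_interval[of 0 "1::real"]
    by (metis countable_subset greaterThanLessThan_iff subsetI zero_less_one)
  let ?K = "{y \<in> topspace X. f y \<in> {..<t}}"
  have "?K = {y \<in> topspace X. f y \<in> {..t}}" using t(3) by force
  moreover have "closedin X {y \<in> topspace X. f y \<in> {..t}}"
    using f(1) by (rule closedin_continuous_map_preimage) simp
  moreover have "openin X ?K"
    using f(1) by (rule openin_continuous_map_preimage) simp
  ultimately have "clopenin X ?K" by (simp add: clopenin_def)
  moreover have "x \<in> ?K" using assms f(2) t(1) openin_subset by fastforce
  moreover have "?K \<subseteq> U" using f(3) t(2) by fastforce
  ultimately show ?thesis using that by blast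
qed

lemma clopenin_compactin: "clopenin X K \<Longrightarrow> compactin X K"
  using compact by (simp add: clopenin_def closedin_compact_space)

lemma compactin_clopenin: "compactin X K \<Longrightarrow> openin X K \<Longrightarrow> clopenin X K"
  by (simp add: Hausdorff clopenin_def compactin_imp_closedin)

lemma finite_closedin: "finite F \<Longrightarrow> F \<subseteq> topspace X \<Longrightarrow> closedin X F"
  by (simp add: closedin_Hausdorff_finite[OF Hausdorff])

text \<open>\<open>U\<close> and \<open>V\<close> are the one-point compactifications of \<open>U - {p}\<close> and \<open>V - {q}\<close>.\<close>

lemma homeo_on_insert_point:
  assumes f: "homeo_on X (U - {p}) (V - {q}) f" and U: "clopenin X U" "p \<in> U" and V: "clopenin X V" "q \<in> V"
  shows "homeo_on X U V (f(p := q))"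
proof -
  have op: "openin X (U - {p})" "openin X (V - {q})"
    using U V finite_closedin[of "{p}"] finite_closedin[of "{q}"] clopenin_subset[OF U(1)] clopenin_subset[OF V(1)]
    by (auto simp: clopenin_def)
  \<comment> \<open>The case with content is a neighbourhood \<open>W\<close> of \<open>p\<close>:
    its complement in \<open>U\<close> is compact, hence has a closed image. The statement is
    general in \<open>g\<close> so that it also serves for the inverse map.\<close>
  have ext: "openin X (g ` W)"
    if g: "homeo_on X (U - {p}) (V - {q}) g" and U: "clopenin X U" "p \<in> U" and V: "clopenin X V" "q \<in> V"
      and W: "W \<subseteq> U" "openin X W" "p \<in> W" "g p = q" and op: "openin X (U - {p})" for U V p q g W
  proof -
    have "compactin X (U - W)"
      using U W(2) by (auto simp: clopenin_def intro: closedin_compact_space[OF compact])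
    then have "compactin X (g ` (U - W))"
      using W(3) by (intro homeo_on_compactin[OF g op]) auto
    then have "closedin X (g ` (U - W))" by (rule compactin_imp_closedin[OF Hausdorff])
    then have "openin X (V - g ` (U - W))" using V by (auto simp: clopenin_def)
    moreover have "g ` W = V - g ` (U - W)"
    proof -
      have "inj_on g (insert p (U - {p}))"
        unfolding inj_on_insert using homeo_onD(1,2)[OF g] W(4) by auto
      then have "inj_on g U" using U(2) by (simp add: insert_absorb)
      then have "g ` (U - W) = g ` U - g ` W" using W(1) by (intro inj_on_image_set_diff[of g U]) auto
      moreover have "g ` U = V"
      proof -
        have "g ` insert p (U - {p}) = insert q (V - {q})"
          unfolding image_insert homeo_onD(1)[OF g] W(4) ..
        then show ?thesis using U(2) V(2) by (simp add: insert_absorb)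
      qed
      ultimately show ?thesis using W(1) by auto
    qed
    ultimately show ?thesis by simp
  qed
  define h where "h = f(p := q)"
  have h: "homeo_on X (U - {p}) (V - {q}) h" "h p = q"
    by (rule homeo_on_cong[OF f]) (simp_all add: h_def)
  have bij: "bij_betw h U V"
    using h U(2) V(2) notIn_Un_bij_betw3[of p "U - {p}" h "V - {q}"]
    by (auto simp: homeo_on_def insert_absorb)
  define k where "k = inv_into U h"
  have hk: "k (h x) = x" if "x \<in> U" for x
    using that bij by (simp add: k_def bij_betw_inv_into_left)
  have k: "homeo_on X (V - {q}) (U - {p}) k"
  proof (rule homeo_on_cong[OF homeo_on_inv[OF h(1)]])
    fix y assume "y \<in> V - {q}"
    then obtain x where "x \<in> U - {p}" "y = h x" using homeo_onD(1)[OF h(1)] by blast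
    then show "k y = inv_into (U - {p}) h y"
      using hk homeo_onD(2)[OF h(1)] by (simp add: inv_into_f_f)
  qed
  have "openin X (h ` W) \<longleftrightarrow> openin X W" if W: "W \<subseteq> U" for W
  proof (cases "p \<in> W")
    case True
    have "k ` (h ` W) = W" using W hk by (force simp: image_image)
    moreover have "h ` W \<subseteq> V" using W bij by (auto simp: bij_betw_def)
    moreover have "q \<in> h ` W" "k q = p" using True h(2) hk[OF U(2)] by auto
    ultimately show ?thesis
      using ext[OF h(1) U V W] ext[OF k V U, of "h ` W"] True h(2) op by auto
  next
    case False
    then show ?thesis using W homeo_onD(3)[OF h(1), of W] by auto
  qed
  then show ?thesis using bij by (simp add: homeo_on_def h_def)
qed

lemma has_rank_clopen:
  assumes "has_rank X \<delta> x" "openin X W" "x \<in> W"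
  obtains K where "clopenin X K" "x \<in> K" "K \<subseteq> W" "K \<inter> CB_deriv X \<delta> = {x}"
proof -
  obtain U where U: "openin X U" "U \<inter> CB_deriv X \<delta> = {x}" using assms by (auto simp: has_rank_def)
  obtain K where "clopenin X K" "x \<in> K" "K \<subseteq> U \<inter> W"
    using clopen_nbhd[of "U \<inter> W" x] U assms by blast
  then show ?thesis using that U by blast
qed

text \<open>Countability lets the points of \<open>U\<close> and \<open>V\<close> be treated one by
  one. At every stage the map built so far has clopen domain and range, so a new piece can be glued
  on without any compatibility condition.\<close>

lemma back_and_forth:
  assumes o: "openin X U" "openin X V"
    and forth: "\<And>A B x. clopenin X A \<Longrightarrow> A \<subseteq> U \<Longrightarrow> clopenin X B \<Longrightarrow> B \<subseteq> V \<Longrightarrow> x \<in> U - A \<Longrightarrow>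
      \<exists>A' B' f. clopenin X A' \<and> clopenin X B' \<and> x \<in> A' \<and> A' \<subseteq> U - A \<and> B' \<subseteq> V - B \<and> homeo_on X A' B' f"
    and bck: "\<And>A B y. clopenin X A \<Longrightarrow> A \<subseteq> U \<Longrightarrow> clopenin X B \<Longrightarrow> B \<subseteq> V \<Longrightarrow> y \<in> V - B \<Longrightarrow>
      \<exists>A' B' f. clopenin X A' \<and> clopenin X B' \<and> y \<in> B' \<and> A' \<subseteq> U - A \<and> B' \<subseteq> V - B \<and> homeo_on X A' B' f"
  shows "\<exists>f. homeo_on X U V f"
proof -
  define P where "P = (\<lambda>(A, B, f). clopenin X A \<and> A \<subseteq> U \<and> clopenin X B \<and> B \<subseteq> V \<and> homeo_on X A B f)"
  define E where "E = (\<lambda>(A :: 'a set, B :: 'a set, f :: 'a \<Rightarrow> 'a) (A', B', f'). A \<subseteq> A' \<and> B \<subseteq> B' \<and> (\<forall>x\<in>A. f' x = f x))"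
  have E_trans: "E s s' \<Longrightarrow> E s' s'' \<Longrightarrow> E s s''" for s s' s''
    by (cases s; cases s'; cases s'') (auto simp: E_def subset_iff)
  have join: "\<exists>s'. P s' \<and> E (A, B, f) s' \<and> A' \<subseteq> fst s' \<and> B' \<subseteq> fst (snd s')"
    if "P (A, B, f)" "clopenin X A'" "clopenin X B'" "A' \<subseteq> U - A" "B' \<subseteq> V - B" "homeo_on X A' B' f'"
    for A B f A' B' f'
  proof -
    define g where "g x = (if x \<in> A then f x else f' x)" for x
    have "homeo_on X A B f" using that(1) by (simp add: P_def)
    then have "homeo_on X A B g" by (rule homeo_on_cong) (simp add: g_def)
    moreover have "homeo_on X A' B' g"
      using that(6) by (rule homeo_on_cong) (use that(4) in \<open>auto simp: g_def\<close>)
    ultimately have "homeo_on X (A \<union> A') (B \<union> B') g"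
      using that by (intro homeo_on_Un) (auto simp: P_def clopenin_def)
    then have "P (A \<union> A', B \<union> B', g)"
      using that by (auto simp: P_def clopenin_Un)
    moreover have "E (A, B, f) (A \<union> A', B \<union> B', g)" by (auto simp: E_def g_def)
    ultimately show ?thesis by force
  qed
  have add_left: "\<exists>s'. P s' \<and> E s s' \<and> (x \<in> U \<longrightarrow> x \<in> fst s')" if Ps: "P s" for s x
  proof -
    obtain A B f where s: "s = (A, B, f)" by (cases s)
    show ?thesis
    proof (cases "x \<in> U - A")
      case True
      then obtain A' B' f' where *: "clopenin X A'" "clopenin X B'" "x \<in> A'" "A' \<subseteq> U - A" "B' \<subseteq> V - B" "homeo_on X A' B' f'"
        using forth[of A B x] Ps unfolding s P_def by blast
      from join[OF _ *(1,2,4,5,6)] Ps show ?thesis unfolding s using *(3) by blast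
    next
      case False
      then show ?thesis using Ps by (intro exI[of _ s]) (auto simp: s E_def)
    qed
  qed
  have add_right: "\<exists>s'. P s' \<and> E s s' \<and> (y \<in> V \<longrightarrow> y \<in> fst (snd s'))" if Ps: "P s" for s y
  proof -
    obtain A B f where s: "s = (A, B, f)" by (cases s)
    show ?thesis
    proof (cases "y \<in> V - B")
      case True
      then obtain A' B' f' where *: "clopenin X A'" "clopenin X B'" "y \<in> B'" "A' \<subseteq> U - A" "B' \<subseteq> V - B" "homeo_on X A' B' f'"
        using bck[of A B y] Ps unfolding s P_def by blast
      from join[OF _ *(1,2,4,5,6)] Ps show ?thesis unfolding s using *(3) by blast
    next
      case False
      then show ?thesis using Ps by (intro exI[of _ s]) (auto simp: s E_def)
    qed
  qed
  \<comment> \<open>The guards cover an empty \<open>U\<close> or \<open>V\<close>, where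
    \<open>from_nat_into\<close> returns an arbitrary value.\<close>
  let ?Q = "\<lambda>n s s'. E s s' \<and> (from_nat_into U n \<in> U \<longrightarrow> from_nat_into U n \<in> fst s') \<and>
      (from_nat_into V n \<in> V \<longrightarrow> from_nat_into V n \<in> fst (snd s'))"
  have "\<exists>s. \<forall>n. P (s n) \<and> ?Q n (s n) (s (Suc n))"
  proof (rule dependent_nat_choice[where P = "\<lambda>_. P" and Q = ?Q])
    have "P ({}, {}, id)" by (auto simp: P_def clopenin_empty homeo_on_def)
    then show "\<exists>s. P s" ..
    fix s n assume "P s"
    then obtain s' where s': "P s'" "E s s'" "from_nat_into U n \<in> U \<longrightarrow> from_nat_into U n \<in> fst s'"
      using add_left by blast
    obtain s'' where s'': "P s''" "E s' s''" "from_nat_into V n \<in> V \<longrightarrow> from_nat_into V n \<in> fst (snd s'')"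
      using add_right[OF s'(1)] by blast
    have "fst s' \<subseteq> fst s''" using s''(2) by (cases s'; cases s'') (auto simp: E_def)
    then show "\<exists>s'. P s' \<and> ?Q n s s'"
      using s' s'' E_trans by blast
  qed
  then obtain s where P: "\<And>n. P (s n)" and Q: "\<And>n. ?Q n (s n) (s (Suc n))" by blast
  define A where "A n = fst (s n)" for n
  define B where "B n = fst (snd (s n))" for n
  define f where "f n = snd (snd (s n))" for n
  have s: "s n = (A n, B n, f n)" for n by (simp add: A_def B_def f_def)
  have AB: "clopenin X (A n)" "A n \<subseteq> U" "B n \<subseteq> V" "homeo_on X (A n) (B n) (f n)" for n
    using P[of n] by (auto simp: s P_def)
  have E: "A n \<subseteq> A (Suc n)" "\<And>x. x \<in> A n \<Longrightarrow> f (Suc n) x = f n x" for n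
    using Q[of n] by (auto simp: s E_def)
  have cnt: "countable U" "countable V"
    using o countable countable_subset openin_subset by metis+
  have "x \<in> (\<Union>n. A n)" if "x \<in> U" for x
    using from_nat_into_surj[OF cnt(1) that] Q that s by (metis UN_iff UNIV_I fst_conv)
  then have "(\<Union>n. A n) = U" using AB(2) by blast
  moreover have "y \<in> (\<Union>n. B n)" if "y \<in> V" for y
    using from_nat_into_surj[OF cnt(2) that] Q that s by (metis UN_iff UNIV_I fst_conv snd_conv)
  then have "(\<Union>n. B n) = V" using AB(3) by blast
  moreover have "\<exists>g. homeo_on X (\<Union>n. A n) (\<Union>n. B n) g"
    using AB(1,4) E by (intro homeo_on_increasing_UN[of X A B f]) (auto simp: clopenin_def)
  ultimately show ?thesis by simp
qed

text \<open>No clopen stage of the back and forth exhausts a rank in \<open>\<Gamma>\<close>, so a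
  partner of the same rank is always available outside the part already treated;
  \<open>model\<close> matches small clopen neighbourhoods of the two partners.\<close>

lemma homeo_on_if_same_ranks:
  assumes o: "openin X U" "openin X V"
    and "\<And>x. x \<in> U \<Longrightarrow> \<exists>\<delta>\<in>\<Gamma>. has_rank X \<delta> x" "\<And>x. x \<in> V \<Longrightarrow> \<exists>\<delta>\<in>\<Gamma>. has_rank X \<delta> x"
    and "\<And>K \<delta>. clopenin X K \<Longrightarrow> K \<subseteq> U \<Longrightarrow> \<delta> \<in> \<Gamma> \<Longrightarrow> \<exists>x\<in>U - K. has_rank X \<delta> x"
    and "\<And>K \<delta>. clopenin X K \<Longrightarrow> K \<subseteq> V \<Longrightarrow> \<delta> \<in> \<Gamma> \<Longrightarrow> \<exists>x\<in>V - K. has_rank X \<delta> x"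
    and model: "\<And>\<delta> A B x y. \<delta> \<in> \<Gamma> \<Longrightarrow> clopenin X A \<Longrightarrow> clopenin X B \<Longrightarrow>
      A \<inter> CB_deriv X \<delta> = {x} \<Longrightarrow> B \<inter> CB_deriv X \<delta> = {y} \<Longrightarrow> \<exists>f. homeo_on X A B f"
  shows "\<exists>f. homeo_on X U V f"
proof -
  \<comment> \<open>One half step, stated for arbitrary \<open>U\<close> and \<open>V\<close>:
    exchanging them and inverting the map gives the other half.\<close>
  have *: "\<exists>A' B' f. clopenin X A' \<and> clopenin X B' \<and> x \<in> A' \<and> A' \<subseteq> U - A \<and> B' \<subseteq> V - B \<and> homeo_on X A' B' f"
    if o: "openin X U" "openin X V" and U: "\<And>x. x \<in> U \<Longrightarrow> \<exists>\<delta>\<in>\<Gamma>. has_rank X \<delta> x"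
    and V: "\<And>K \<delta>. clopenin X K \<Longrightarrow> K \<subseteq> V \<Longrightarrow> \<delta> \<in> \<Gamma> \<Longrightarrow> \<exists>x\<in>V - K. has_rank X \<delta> x"
    and AB: "clopenin X A" "clopenin X B" "B \<subseteq> V" "x \<in> U - A" for U V A B x
  proof -
    obtain \<delta> where d: "\<delta> \<in> \<Gamma>" "has_rank X \<delta> x" using U[of x] AB(4) by blast
    obtain y where y: "y \<in> V - B" "has_rank X \<delta> y" using V[OF AB(2,3) d(1)] by blast
    have "openin X (U - A)" "openin X (V - B)" using o AB by (auto simp: clopenin_def)
    then obtain A' B' where 1: "clopenin X A'" "x \<in> A'" "A' \<subseteq> U - A" "A' \<inter> CB_deriv X \<delta> = {x}"
      and 2: "clopenin X B'" "B' \<subseteq> V - B" "B' \<inter> CB_deriv X \<delta> = {y}"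
      using has_rank_clopen d(2) y AB(4) by metis
    from model[OF d(1) 1(1) 2(1) 1(4) 2(3)] show ?thesis using 1 2 by blast
  qed
  show ?thesis
  proof (rule back_and_forth[OF o])
    fix A B y assume AB: "clopenin X A" "A \<subseteq> U" "clopenin X B" "B \<subseteq> V" "y \<in> V - B"
    have "\<exists>B' A' f. clopenin X B' \<and> clopenin X A' \<and> y \<in> B' \<and> B' \<subseteq> V - B \<and> A' \<subseteq> U - A \<and> homeo_on X B' A' f"
      by (rule *[OF o(2,1) assms(4,5) AB(3,1,2,5)])
    then show "\<exists>A' B' f. clopenin X A' \<and> clopenin X B' \<and> y \<in> B' \<and> A' \<subseteq> U - A \<and> B' \<subseteq> V - B \<and> homeo_on X A' B' f"
      using homeo_on_inv by blast
  next
    fix A B x assume AB: "clopenin X A" "A \<subseteq> U" "clopenin X B" "B \<subseteq> V" "x \<in> U - A"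
    show "\<exists>A' B' f. clopenin X A' \<and> clopenin X B' \<and> x \<in> A' \<and> A' \<subseteq> U - A \<and> B' \<subseteq> V - B \<and> homeo_on X A' B' f"
      by (rule *[OF o assms(3,6) AB(1,3,4,5)])
  qed
qed

end

section \<open>Uniqueness of the pieces\<close>

locale CB_space = countable_compact X for X :: "'a topology" +
  fixes \<alpha> \<beta> :: "'o::wellorder"
  assumes successor: "successor_of \<beta> \<alpha>" and finite_top: "finite (CB_deriv X \<alpha>)"
begin

lemma beta_less: "\<beta> < \<alpha>" and less_alpha_iff: "\<delta> < \<alpha> \<longleftrightarrow> \<delta> \<le> \<beta>"
proof -
  show "\<beta> < \<alpha>" using successor by (simp add: successor_of_def)
  have "\<delta> \<notin> {\<beta><..<\<alpha>}" using successor by (simp add: successor_of_def)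
  then show "\<delta> < \<alpha> \<longleftrightarrow> \<delta> \<le> \<beta>" using \<open>\<beta> < \<alpha>\<close> by auto
qed

lemma CB_alpha_subset: "CB_deriv X \<alpha> \<subseteq> CB_deriv X \<beta>"
  using CB_deriv_antimono less_imp_le[OF beta_less] .

text \<open>Supplies the fresh points that the back and forth needs: the points of rank exactly
  \<open>\<delta>\<close> are dense in the derivative with index \<open>\<delta>\<close>.\<close>

lemma has_rank_in:
  fixes \<delta> :: 'o
  assumes W: "openin X W" "x \<in> W" "x \<in> CB_deriv X \<delta>" and le: "\<delta> \<le> \<alpha>"
  shows "\<exists>y\<in>W. has_rank X \<delta> y"
proof (rule ccontr)
  assume none: "\<not> ?thesis"
  \<comment> \<open>Then no derivative up to \<open>\<alpha>\<close> removes a point of \<open>W \<inter> CB_deriv X \<delta>\<close>, so this set is finite.\<close>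
  have "W \<inter> CB_deriv X \<delta> \<subseteq> CB_deriv X \<mu>" if "\<delta> \<le> \<mu>" for \<mu>
    using that
  proof (induction \<mu> rule: less_induct)
    case (less \<mu>)
    show ?case
    proof (cases "\<delta> = \<mu>")
      case False
      with less.prems have lt: "\<delta> < \<mu>" by simp
      then have nz: "\<not> zero_ordinal \<mu>" by (auto simp: zero_ordinal_def)
      show ?thesis
      proof (cases "successor_ordinal \<mu>")
        case True
        then obtain \<epsilon> where e: "successor_of \<epsilon> \<mu>" by (auto simp: successor_ordinal_def)
        then have "\<epsilon> < \<mu>" "\<delta> \<notin> {\<epsilon><..<\<mu>}" by (simp_all add: successor_of_def)
        then have "\<epsilon> < \<mu>" "\<delta> \<le> \<epsilon>" using lt by auto
        then have sub: "W \<inter> CB_deriv X \<delta> \<subseteq> CB_deriv X \<epsilon>" by (rule less.IH)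
        have "x \<in> CB_derivative X (CB_deriv X \<epsilon>)" if x: "x \<in> W" "x \<in> CB_deriv X \<delta>" for x
        proof (rule ccontr)
          assume "x \<notin> CB_derivative X (CB_deriv X \<epsilon>)"
          then obtain U where U: "openin X U" "U \<inter> CB_deriv X \<epsilon> = {x}"
            using sub x unfolding CB_derivative_iff by blast
          have "(U \<inter> W) \<inter> CB_deriv X \<delta> = {x}"
            using sub x U by blast
          moreover have "openin X (U \<inter> W)" using U W by blast
          ultimately have "has_rank X \<delta> x" unfolding has_rank_def by blast
          then show False using none x by blast
        qed
        then show ?thesis by (auto simp: CB_deriv_successor[OF e])
      next
        case False
        have "x \<in> CB_deriv X \<epsilon>" if "\<epsilon> < \<mu>" "x \<in> W" "x \<in> CB_deriv X \<delta>" for x \<epsilon>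
        proof (cases "\<delta> \<le> \<epsilon>")
          case True
          then show ?thesis using less.IH[OF that(1)] that by blast
        next
          case False
          then have "\<epsilon> \<le> \<delta>" by simp
          then show ?thesis using CB_deriv_antimono[of \<epsilon> \<delta> X] that by blast
        qed
        then show ?thesis by (auto simp: CB_deriv_limit[OF nz False])
      qed
    qed simp
  qed
  then have sub: "W \<inter> CB_deriv X \<delta> \<subseteq> CB_deriv X \<alpha>" using le by blast
  let ?F = "CB_deriv X \<alpha> - {x}"
  have "openin X (W - ?F)"
    using W CB_deriv_subset[of X \<alpha>] finite_closedin[of ?F] finite_top by blast
  moreover have "(W - ?F) \<inter> CB_deriv X \<delta> = {x}" using sub W by blast
  ultimately have "has_rank X \<delta> x" unfolding has_rank_def by blast
  then show False using none W by blast
qed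

text \<open>Transfinite induction. Without its top point a piece has only ranks below
  \<open>\<gamma>\<close>, and each of them occurs arbitrarily near that point, hence outside every
  clopen subset that avoids it. Smaller pieces match by induction, and the top point is put back by
  one-point compactification.\<close>

lemma unique_piece:
  assumes "\<gamma> \<le> \<alpha>" "clopenin X U" "clopenin X V" "U \<inter> CB_deriv X \<gamma> = {p}" "V \<inter> CB_deriv X \<gamma> = {q}"
  shows "\<exists>f. homeo_on X U V f \<and> f p = q"
  using assms
proof (induction \<gamma> arbitrary: U V p q rule: less_induct)
  case (less \<gamma>)
  have pq: "p \<in> U" "q \<in> V" using less.prems by auto
  have o: "openin X (U' - {p'})"
    and rk: "\<And>x. x \<in> U' - {p'} \<Longrightarrow> \<exists>\<delta>\<in>{..<\<gamma>}. has_rank X \<delta> x"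
    and big: "\<And>K \<delta>. clopenin X K \<Longrightarrow> K \<subseteq> U' - {p'} \<Longrightarrow> \<delta> \<in> {..<\<gamma>} \<Longrightarrow> \<exists>x\<in>(U' - {p'}) - K. has_rank X \<delta> x"
    if U: "clopenin X U'" "U' \<inter> CB_deriv X \<gamma> = {p'}" for U' p'
  proof -
    have p: "p' \<in> U'" "p' \<in> CB_deriv X \<gamma>" "U' \<subseteq> topspace X" using U clopenin_subset by blast+
    show "openin X (U' - {p'})"
      using U p finite_closedin[of "{p'}"] by (auto simp: clopenin_def)
    show "\<exists>\<delta>\<in>{..<\<gamma>}. has_rank X \<delta> x" if x: "x \<in> U' - {p'}" for x
    proof -
      have "x \<in> topspace X" "x \<notin> CB_deriv X \<gamma>" using x U p by blast+
      then obtain \<delta> where "\<delta> < \<gamma>" "has_rank X \<delta> x" by (rule has_rank_exists)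
      then show ?thesis by blast
    qed
    show "\<exists>x\<in>(U' - {p'}) - K. has_rank X \<delta> x"
      if K: "clopenin X K" "K \<subseteq> U' - {p'}" and d: "\<delta> \<in> {..<\<gamma>}" for K \<delta>
    proof -
      have "openin X (U' - K)" using clopenin_Diff[OF U(1) K(1)] by (simp add: clopenin_def)
      moreover have "p' \<in> U' - K" using p K by blast
      moreover have "p' \<in> CB_deriv X \<delta>" using p(2) CB_deriv_antimono[of \<delta> \<gamma> X] d less_imp_le[of \<delta> \<gamma>] by auto
      moreover have "\<delta> \<le> \<alpha>" using d less.prems(1) by auto
      ultimately have "\<exists>y\<in>U' - K. has_rank X \<delta> y" by (rule has_rank_in)
      then obtain y where y: "y \<in> U' - K" "has_rank X \<delta> y" ..
      have "y \<noteq> p'" using has_rank_imp_notin[OF y(2), of \<gamma>] d p(2) by auto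
      then show ?thesis using y by blast
    qed
  qed
  have "\<exists>f. homeo_on X (U - {p}) (V - {q}) f"
  proof (rule homeo_on_if_same_ranks[where \<Gamma> = "{..<\<gamma>}"])
    fix \<delta> A B x y
    assume "\<delta> \<in> {..<\<gamma>}" "clopenin X A" "clopenin X B" "A \<inter> CB_deriv X \<delta> = {x}" "B \<inter> CB_deriv X \<delta> = {y}"
    moreover from this have "\<delta> < \<gamma>" "\<delta> \<le> \<alpha>" using less.prems(1) by auto
    ultimately show "\<exists>f. homeo_on X A B f" using less.IH[of \<delta> A B x y] by blast
  qed (use o rk big less.prems in blast)+
  then obtain f where "homeo_on X (U - {p}) (V - {q}) f" ..
  then have "homeo_on X U V (f(p := q))"
    using less.prems pq by (intro homeo_on_insert_point)
  then show ?case by (metis fun_upd_same)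
qed

section \<open>Open sets counted by their points of rank \<open>\<beta>\<close>\<close>

text \<open>Outside X^(\<alpha>) the points of X^(\<beta>) are isolated in it, so the set in
  question is compact and discrete.\<close>

lemma finite_CB_beta:
  assumes K: "clopenin X K" "K \<inter> CB_deriv X \<alpha> = {}"
  shows "finite (K \<inter> CB_deriv X \<beta>)"
proof -
  let ?S = "K \<inter> CB_deriv X \<beta>"
  have "compactin X ?S"
    using K(1) closedin_CB_deriv[of X \<beta>] by (auto simp: clopenin_def intro: closedin_compact_space[OF compact])
  moreover have "?S \<inter> X derived_set_of ?S = {}"
  proof -
    have False if x: "x \<in> ?S" "x \<in> X derived_set_of ?S" for x
    proof -
      have "x \<notin> CB_deriv X \<alpha>" using x K by blast
      then obtain U where U: "openin X U" "U \<inter> CB_deriv X \<beta> = {x}"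
        using x unfolding CB_deriv_successor[OF successor] CB_derivative_iff by blast
      then have "x \<in> U" by blast
      then obtain y where "y \<noteq> x" "y \<in> ?S" "y \<in> U"
        using x(2) U(1) unfolding derived_set_of_def by blast
      then show False using U by blast
    qed
    then show ?thesis by blast
  qed
  ultimately show ?thesis
    using discrete_compactin_eq_finite by blast
qed

text \<open>
  These sets are pairwise homeomorphic; they play the role that infinite sets of natural numbers
  play in the Bergman property of the symmetric group.
\<close>

definition half :: "'a set \<Rightarrow> bool" where
  "half V \<longleftrightarrow> openin X V \<and> V \<inter> CB_deriv X \<alpha> = {} \<and> infinite (V \<inter> CB_deriv X \<beta>)"

text \<open>A clopen subset of a half has finitely many points of rank \<open>\<beta>\<close>, so
  infinitely many remain outside it, and near any of these every rank up to \<open>\<beta>\<close>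
  occurs. Hence the back and forth runs with all ranks below \<open>\<alpha>\<close>.\<close>

lemma half_homeo:
  assumes "half U" "half V"
  shows "\<exists>f. homeo_on X U V f"
proof (rule homeo_on_if_same_ranks[where \<Gamma> = "{..<\<alpha>}"])
  have *: "\<exists>\<delta>\<in>{..<\<alpha>}. has_rank X \<delta> x" if "half U" "x \<in> U" for U x
  proof -
    have "x \<in> topspace X" "x \<notin> CB_deriv X \<alpha>"
      using that openin_subset[of X U] by (auto simp: half_def)
    then obtain \<delta> where "\<delta> < \<alpha>" "has_rank X \<delta> x" by (rule has_rank_exists)
    then show ?thesis by blast
  qed
  show "\<And>x. x \<in> U \<Longrightarrow> \<exists>\<delta>\<in>{..<\<alpha>}. has_rank X \<delta> x" "\<And>x. x \<in> V \<Longrightarrow> \<exists>\<delta>\<in>{..<\<alpha>}. has_rank X \<delta> x"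
    using assms * by blast+
  have *: "\<exists>x\<in>U - K. has_rank X \<delta> x" if "half U" "clopenin X K" "K \<subseteq> U" "\<delta> \<in> {..<\<alpha>}" for U K \<delta>
  proof -
    have "finite (K \<inter> CB_deriv X \<beta>)"
      using that by (intro finite_CB_beta) (auto simp: half_def)
    moreover have "U \<inter> CB_deriv X \<beta> \<subseteq> (U - K) \<inter> CB_deriv X \<beta> \<union> K \<inter> CB_deriv X \<beta>" by blast
    ultimately have "infinite ((U - K) \<inter> CB_deriv X \<beta>)"
      using that(1) finite_subset by (auto simp: half_def)
    then obtain x where x: "x \<in> U - K" "x \<in> CB_deriv X \<beta>"
      by (metis Int_iff ex_in_conv finite.emptyI)
    have "\<delta> \<le> \<beta>" using that(4) less_alpha_iff by simp
    then have "x \<in> CB_deriv X \<delta>" using CB_deriv_antimono[of \<delta> \<beta> X] x(2) by blast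
    moreover have "openin X (U - K)" using that by (auto simp: half_def clopenin_def)
    ultimately show ?thesis using x(1) that(4) by (intro has_rank_in) auto
  qed
  show "\<And>K \<delta>. clopenin X K \<Longrightarrow> K \<subseteq> U \<Longrightarrow> \<delta> \<in> {..<\<alpha>} \<Longrightarrow> \<exists>x\<in>U - K. has_rank X \<delta> x"
    "\<And>K \<delta>. clopenin X K \<Longrightarrow> K \<subseteq> V \<Longrightarrow> \<delta> \<in> {..<\<alpha>} \<Longrightarrow> \<exists>x\<in>V - K. has_rank X \<delta> x"
    using assms * by blast+
  show "openin X U" "openin X V" using assms by (auto simp: half_def)
  fix \<delta> A B x y
  assume "\<delta> \<in> {..<\<alpha>}" "clopenin X A" "clopenin X B" "A \<inter> CB_deriv X \<delta> = {x}" "B \<inter> CB_deriv X \<delta> = {y}"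
  moreover from this have "\<delta> \<le> \<alpha>" by simp
  ultimately show "\<exists>f. homeo_on X A B f" using unique_piece[of \<delta> A B x y] less_imp_le by blast
qed

text \<open>With only finitely many points of rank \<open>\<beta>\<close> around it,
  \<open>p\<close> would be isolated in X^(\<beta>) and could not lie in X^(\<alpha>).\<close>

lemma half_punctured:
  assumes U: "clopenin X U" "U \<inter> CB_deriv X \<alpha> = {p}"
  shows "half (U - {p})"
proof -
  have p: "p \<in> U" "p \<in> CB_deriv X \<alpha>" "U \<subseteq> topspace X" using U clopenin_subset by blast+
  have o: "openin X (U - {p})"
    using U p finite_closedin[of "{p}"] by (auto simp: clopenin_def)
  have "infinite ((U - {p}) \<inter> CB_deriv X \<beta>)"
  proof
    assume "finite ((U - {p}) \<inter> CB_deriv X \<beta>)" (is "finite ?F")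
    then have "closedin X ?F" using p by (intro finite_closedin) auto
    then have "openin X (U - ?F)" using U by (auto simp: clopenin_def)
    moreover have "(U - ?F) \<inter> CB_deriv X \<beta> = {p}"
      using p CB_alpha_subset by auto
    ultimately show False
      using p(2) unfolding CB_deriv_successor[OF successor] CB_derivative_iff by blast
  qed
  then show ?thesis using o U(2) by (auto simp: half_def)
qed

text \<open>A half is a disjoint union of clopen blocks with finitely many points of rank
  \<open>\<beta>\<close> each, so infinitely many blocks contain such a point; these are dealt out
  to infinitely many classes.\<close>

lemma half_split:
  assumes V: "half V"
  obtains W :: "nat \<Rightarrow> 'a set" where "(\<Union>n. W n) = V" "\<And>m n. m \<noteq> n \<Longrightarrow> W m \<inter> W n = {}" "\<And>n. half (W n)"
proof -
  let ?Z = "V \<inter> CB_deriv X \<beta>"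
  have oV: "openin X V" "V \<inter> CB_deriv X \<alpha> = {}" "infinite ?Z" using V by (auto simp: half_def)
  have cV: "countable V" "V \<noteq> {}"
    using oV(1,3) countable_subset[OF openin_subset countable] by auto
  define x where "x = from_nat_into V"
  have x: "x n \<in> V" for n using cV by (simp add: x_def from_nat_into)
  have "\<exists>K. clopenin X K \<and> x n \<in> K \<and> K \<subseteq> V" for n
    using clopen_nbhd[OF oV(1) x[of n]] by metis
  then obtain K where K: "\<And>n. clopenin X (K n)" "\<And>n. x n \<in> K n" "\<And>n. K n \<subseteq> V" by metis
  define D where "D = disjointed K"
  have D: "clopenin X (D n)" for n
    unfolding D_def disjointed_def by (intro clopenin_Diff clopenin_UN K) auto
  have UD: "(\<Union>n. D n) = V"
  proof -
    have "(\<Union>n. D n) = (\<Union>n. K n)" by (simp add: D_def UN_disjointed_eq)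
    also have "\<dots> = V"
    proof (intro subset_antisym subsetI)
      fix v assume "v \<in> V"
      then obtain n where "x n = v" using from_nat_into_surj[OF cV(1)] by (auto simp: x_def)
      then show "v \<in> (\<Union>n. K n)" using K(2)[of n] by blast
    qed (use K(3) in blast)
    finally show ?thesis .
  qed
  have disj: "m \<noteq> n \<Longrightarrow> D m \<inter> D n = {}" for m n
    using disjoint_family_disjointed[of K] by (auto simp: D_def disjoint_family_on_def)
  define J where "J = {n. D n \<inter> CB_deriv X \<beta> \<noteq> {}}"
  have "infinite J"
  proof
    assume "finite J"
    moreover have "finite (D n \<inter> CB_deriv X \<beta>)" for n
      using D UD oV(2) by (intro finite_CB_beta) auto
    moreover have "?Z = (\<Union>n\<in>J. D n \<inter> CB_deriv X \<beta>)"
      unfolding J_def using UD by auto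
    ultimately show False using oV(3) by (metis finite_UN_I)
  qed
  define e where "e = enumerate J"
  have e: "inj e" "range e = J"
    unfolding e_def using strict_mono_imp_inj_on[OF strict_mono_enumerate[OF \<open>infinite J\<close>]]
      range_enumerate[OF \<open>infinite J\<close>] .
  \<comment> \<open>Through the pairing of naturals each class receives infinitely many blocks from
    \<open>J\<close>. Blocks without a point of X^(\<beta>) may go anywhere and are put into class
    0.\<close>
  define col where "col n = (if n \<in> J then fst (prod_decode (inv_into UNIV e n)) else 0)" for n
  define W where "W i = (\<Union>n\<in>{n. col n = i}. D n)" for i
  show ?thesis
  proof
    show "(\<Union>i. W i) = V" using UD by (auto simp: W_def)
    show "W i \<inter> W j = {}" if "i \<noteq> j" for i j
    proof -
      have "D m \<inter> D n = {}" if "col m = i" "col n = j" for m n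
        using disj[of m n] that \<open>i \<noteq> j\<close> by blast
      then show ?thesis unfolding W_def by blast
    qed
    fix i
    have "openin X (W i)" unfolding W_def using D by (intro openin_Union) (auto simp: clopenin_def)
    moreover have WV: "W i \<subseteq> V" unfolding W_def UD[symmetric] by blast
    moreover have "infinite (W i \<inter> CB_deriv X \<beta>)"
    proof -
      define y where "y j = (SOME y. y \<in> D (e (prod_encode (i, j))) \<inter> CB_deriv X \<beta>)" for j
      have y: "y j \<in> D (e (prod_encode (i, j))) \<inter> CB_deriv X \<beta>" for j

      proof -
        have "e (prod_encode (i, j)) \<in> J" using e(2) by blast
        then have "\<exists>y. y \<in> D (e (prod_encode (i, j))) \<inter> CB_deriv X \<beta>" by (auto simp: J_def)
        then show ?thesis unfolding y_def by (rule someI_ex)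
      qed
      have "inj y"
      proof (rule injI)
        fix j k assume "y j = y k"
        then have "D (e (prod_encode (i, j))) \<inter> D (e (prod_encode (i, k))) \<noteq> {}" using y[of j] y[of k] by auto
        then have "e (prod_encode (i, j)) = e (prod_encode (i, k))" using disj[of "e (prod_encode (i, j))"] by metis
        then have "prod_encode (i, j) = prod_encode (i, k)" by (rule injD[OF e(1)])
        then show "j = k" by (simp add: prod_encode_eq)
      qed
      moreover have "range y \<subseteq> W i \<inter> CB_deriv X \<beta>"
      proof -
        have "e k \<in> J" for k using e(2) by blast
        then have "col (e (prod_encode (i, j))) = i" for j
          by (simp add: col_def inv_f_f[OF e(1)])
        then show ?thesis using y unfolding W_def by blast
      qed
      ultimately show ?thesis using range_inj_infinite[of y] finite_subset[of "range y"] by blast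
    qed
    ultimately show "half (W i)" using oV(2) unfolding half_def by blast
  qed
qed

end

section \<open>The group of homeomorphisms\<close>

text \<open>A copy of the group on total functions, each the identity outside the space, so that
  product and inverse are plain composition and \<open>inv_into UNIV\<close>.\<close>

definition homeos :: "'a topology \<Rightarrow> ('a \<Rightarrow> 'a) set" where
  "homeos X = {f. homeo_on X (topspace X) (topspace X) f \<and> (\<forall>x. x \<notin> topspace X \<longrightarrow> f x = x)}"

lemma homeos_id: "id \<in> homeos X"
  by (simp add: homeos_def homeo_on_ident)

lemma homeos_comp: "f \<in> homeos X \<Longrightarrow> g \<in> homeos X \<Longrightarrow> f \<circ> g \<in> homeos X"
  using homeo_on_comp by (fastforce simp: homeos_def)

lemma homeos_bij:
  assumes "f \<in> homeos X" shows "bij f"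
proof -
  have "bij_betw f (topspace X) (topspace X)" using assms by (simp add: homeos_def homeo_on_def)
  moreover have "bij_betw f (- topspace X) (- topspace X)"
    using assms by (intro bij_betw_cong[THEN iffD2, OF _ bij_betw_id]) (auto simp: homeos_def)
  ultimately show ?thesis using bij_betw_combine[of f "topspace X" "topspace X" "- topspace X" "- topspace X"] by simp
qed

lemma homeos_inv:
  assumes "f \<in> homeos X" shows "inv_into UNIV f \<in> homeos X"
proof -
  have f: "homeo_on X (topspace X) (topspace X) f" using assms by (simp add: homeos_def)
  note bij = homeos_bij[OF assms]
  have "homeo_on X (topspace X) (topspace X) (inv_into UNIV f)"
  proof (rule homeo_on_cong[OF homeo_on_inv[OF f]])
    fix y assume "y \<in> topspace X"
    then have "inv_into (topspace X) f y \<in> topspace X" "f (inv_into (topspace X) f y) = y"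
      using homeo_onD(1)[OF f] by (auto simp: inv_into_into f_inv_into_f)
    then show "inv_into UNIV f y = inv_into (topspace X) f y" using bij by (metis bij_inv_eq_iff)
  qed
  moreover have "inv_into UNIV f x = x" if "x \<notin> topspace X" for x
  proof -
    have "f x = x" using assms that by (simp add: homeos_def)
    then show ?thesis using inv_f_f[OF bij_is_inj[OF bij], of x] by simp
  qed
  ultimately show ?thesis by (simp add: homeos_def)
qed

lemma homeos_topspace: "f \<in> homeos X \<Longrightarrow> f x \<in> topspace X \<longleftrightarrow> x \<in> topspace X"
  unfolding homeos_def using homeo_onD(4) by force

lemma homeos_openin:
  assumes "f \<in> homeos X" shows "openin X (f ` W) \<longleftrightarrow> openin X W"
proof -
  have "W \<subseteq> topspace X" if "openin X W \<or> openin X (f ` W)"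
    using that homeos_topspace[OF assms] by (meson image_subset_iff openin_subset subsetI subset_iff)
  then show ?thesis using assms homeo_onD(3)[of X "topspace X" "topspace X" f W] by (auto simp: homeos_def)
qed

lemma homeos_clopenin:
  assumes f: "f \<in> homeos X" shows "clopenin X (f ` W) \<longleftrightarrow> clopenin X W"
proof -
  note bij = homeos_bij[OF f]
  have "f ` topspace X = topspace X" using f homeo_onD(1) unfolding homeos_def by blast
  then have "topspace X - f ` W = f ` (topspace X - W)"
    using bij by (metis bij_is_inj image_set_diff)
  then have "openin X (topspace X - f ` W) \<longleftrightarrow> openin X (topspace X - W)"
    using homeos_openin[OF f] by simp
  moreover have "f ` W \<subseteq> topspace X \<longleftrightarrow> W \<subseteq> topspace X"
    using homeos_topspace[OF f] by auto
  ultimately show ?thesis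
    using homeos_openin[OF f] by (auto simp: clopenin_def closedin_def)
qed

text \<open>Derivatives are defined from the topology alone. The invariance makes every
  homeomorphism permute the points of each rank, in particular the finite set X^(\<alpha>).\<close>

lemma homeos_CB_deriv:
  fixes \<gamma> :: "'o::wellorder"
  assumes f: "f \<in> homeos X" shows "f x \<in> CB_deriv X \<gamma> \<longleftrightarrow> x \<in> CB_deriv X \<gamma>"
proof (induction \<gamma> arbitrary: x rule: less_induct)
  case (less \<gamma>)
  note bij = homeos_bij[OF f]
  consider "zero_ordinal \<gamma>" | "successor_ordinal \<gamma>" | "\<not> zero_ordinal \<gamma>" "\<not> successor_ordinal \<gamma>"
    by blast
  then show ?case
  proof cases
    case 1 then show ?thesis by (simp add: CB_deriv_zero homeos_topspace[OF f])
  next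
    case 2
    then obtain \<epsilon> where e: "successor_of \<epsilon> \<gamma>" by (auto simp: successor_ordinal_def)
    have IH: "f x \<in> CB_deriv X \<epsilon> \<longleftrightarrow> x \<in> CB_deriv X \<epsilon>" for x
      by (rule less.IH) (use e in \<open>simp add: successor_of_def\<close>)
    have img: "f ` U \<inter> CB_deriv X \<epsilon> = f ` (U \<inter> CB_deriv X \<epsilon>)" for U
      using IH by auto
    have "(\<exists>U. openin X U \<and> U \<inter> CB_deriv X \<epsilon> = {f x}) \<longleftrightarrow> (\<exists>U. openin X U \<and> U \<inter> CB_deriv X \<epsilon> = {x})"
    proof
      assume "\<exists>U. openin X U \<and> U \<inter> CB_deriv X \<epsilon> = {x}"
      then obtain U where U: "openin X U" "U \<inter> CB_deriv X \<epsilon> = {x}" by blast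
      then have "openin X (f ` U)" "f ` U \<inter> CB_deriv X \<epsilon> = {f x}"
        using homeos_openin[OF f] img[of U] by simp_all
      then show "\<exists>U. openin X U \<and> U \<inter> CB_deriv X \<epsilon> = {f x}" by blast
    next
      assume "\<exists>U. openin X U \<and> U \<inter> CB_deriv X \<epsilon> = {f x}"
      then obtain U where U: "openin X U" "U \<inter> CB_deriv X \<epsilon> = {f x}" by blast
      have "f ` (f -` U) = U" using bij by (simp add: bij_is_surj surj_image_vimage_eq)
      then have "openin X (f -` U)" "f ` (f -` U \<inter> CB_deriv X \<epsilon>) = f ` {x}"
        using homeos_openin[OF f, of "f -` U"] img[of "f -` U"] U by simp_all
      then have "openin X (f -` U)" "f -` U \<inter> CB_deriv X \<epsilon> = {x}"
        using inj_image_eq_iff[OF bij_is_inj[OF bij]] by metis+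
      then show "\<exists>U. openin X U \<and> U \<inter> CB_deriv X \<epsilon> = {x}" by blast
    qed
    then show ?thesis by (simp add: CB_deriv_successor[OF e] CB_derivative_iff IH)
  next
    case 3
    then show ?thesis using less.IH by (auto simp: CB_deriv_limit[OF 3])
  qed
qed

section \<open>Strong boundedness of the homeomorphisms of one piece\<close>

definition homeos_in :: "'a topology \<Rightarrow> 'a set \<Rightarrow> ('a \<Rightarrow> 'a) set" where
  "homeos_in X V = {f \<in> homeos X. \<forall>x. x \<notin> V \<longrightarrow> f x = x}"

lemma homeos_in_iff:
  assumes "f \<in> homeos_in X V" shows "f x \<in> V \<longleftrightarrow> x \<in> V"
proof -
  have "inj f" using assms homeos_bij bij_is_inj by (auto simp: homeos_in_def)
  moreover have "f y = y" if "y \<notin> V" for y using assms that by (simp add: homeos_in_def)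
  ultimately show ?thesis by (metis injD)
qed

lemma homeos_in_homeo_on:
  assumes f: "f \<in> homeos_in X V" and V: "V \<subseteq> topspace X"
  shows "homeo_on X V V f"
proof -
  have "f ` V = V"
  proof
    show "f ` V \<subseteq> V" using homeos_in_iff[OF f] by auto
    have "surj f" using f homeos_bij bij_is_surj unfolding homeos_in_def by blast
    then show "V \<subseteq> f ` V" using homeos_in_iff[OF f] by (metis imageI subsetI surjD)
  qed
  moreover have "homeo_on X (topspace X) (topspace X) f" using f by (simp add: homeos_in_def homeos_def)
  ultimately show ?thesis using homeo_on_sub V by metis
qed

section \<open>Length functions and the commutator trick\<close>

text \<open>Models the distance from the identity in a left-invariant pseudometric; maximality then
  amounts to a bound on every such function.\<close>

locale length_function =
  fixes X :: "'a topology" and len :: "('a \<Rightarrow> 'a) \<Rightarrow> real"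
  assumes len_nonneg: "f \<in> homeos X \<Longrightarrow> 0 \<le> len f"
    and len_comp: "f \<in> homeos X \<Longrightarrow> g \<in> homeos X \<Longrightarrow> len (f \<circ> g) \<le> len f + len g"
    and len_inv: "f \<in> homeos X \<Longrightarrow> len (inv_into UNIV f) = len f"

locale CB_length = CB_space X \<alpha> \<beta> + length_function X len
  for X :: "'a topology" and \<alpha> \<beta> :: "'o::wellorder" and len
begin

text \<open>\<open>Y - {p}\<close> is open but need not be closed, so gluing with the identity is
  not automatic at \<open>p\<close>; continuity there comes from one-point compactification.\<close>

lemma homeos_extend:
  assumes Y: "clopenin X Y" "p \<in> Y" and f: "homeo_on X (Y - {p}) (Y - {p}) f" "\<And>x. x \<notin> Y - {p} \<Longrightarrow> f x = x"
  shows "f \<in> homeos_in X (Y - {p})"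
proof -
  have "f(p := p) = f" using f(2)[of p] by auto
  then have "homeo_on X Y Y f"
    using homeo_on_insert_point[OF f(1) Y(1,2) Y(1,2)] by simp
  moreover have "homeo_on X (topspace X - Y) (topspace X - Y) f"
    using f(2) by (intro homeo_on_ident) auto
  ultimately have "homeo_on X (Y \<union> (topspace X - Y)) (Y \<union> (topspace X - Y)) f"
    using Y by (intro homeo_on_Un) (auto simp: clopenin_def)
  moreover have "Y \<union> (topspace X - Y) = topspace X" using clopenin_subset[OF Y(1)] by auto
  ultimately show ?thesis using f(2) clopenin_subset[OF Y(1)] by (auto simp: homeos_in_def homeos_def)
qed

text \<open>The rest of \<open>Y - {p}\<close> is required to be a half because it has to hold
  infinitely many disjoint copies of \<open>V\<close>.\<close>

lemma length_bounded_on_half: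
  assumes Y: "clopenin X Y" "Y \<inter> CB_deriv X \<alpha> = {p}" and V: "V \<subseteq> Y - {p}" "half V" "half (Y - {p} - V)"
  shows "\<exists>B. \<forall>f\<in>homeos_in X V. len f \<le> B"
proof (rule ccontr)
  assume unbounded: "\<not> ?thesis"
  \<comment> \<open>Disjoint copies \<open>Q i j\<close> of \<open>V = Q i 0\<close> fill the rest. \<open>\<sigma> i\<close> shifts row \<open>i\<close>, and \<open>F\<close> acts like
    \<open>f i\<close> on the copies \<open>Q i j\<close> with \<open>j \<ge> 1\<close>, so \<open>f i\<close> is the commutator of \<open>inv (\<sigma> i)\<close> and \<open>F\<close>. As \<open>\<sigma> i\<close>
    does not depend on \<open>f i\<close>, the latter can be chosen long compared with the former.\<close>
  define O' where "O' = Y - {p}"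
  have pY: "p \<in> Y" using Y by blast
  obtain R :: "nat \<Rightarrow> 'a set" where R: "(\<Union>n. R n) = O' - V" "\<And>m n. m \<noteq> n \<Longrightarrow> R m \<inter> R n = {}" "\<And>n. half (R n)"
    using half_split[OF V(3)] unfolding O'_def by blast
  \<comment> \<open>Enumerates the nonzero integers by naturals: positive ones are lowered by one
    before \<open>int_encode\<close>, which closes the gap at 0.\<close>
  define k where "k j = int_encode (if j > 0 then j - 1 else j)" for j
  have k_inj: "k j = k j' \<Longrightarrow> j \<noteq> 0 \<Longrightarrow> j' \<noteq> 0 \<Longrightarrow> j = j'" for j j'
    by (auto simp: k_def int_encode_eq split: if_splits)
  have k_surj: "\<exists>j. j \<noteq> 0 \<and> k j = m" for m
  proof (cases "int_decode m \<ge> 0")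
    case True
    then show ?thesis by (intro exI[of _ "int_decode m + 1"]) (simp add: k_def)
  next
    case False
    then show ?thesis by (intro exI[of _ "int_decode m"]) (simp add: k_def)
  qed
  define Q where "Q i j = (if j = 0 then V else R (prod_encode (i, k j)))" for i j
  have Q0: "Q i 0 = V" for i by (simp add: Q_def)
  have halfQ: "half (Q i j)" for i j using V(2) R(3) by (simp add: Q_def)
  have oQ: "openin X (Q i j)" for i j using halfQ by (simp add: half_def)
  \<comment> \<open>All rows share \<open>V\<close> as their entry 0. The index set for
    \<open>i\<close> keeps this entry in row \<open>i\<close> only, so that the sets
    \<open>Q\<close> indexed by it are disjoint.\<close>
  define I where "I i = {(i' :: nat, j :: int). j \<noteq> 0 \<or> i' = i}" for i
  have UQ: "(\<Union>(i', j)\<in>I i. Q i' j) = O'" for i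
  proof (intro subset_antisym subsetI)
    fix x assume "x \<in> (\<Union>(i', j)\<in>I i. Q i' j)"
    then obtain i' j where x: "x \<in> Q i' j" by blast
    have "R n \<subseteq> O'" for n using R(1) by blast
    then show "x \<in> O'" using x V(1) by (auto simp: Q_def O'_def split: if_splits)
  next
    fix x assume x: "x \<in> O'"
    show "x \<in> (\<Union>(i', j)\<in>I i. Q i' j)"
    proof (cases "x \<in> V")
      case True
      then have "(i, 0) \<in> I i" "x \<in> Q i 0" by (simp_all add: I_def Q_def)
      then show ?thesis by blast
    next
      case False
      then obtain n where n: "x \<in> R n" using x R(1) by blast
      obtain i' m where im: "n = prod_encode (i', m)" by (metis prod_decode_inverse surj_pair)
      obtain j where "j \<noteq> 0" "k j = m" using k_surj by blast
      then have "(i', j) \<in> I i" "x \<in> Q i' j" using n im by (auto simp: I_def Q_def)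
      then show ?thesis by blast
    qed
  qed
  have Q_disj: "Q i j \<inter> Q i' j' = {}" if "i \<noteq> i' \<or> j \<noteq> j'" "j \<noteq> 0 \<or> j' \<noteq> 0" for i i' j j'
  proof -
    have "V \<inter> R n = {}" for n using R(1) by blast
    moreover have "j \<noteq> 0 \<Longrightarrow> j' \<noteq> 0 \<Longrightarrow> prod_encode (i, k j) \<noteq> prod_encode (i', k j')"
      using that k_inj[of j j'] by (auto simp: prod_encode_eq)
    moreover have "R n \<inter> V = {}" for n using R(1) by blast
    ultimately show ?thesis using that R(2) unfolding Q_def by (cases "j = 0"; cases "j' = 0") (simp_all only: if_True if_False, auto)
  qed
  define P where "P ij = Q (fst ij) (snd ij)" for ij
  have P_disj: "P ij \<inter> P ij' = {}" if "ij \<in> I i" "ij' \<in> I i" "ij \<noteq> ij'" for ij ij' i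
    unfolding P_def using that by (intro Q_disj) (auto simp: I_def prod_eq_iff)
  have UP: "(\<Union>ij\<in>I i. P ij) = O'" for i
    using UQ[of i] by (simp add: P_def case_prod_beta)
  have "\<exists>a. homeo_on X V (Q i j) a \<and> (j = 0 \<longrightarrow> a = id)" for i j
  proof (cases "j = 0")
    case True
    then show ?thesis using homeo_on_ident[of V id X] by (auto simp: Q_def)
  next
    case False
    then show ?thesis using half_homeo[OF V(2) halfQ] by auto
  qed
  then obtain a where a: "\<And>i j. homeo_on X V (Q i j) (a i j)" and a0: "\<And>i. a i 0 = id" by metis
  have aQ: "v \<in> V \<Longrightarrow> a i j v \<in> Q i j" for i j v using homeo_onD(4)[OF a] .
  have Qa: "\<exists>v\<in>V. x = a i j v" if "x \<in> Q i j" for i j x using that homeo_onD(1)[OF a, of i j] by blast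
  have a_inj: "a i j v = a i' j' v' \<Longrightarrow> v \<in> V \<Longrightarrow> v' \<in> V \<Longrightarrow> j = j' \<and> v = v' \<and> (j = 0 \<or> i = i')" for i j v i' j' v'
  proof -
    assume e: "a i j v = a i' j' v'" and v: "v \<in> V" "v' \<in> V"
    have ne: "Q i j \<inter> Q i' j' \<noteq> {}" using aQ[OF v(1), of i j] aQ[OF v(2), of i' j'] e by auto
    then have "j = j' \<and> (j = 0 \<or> i = i')" using Q_disj by metis
    moreover have "v = v'"
    proof (cases "j = 0")
      case True
      then show ?thesis using calculation e by (simp add: a0)
    next
      case False
      then show ?thesis using calculation e v homeo_onD(2)[OF a, of i j] by (auto dest: inj_onD)
    qed
    ultimately show ?thesis by blast
  qed
  have not_V: "a i j v \<notin> V" if "v \<in> V" "j \<noteq> 0" for i j v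
    using a_inj[of i j v i 0 "a i j v"] that by (auto simp: a0)
  have aO: "v \<in> V \<Longrightarrow> a i j v \<in> O'" for i j v
  proof -
    assume "v \<in> V"
    then have "a i j v \<in> Q i j" by (rule aQ)
    moreover have "(i, j) \<in> I i" by (simp add: I_def)
    ultimately show ?thesis using UQ[of i] by blast
  qed

  \<comment> \<open>The description by \<open>THE\<close> is meaningful because \<open>a_inj\<close>
    recovers the column and \<open>v\<close> from the point.\<close>
  define \<sigma> where "\<sigma> i x = (if \<exists>j. \<exists>v\<in>V. x = a i j v then
     (THE y. \<exists>j. \<exists>v\<in>V. x = a i j v \<and> y = a i (j + 1) v) else x)" for i x
  have \<sigma>a: "\<sigma> i (a i j v) = a i (j + 1) v" if "v \<in> V" for i j v
  proof -
    have "(THE y. \<exists>j'. \<exists>v'\<in>V. a i j v = a i j' v' \<and> y = a i (j' + 1) v') = a i (j + 1) v"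
      using that a_inj by (intro the_equality) blast+
    then show ?thesis using that by (auto simp: \<sigma>_def)
  qed
  have \<sigma>_other: "\<sigma> i (a i' j v) = a i' j v" if "v \<in> V" "i' \<noteq> i" "j \<noteq> 0" for i i' j v
    using that a_inj[of i' j v i] by (auto simp: \<sigma>_def)
  have \<sigma>_out: "\<sigma> i x = x" if "x \<notin> O'" for i x
    using that aO by (auto simp: \<sigma>_def)
  have \<sigma>: "\<sigma> i \<in> homeos X" for i
  proof -
    define t where "t ij = (if fst ij = i then (i, snd ij + 1) else ij)" for ij :: "nat \<times> int"
    have t_in: "t ij \<in> I i" if "ij \<in> I i" for ij using that by (auto simp: t_def I_def)
    have t_inj: "inj_on t (I i)" by (auto simp: inj_on_def t_def prod_eq_iff split: if_splits)
    have t_surj: "t ` I i = I i"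
    proof
      show "t ` I i \<subseteq> I i" using t_in by blast
      show "I i \<subseteq> t ` I i"
      proof
        fix ij assume ij: "ij \<in> I i"
        define u where "u = (if fst ij = i then (i, snd ij - 1) else ij)"
        have "ij = t u" by (auto simp: u_def t_def)
        moreover have "u \<in> I i" using ij by (auto simp: u_def I_def)
        ultimately show "ij \<in> t ` I i" by blast
      qed
    qed
    have "homeo_on X (\<Union>ij\<in>I i. P ij) (\<Union>ij\<in>I i. P (t ij)) (\<sigma> i)"
    proof (rule homeo_on_disjoint_UN)
      fix ij assume ij: "ij \<in> I i"
      obtain i' j where ij': "ij = (i', j)" by (cases ij)
      show "openin X (P ij)" using oQ by (simp add: P_def)
      show "homeo_on X (P ij) (P (t ij)) (\<sigma> i)"
      proof (cases "i' = i")
        case True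
        have "homeo_on X (Q i j) (Q i (j + 1)) (a i (j + 1) \<circ> inv_into V (a i j))"
          by (rule homeo_on_comp[OF homeo_on_inv[OF a] a])
        then have "homeo_on X (Q i j) (Q i (j + 1)) (\<sigma> i)"
        proof (rule homeo_on_cong)
          fix x assume "x \<in> Q i j"
          then obtain v where v: "v \<in> V" "x = a i j v" using Qa by blast
          then have "inv_into V (a i j) x = v" using homeo_onD(2)[OF a] by (simp add: inv_into_f_f)
          then show "\<sigma> i x = (a i (j + 1) \<circ> inv_into V (a i j)) x" using v \<sigma>a by simp
        qed
        then show ?thesis using True by (simp add: P_def t_def ij')
      next
        case False
        then have j: "j \<noteq> 0" using ij by (simp add: I_def ij')
        have "homeo_on X (Q i' j) (Q i' j) (\<sigma> i)"
        proof (rule homeo_on_ident)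
          fix x assume "x \<in> Q i' j"
          then obtain v where v: "v \<in> V" "x = a i' j v" using Qa by blast
          then show "\<sigma> i x = x" using \<sigma>_other[OF v(1) False j] by simp
        qed
        then show ?thesis using False by (simp add: P_def t_def ij')
      qed
    next
      fix x y assume xy: "x \<in> I i" "y \<in> I i" "x \<noteq> y"
      then have "t x \<noteq> t y" using t_inj by (auto dest: inj_onD)
      then show "P (t x) \<inter> P (t y) = {}" using t_in xy by (intro P_disj)
    qed
    moreover have "(\<Union>ij\<in>I i. P (t ij)) = (\<Union>ij\<in>t ` I i. P ij)" by blast
    ultimately have "homeo_on X O' O' (\<sigma> i)" using UP[of i] t_surj by simp
    then show ?thesis
      using homeos_extend[OF Y(1) pY] \<sigma>_out by (auto simp: O'_def homeos_in_def)
  qed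

  \<comment> \<open>The term \<open>2 * len (\<sigma> i)\<close> pays for the two occurrences of the
    shift in the commutator; the remainder \<open>i\<close> must then be at most
    \<open>2 * len F\<close>, for every \<open>i\<close>.\<close>
  have "\<exists>f\<in>homeos_in X V. len f > real i + 2 * len (\<sigma> i)" for i
    using unbounded by (meson not_le)
  then obtain f where f: "\<And>i. f i \<in> homeos_in X V" "\<And>i. len (f i) > real i + 2 * len (\<sigma> i)" by metis
  have VX: "V \<subseteq> topspace X" using V(1) clopenin_subset[OF Y(1)] by blast
  have fV: "f i v \<in> V \<longleftrightarrow> v \<in> V" for i v by (rule homeos_in_iff[OF f(1)])
  have f_out: "v \<notin> V \<Longrightarrow> f i v = v" for i v using f(1)[of i] by (simp add: homeos_in_def)
  define F where "F x = (if \<exists>i j. \<exists>v\<in>V. j \<ge> 1 \<and> x = a i j v then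
     (THE y. \<exists>i j. \<exists>v\<in>V. j \<ge> 1 \<and> x = a i j v \<and> y = a i j (f i v)) else x)" for x
  have Fa: "F (a i j v) = a i j (f i v)" if v: "v \<in> V" and j: "j \<ge> 1" for i j v
  proof -
    have "(THE y. \<exists>i' j'. \<exists>v'\<in>V. j' \<ge> 1 \<and> a i j v = a i' j' v' \<and> y = a i' j' (f i' v')) = a i j (f i v)"
    proof (rule the_equality)
      show "\<exists>i' j'. \<exists>v'\<in>V. j' \<ge> 1 \<and> a i j v = a i' j' v' \<and> a i j (f i v) = a i' j' (f i' v')"
        using v j by blast
      fix y assume "\<exists>i' j'. \<exists>v'\<in>V. j' \<ge> 1 \<and> a i j v = a i' j' v' \<and> y = a i' j' (f i' v')"
      then obtain i' j' v' where *: "v' \<in> V" "j' \<ge> 1" "a i j v = a i' j' v'" "y = a i' j' (f i' v')" by blast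
      then have "j = j'" "v = v'" "i = i'" using a_inj[OF *(3) v *(1)] by auto
      then show "y = a i j (f i v)" using * by simp
    qed
    then show ?thesis using v j by (auto simp: F_def)
  qed
  have F_other: "F (a i j v) = a i j v" if "v \<in> V" "j \<le> 0" for i j v
    using that a_inj[of i j v] by (fastforce simp: F_def)
  have F_V: "F v = v" if "v \<in> V" for v using F_other[of v 0 0] that by (simp add: a0)
  have F_out: "F x = x" if "x \<notin> O'" for x
    using that aO by (auto simp: F_def)
  have F: "F \<in> homeos X"
  proof -
    have "homeo_on X (\<Union>ij\<in>I 0. P ij) (\<Union>ij\<in>I 0. P ij) F"
    proof (rule homeo_on_disjoint_UN)
      fix ij assume ij: "ij \<in> I 0"
      obtain i j where ij': "ij = (i, j)" by (cases ij)
      show "openin X (P ij)" using oQ by (simp add: P_def)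
      have "homeo_on X (Q i j) (Q i j) F"
      proof (cases "j \<ge> 1")
        case True
        have "homeo_on X (Q i j) (Q i j) (a i j \<circ> (f i \<circ> inv_into V (a i j)))"
          by (rule homeo_on_comp[OF homeo_on_comp[OF homeo_on_inv[OF a] homeos_in_homeo_on[OF f(1) VX]] a])
        then show ?thesis
        proof (rule homeo_on_cong)
          fix x assume "x \<in> Q i j"
          then obtain v where v: "v \<in> V" "x = a i j v" using Qa by blast
          then have "inv_into V (a i j) x = v" using homeo_onD(2)[OF a] by (simp add: inv_into_f_f)
          then show "F x = (a i j \<circ> (f i \<circ> inv_into V (a i j))) x" using v Fa True by simp
        qed
      next
        case False
        then have j: "j \<le> 0" by simp
        show ?thesis
        proof (rule homeo_on_ident)
          fix x assume "x \<in> Q i j"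
          then obtain v where "v \<in> V" "x = a i j v" using Qa by blast
          then show "F x = x" using F_other j by simp
        qed
      qed
      then show "homeo_on X (P ij) (P ij) F" by (simp add: P_def ij')
    qed (rule P_disj)
    then have "homeo_on X O' O' F" using UP[of 0] by simp
    then show ?thesis
      using homeos_extend[OF Y(1) pY] F_out by (auto simp: O'_def homeos_in_def)
  qed

  \<comment> \<open>In row \<open>i\<close> the map \<open>f i \<circ> F\<close> acts from column 0
    on and \<open>F\<close> from column 1 on, so the shift by one column turns the former into the
    latter. In the other rows, away from \<open>V\<close>, both \<open>f i\<close> and the shift are
    trivial.\<close>
  have comm: "\<sigma> i \<circ> f i \<circ> F = F \<circ> \<sigma> i" for i
  proof
    fix x
    have "\<sigma> i (f i (F x)) = F (\<sigma> i x)"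
    proof (cases "x \<in> O'")
      case False
      then show ?thesis using \<sigma>_out F_out f_out V(1) by (metis O'_def subsetD)
    next
      case True
      then obtain i' j where ij: "(i', j) \<in> I i" "x \<in> Q i' j" using UQ[of i] by blast
      then obtain v where v: "v \<in> V" "x = a i' j v" using Qa by blast
      have fv: "f i' v \<in> V" using fV v by simp
      show ?thesis
      proof (cases "i' = i")
        case False
        then have j: "j \<noteq> 0" using ij by (simp add: I_def)
        obtain w where w: "w \<in> V" "F x = a i' j w"
        proof (cases "j \<ge> 1")
          case True
          then show thesis using that[of "f i' v"] v fv Fa by simp
        next
          case False
          then show thesis using that[of v] v F_other by simp
        qed
        have "f i (a i' j w) = a i' j w" by (rule f_out[OF not_V[OF w(1) j]])
        then show ?thesis using \<sigma>_other[OF w(1) False j] \<sigma>_other[OF v(1) False j] w v by simp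
      next
        case True
        consider "j \<ge> 1" | "j = 0" | "j = -1" | "j < -1" by linarith
        then show ?thesis
        proof cases
          case 1
          have "f i (a i j (f i v)) = a i j (f i v)" using 1 fv True by (intro f_out not_V) auto
          then show ?thesis using 1 v fv True by (simp add: Fa \<sigma>a)
        next
          case 2
          have "x = v" using 2 v by (simp add: a0)
          then have "\<sigma> i (f i (F x)) = \<sigma> i (a i 0 (f i v))" using v by (simp add: F_V a0)
          also have "\<dots> = a i 1 (f i v)" using \<sigma>a[of "f i v" i 0] fv True by simp
          also have "\<dots> = F (a i 1 v)" using Fa v by simp
          also have "a i 1 v = \<sigma> i x" using \<sigma>a[OF v(1), of i 0] 2 v True by simp
          finally show ?thesis .
        next
          case 3
          have "f i (a i j v) = a i j v" using 3 v by (intro f_out not_V) auto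
          moreover have "\<sigma> i (a i j v) = v" using \<sigma>a[OF v(1), of i j] 3 by (simp add: a0)
          ultimately show ?thesis using 3 v True F_other[OF v(1), of j i] F_V by simp
        next
          case 4
          have "f i (a i j v) = a i j v" using 4 v by (intro f_out not_V) auto
          then show ?thesis using 4 v True F_other[OF v(1), of j i] F_other[OF v(1), of "j + 1" i] \<sigma>a[OF v(1), of i j] by simp
        qed
      qed
    qed
    then show "(\<sigma> i \<circ> f i \<circ> F) x = (F \<circ> \<sigma> i) x" by simp
  qed
  have "real i \<le> 2 * len F" for i
  proof -
    note b = homeos_bij[OF \<sigma>[of i]] homeos_bij[OF F]
    have "f i = inv_into UNIV (\<sigma> i) \<circ> (\<sigma> i \<circ> f i \<circ> F) \<circ> inv_into UNIV F"
      using b by (simp add: fun_eq_iff bij_is_inj bij_is_surj surj_f_inv_f)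
    also have "\<dots> = inv_into UNIV (\<sigma> i) \<circ> (F \<circ> \<sigma> i) \<circ> inv_into UNIV F" by (simp only: comm)
    finally have e: "f i = inv_into UNIV (\<sigma> i) \<circ> (F \<circ> \<sigma> i) \<circ> inv_into UNIV F" .
    have "len (f i) \<le> len (inv_into UNIV (\<sigma> i)) + (len F + len (\<sigma> i)) + len (inv_into UNIV F)"
      unfolding e using \<sigma>[of i] F
      by (intro order_trans[OF len_comp] add_mono homeos_comp homeos_inv order_refl)
    then show ?thesis using f(2)[of i] len_inv[OF F] len_inv[OF \<sigma>[of i]] by linarith
  qed
  then show False using reals_Archimedean2 by (metis not_le)
qed

end

lemma homeos_inI_piecewise:
  assumes V: "openin X V" "closedin X V" and f: "homeo_on X V V f" "\<And>x. x \<notin> V \<Longrightarrow> f x = x"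
  shows "f \<in> homeos_in X V"
proof -
  have "homeo_on X (topspace X - V) (topspace X - V) f"
    using f(2) by (intro homeo_on_ident) auto
  then have "homeo_on X (V \<union> (topspace X - V)) (V \<union> (topspace X - V)) f"
    using V f(1) by (intro homeo_on_Un) auto
  moreover have "V \<union> (topspace X - V) = topspace X" using openin_subset[OF V(1)] by auto
  ultimately show ?thesis using f(2) openin_subset[OF V(1)] by (auto simp: homeos_in_def homeos_def)
qed

section \<open>The displacement argument for a punctured piece\<close>

context CB_length
begin

lemma half_Un: "half U \<Longrightarrow> openin X W \<Longrightarrow> W \<inter> CB_deriv X \<alpha> = {} \<Longrightarrow> half (U \<union> W)"
  by (auto simp: half_def Int_Un_distrib2)

lemma half_superset:
  assumes "half U" "U \<subseteq> W" "openin X W" "W \<inter> CB_deriv X \<alpha> = {}"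
  shows "half W"
  using half_Un[OF assms(1,3,4)] assms(2) by (simp add: Un_absorb1)

lemma half_split2:
  assumes "half V"
  obtains A B where "A \<union> B = V" "A \<inter> B = {}" "half A" "half B"
proof -
  obtain W :: "nat \<Rightarrow> 'a set" where W: "(\<Union>n. W n) = V" "\<And>m n. m \<noteq> n \<Longrightarrow> W m \<inter> W n = {}" "\<And>n. half (W n)"
    using half_split[OF assms] by blast
  define B where "B = (\<Union>n. W (Suc n))"
  have "W 0 \<union> B = V"
  proof -
    have "x \<in> W 0 \<union> B" if "x \<in> W n" for x n using that by (cases n) (auto simp: B_def)
    moreover have "W 0 \<union> B \<subseteq> V" unfolding B_def W(1)[symmetric] by blast
    ultimately show ?thesis using W(1) by blast
  qed
  moreover have "W 0 \<inter> W (Suc n) = {}" for n by (rule W(2)) simp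
  then have "W 0 \<inter> B = {}" by (simp add: B_def Int_UN_distrib)
  moreover have "half B"
  proof -
    have "openin X B" using W(3) unfolding B_def half_def by (intro openin_Union) auto
    moreover have "B \<inter> CB_deriv X \<alpha> = {}" using W(3) unfolding B_def half_def by blast
    ultimately have "half (W 1 \<union> B)" using W(3) by (intro half_Un)
    moreover have "W 1 \<union> B = B" unfolding B_def by force
    ultimately show ?thesis by simp
  qed
  ultimately show ?thesis using that W(3) by blast
qed

lemma len_conj:
  assumes "e \<in> homeos X" "h \<in> homeos X"
  shows "len h \<le> 2 * len e + len (e \<circ> h \<circ> inv_into UNIV e)"
proof -
  note b = homeos_bij[OF assms(1)]
  let ?c = "e \<circ> h \<circ> inv_into UNIV e"
  have c: "?c \<in> homeos X" using assms by (intro homeos_comp homeos_inv)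
  have "inv_into UNIV e (e x) = x" for x using b by (simp add: bij_is_inj)
  then have "h = inv_into UNIV e \<circ> ?c \<circ> e" by (simp add: fun_eq_iff)
  then have "len h = len (inv_into UNIV e \<circ> ?c \<circ> e)" by (rule arg_cong)
  also have "\<dots> \<le> len (inv_into UNIV e \<circ> ?c) + len e"
    by (intro len_comp homeos_comp[of _ X ?c] homeos_inv assms(1) c)
  also have "len (inv_into UNIV e \<circ> ?c) \<le> len (inv_into UNIV e) + len ?c"
    by (intro len_comp homeos_inv assms(1) c)
  finally show ?thesis using len_inv[OF assms(1)] by linarith
qed

text \<open>With infinitely many disjoint halves, each one has a half as its complement, so maps
  fixing part 0, 1 or 2 pointwise have bounded length, and there is spare room for rearrangements.
  An arbitrary map is a product of four such maps.\<close>

lemma length_bounded_on_punctured: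
  assumes Y: "clopenin X Y" "Y \<inter> CB_deriv X \<alpha> = {p}"
  shows "\<exists>B. \<forall>g\<in>homeos_in X (Y - {p}). len g \<le> B"
proof -
  define O' where "O' = Y - {p}"
  have pY: "p \<in> Y" using Y by blast
  have hO: "half O'" unfolding O'_def using Y by (rule half_punctured)
  have O_top: "O' \<subseteq> topspace X" using hO openin_subset by (auto simp: half_def)
  have O_al: "O' \<inter> CB_deriv X \<alpha> = {}" using hO by (simp add: half_def)
  obtain W :: "nat \<Rightarrow> 'a set" where W: "(\<Union>n. W n) = O'" "\<And>m n. m \<noteq> n \<Longrightarrow> W m \<inter> W n = {}" "\<And>n. half (W n)"
    using half_split[OF hO] by blast
  define U where "U S = (\<Union>n\<in>S. W n)" for S
  have oU: "openin X (U S)" for S using W(3) by (auto simp: U_def half_def)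
  have UO: "U S \<subseteq> O'" for S using W(1) by (auto simp: U_def)
  have U_disj: "U S \<inter> U T = {}" if ST: "S \<inter> T = {}" for S T
  proof (rule ccontr)
    assume "U S \<inter> U T \<noteq> {}"
    then obtain x m n where "m \<in> S" "n \<in> T" "x \<in> W m" "x \<in> W n" unfolding U_def by blast
    moreover from this have "m \<noteq> n" using ST by auto
    ultimately show False using W(2)[of m n] by auto
  qed
  have U_Un: "U S \<union> U T = U (S \<union> T)" for S T by (auto simp: U_def)
  have U_compl: "O' - U S = U (- S)" for S
  proof -
    have "U S \<union> U (- S) = O'" using U_Un[of S "- S"] W(1) by (simp add: U_def)
    then show ?thesis using U_disj[of S "- S"] by blast
  qed
  have hU: "half (U S)" if ne: "S \<noteq> {}" for S
  proof -
    obtain n where "n \<in> S" using ne by blast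
    then have "W n \<subseteq> U S" by (auto simp: U_def)
    moreover have "U S \<inter> CB_deriv X \<alpha> = {}" using UO O_al by blast
    ultimately show ?thesis using W(3) oU by (intro half_superset[of "W n" "U S"])
  qed
  have bounded: "\<exists>B. \<forall>f\<in>homeos_in X (O' - U {n}). len f \<le> B" for n
  proof -
    have "Suc n \<in> - {n}" by simp
    then have "- {n} \<noteq> {}" by blast
    moreover have "O' - U (- {n}) = U {n}" using U_compl[of "- {n}"] by simp
    ultimately have "\<exists>B. \<forall>f\<in>homeos_in X (U (- {n})). len f \<le> B"
      using UO hU unfolding O'_def by (intro length_bounded_on_half[OF Y]) auto
    then show ?thesis unfolding U_compl .
  qed
  then obtain b where b: "\<And>n f. f \<in> homeos_in X (O' - U {n}) \<Longrightarrow> len f \<le> b n" by metis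
  define B where "B = Max (b ` {0, 1, 2})"
  have B: "len f \<le> B" if "f \<in> homeos_in X (O' - U {n})" "n \<in> {0, 1, 2}" for n f
    using b[OF that(1)] that(2) unfolding B_def by (meson Max_ge finite.emptyI finite.insertI finite_imageI imageI order_trans)
  \<comment> \<open>\<open>h\<close> agrees with \<open>g\<close> on one of the first two parts and fixes a half \<open>V''\<close> of the third;
    \<open>e\<close> spreads \<open>V''\<close> over the whole third part.\<close>
  have "len g \<le> 4 * B" if g: "g \<in> homeos_in X O'" for g
  proof -
    have gX: "g \<in> homeos X" using g by (simp add: homeos_in_def)
    have gO: "g x \<in> O' \<longleftrightarrow> x \<in> O'" for x by (rule homeos_in_iff[OF g])
    note gbij = homeos_bij[OF gX]
    let ?V3 = "U {2}"
    \<comment> \<open>The images of parts 0 and 1 are disjoint, so they cannot both contain almost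
      all points of rank \<open>\<beta>\<close> of part 2.\<close>
    have "\<exists>n\<in>{0, 1}. infinite ((?V3 - g ` U {n}) \<inter> CB_deriv X \<beta>)"
    proof (rule ccontr)
      assume "\<not> ?thesis"
      then have "finite ((?V3 - g ` U {0}) \<inter> CB_deriv X \<beta> \<union> (?V3 - g ` U {1}) \<inter> CB_deriv X \<beta>)" by simp
      moreover have "g ` U {0} \<inter> g ` U {1} = {}"
        using U_disj[of "{0}" "{1}"] image_Int[OF bij_is_inj[OF gbij], of "U {0}" "U {1}"] by simp
      then have "?V3 \<inter> CB_deriv X \<beta> \<subseteq> (?V3 - g ` U {0}) \<inter> CB_deriv X \<beta> \<union> (?V3 - g ` U {1}) \<inter> CB_deriv X \<beta>" by blast
      ultimately show False using hU[of "{2}"] finite_subset by (auto simp: half_def)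
    qed
    then obtain n where n: "n \<in> {0, 1}" and inf: "infinite ((?V3 - g ` U {n}) \<inter> CB_deriv X \<beta>)" by blast
    let ?V = "U {n}"
    have gV: "openin X (g ` ?V)" "openin X (g ` (O' - ?V))"
      using oU U_compl homeos_openin[OF gX] by auto
    have gO_img: "g ` O' = O'"
    proof
      show "g ` O' \<subseteq> O'" using gO by auto
      show "O' \<subseteq> g ` O'" using gO bij_is_surj[OF gbij] by (metis imageI subsetI surjD)
    qed
    have gcompl: "g ` (O' - ?V) = O' - g ` ?V"
      using gO_img gbij by (simp add: bij_is_inj image_set_diff)
    have V3_V: "?V3 \<inter> ?V = {}" using n by (intro U_disj) auto
    have "?V3 - g ` ?V = ?V3 \<inter> g ` (O' - ?V)" using UO[of "{2}"] gcompl by blast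
    then have "half (?V3 - g ` ?V)"
      using inf oU gV UO[of "{2}"] O_al unfolding half_def by auto
    then obtain V'' M where VM: "V'' \<union> M = ?V3 - g ` ?V" "V'' \<inter> M = {}" "half V''" "half M"
      by (rule half_split2)
    have oV'': "openin X V''" using VM by (simp add: half_def)
    have V''_sub: "V'' \<subseteq> ?V3" "V'' \<inter> g ` ?V = {}" using VM(1) by auto
    define N where "N = (?V3 \<inter> g ` ?V) \<union> M"
    have oN: "openin X N" using oU gV(1) VM(4) by (auto simp: N_def half_def)
    have N: "?V3 - V'' = N" using VM(1,2) unfolding N_def by blast
    have oc: "openin X (O' - V'')"
    proof -
      have "O' - V'' = U (- {2}) \<union> N" using N U_compl[of "{2}"] V''_sub(1) UO[of "{2}"] by blast
      then show ?thesis using oU oN by auto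
    qed
    define R1 where "R1 = O' - V'' - ?V"
    define R2 where "R2 = O' - V'' - g ` ?V"
    have sub: "?V \<subseteq> O'" "g ` ?V \<subseteq> O'" "V'' \<subseteq> O'" "?V \<inter> V'' = {}" "g ` ?V \<inter> V'' = {}"
      using UO[of "{n}"] UO[of "{2}"] V''_sub V3_V gO_img by blast+
    \<comment> \<open>Part 3 lies in this remainder and makes it a half; for \<open>R2\<close> the
      reserve \<open>M\<close>, split off from part 2, plays the same role.\<close>
    have hR1: "half R1"
    proof (rule half_superset[OF hU[of "{3}"]])
      have "U {3} \<inter> U {2} = {}" "U {3} \<inter> ?V = {}" using n by (auto intro!: U_disj)
      then show "U {3} \<subseteq> R1" using V''_sub(1) UO[of "{3}"] unfolding R1_def by blast
      have "R1 = (O' - V'') \<inter> U (- {n})" using U_compl[of "{n}"] unfolding R1_def by blast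
      then show "openin X R1" using oc oU by auto
      show "R1 \<inter> CB_deriv X \<alpha> = {}" using O_al unfolding R1_def by blast
    qed simp
    have hR2: "half R2"
    proof (rule half_superset[OF VM(4)])
      show "M \<subseteq> R2" using VM(1,2) UO[of "{2}"] unfolding R2_def by blast
      have "R2 = (O' - V'') \<inter> g ` (O' - ?V)" unfolding R2_def gcompl by blast
      then show "openin X R2" using oc gV by auto
      show "R2 \<inter> CB_deriv X \<alpha> = {}" using O_al unfolding R2_def by blast
    qed
    obtain k where k: "homeo_on X R1 R2 k" using half_homeo[OF hR1 hR2] by blast
    define h where "h x = (if x \<in> ?V then g x else if x \<in> R1 then k x else x)" for x
    have O_parts: "O' = (?V \<union> R1) \<union> V''" "O' = (g ` ?V \<union> R2) \<union> V''"
      using sub unfolding R1_def R2_def by blast+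
    have "homeo_on X ?V (g ` ?V) h"
    proof (rule homeo_on_cong)
      show "homeo_on X ?V (g ` ?V) g"
        using gX openin_subset[OF oU[of "{n}"]] unfolding homeos_def by (intro homeo_on_sub) auto
    qed (simp add: h_def)
    moreover have "homeo_on X R1 R2 h"
      by (rule homeo_on_cong[OF k]) (auto simp: h_def R1_def)
    moreover have "homeo_on X V'' V'' h"
      using V''_sub V3_V by (intro homeo_on_ident) (auto simp: h_def R1_def)
    ultimately have "homeo_on X ((?V \<union> R1) \<union> V'') ((g ` ?V \<union> R2) \<union> V'') h"
      using oU hR1 oV'' sub
      by (intro homeo_on_Un openin_Un) (auto simp: half_def R2_def)
    then have "homeo_on X O' O' h" using O_parts by simp
    moreover have h_out: "h x = x" if "x \<notin> O'" for x
      using that UO[of "{n}"] by (auto simp: h_def R1_def)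
    ultimately have hin: "h \<in> homeos_in X O'"
      using homeos_extend[OF Y(1) pY] unfolding O'_def by blast
    then have hX: "h \<in> homeos X" by (simp add: homeos_in_def)
    note hbij = homeos_bij[OF hX]
    have hV'': "h x = x" if "x \<in> V''" for x using that V''_sub V3_V by (auto simp: h_def R1_def)
    let ?q = "inv_into UNIV h \<circ> g"
    have q: "?q \<in> homeos X" using hX gX by (intro homeos_comp homeos_inv)
    have "?q x = x" if "x \<notin> O' - ?V" for x
    proof -
      have "g x = h x"
      proof (cases "x \<in> ?V")
        case False
        then have "x \<notin> O'" using that by simp
        then show ?thesis using h_out g by (simp add: homeos_in_def)
      qed (simp add: h_def)
      then show ?thesis using hbij by (simp add: bij_is_inj)
    qed
    then have "len ?q \<le> B" using q n by (intro B[of _ n]) (auto simp: homeos_in_def)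
    have len_g: "len g \<le> len h + B"
    proof -
      have "g = h \<circ> ?q" using hbij by (simp add: fun_eq_iff bij_is_surj surj_f_inv_f)
      then have "len g \<le> len h + len ?q" using len_comp[OF hX q] by simp
      then show ?thesis using \<open>len ?q \<le> B\<close> by simp
    qed

    \<comment> \<open>When \<open>V''\<close> is spread over part 2, the rest of that part has to go
      elsewhere and is absorbed by the parts from 3 on. Parts 0 and 1 stay fixed, so the bound
      \<open>B\<close> applies to \<open>e\<close>.\<close>
    define S where "S = N \<union> U {3..}"
    have hS: "half S"
    proof -
      have "N \<inter> CB_deriv X \<alpha> = {}" using N UO[of "{2}"] O_al by blast
      then have "half (U {3..} \<union> N)" using oN hU[of "{3..}"] by (intro half_Un) auto
      then show ?thesis by (simp add: S_def Un_commute)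
    qed
    obtain k1 where k1: "homeo_on X V'' ?V3 k1" using half_homeo[OF \<open>half V''\<close> hU[of "{2}"]] by blast
    obtain k2 where k2: "homeo_on X S (U {3..}) k2" using half_homeo[OF hS hU[of "{3..}"]] by auto
    define e where "e x = (if x \<in> V'' then k1 x else if x \<in> S then k2 x else x)" for x
    have S_V'': "S \<inter> V'' = {}"
      using V''_sub(1) N U_disj[of "{2}" "{3..}"] unfolding S_def by auto
    have U01: "U {0, 1} \<inter> (V'' \<union> S) = {}"
      using U_disj[of "{0, 1}" "{2}"] U_disj[of "{0, 1}" "{3..}"] V''_sub(1) N unfolding S_def by auto
    have e_out: "e x = x" if "x \<notin> V'' \<union> S" for x using that by (simp add: e_def)
    have "homeo_on X V'' ?V3 e" by (rule homeo_on_cong[OF k1]) (simp add: e_def)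
    moreover have "homeo_on X S (U {3..}) e"
      using S_V'' by (intro homeo_on_cong[OF k2]) (auto simp: e_def)
    moreover have "homeo_on X (U {0, 1}) (U {0, 1}) e"
      using U01 by (intro homeo_on_ident e_out) auto
    ultimately have "homeo_on X ((V'' \<union> S) \<union> U {0, 1}) ((?V3 \<union> U {3..}) \<union> U {0, 1}) e"
      using oU hS oV'' U_disj[of "{2}" "{3..}"] U_disj[of "{2} \<union> {3..}" "{0, 1}"] U_Un[of "{2}" "{3..}"]
      by (intro homeo_on_Un openin_Un) (auto simp: half_def)
    moreover have all: "(?V3 \<union> U {3..}) \<union> U {0, 1} = O'"
    proof -
      have "{2} \<union> {3..} \<union> {0, 1} = (UNIV :: nat set)" by auto
      then show ?thesis using U_Un W(1) by (metis U_def)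
    qed
    moreover have "V'' \<union> S = ?V3 \<union> U {3..}" using N V''_sub(1) unfolding S_def by blast
    ultimately have "homeo_on X O' O' e" by simp
    moreover have "e x = x" if "x \<notin> O'" for x
      using that all \<open>V'' \<union> S = _\<close> by (intro e_out) blast
    ultimately have "e \<in> homeos_in X O'"
      using homeos_extend[OF Y(1) pY] unfolding O'_def by blast
    then have eX: "e \<in> homeos X" by (simp add: homeos_in_def)
    have "e x = x" if "x \<notin> O' - U {0}" for x
    proof (rule e_out)
      have "U {0} \<subseteq> U {0, 1}" by (auto simp: U_def)
      then show "x \<notin> V'' \<union> S" using that U01 all \<open>V'' \<union> S = _\<close> by blast
    qed
    then have len_e: "len e \<le> B" using eX by (intro B[of _ 0]) (auto simp: homeos_in_def)
    note ebij = homeos_bij[OF eX]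
    let ?c = "e \<circ> h \<circ> inv_into UNIV e"
    have "?c \<in> homeos X" using eX hX by (intro homeos_comp homeos_inv)
    moreover have "?c y = y" if y: "y \<notin> O' - U {2}" for y
    proof (cases "y \<in> O'")
      case True
      then have "y \<in> ?V3" using y by blast
      then obtain x where x: "x \<in> V''" "y = e x"
        using homeo_onD(1)[OF \<open>homeo_on X V'' ?V3 e\<close>] by blast
      then show ?thesis using ebij hV'' by (simp add: bij_is_inj)
    next
      case False
      then have "e y = y" using \<open>e \<in> homeos_in X O'\<close> by (simp add: homeos_in_def)
      then have "inv_into UNIV e y = y" using ebij by (metis bij_is_inj inv_f_f)
      then show ?thesis using h_out[OF False] \<open>e y = y\<close> by simp
    qed
    ultimately have "len ?c \<le> B" by (intro B[of _ 2]) (auto simp: homeos_in_def)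
    \<comment> \<open>Two summands \<open>B\<close> for the conjugator \<open>e\<close> and one for
      the conjugate; the factor \<open>?q\<close> adds the fourth.\<close>
    then have "len h \<le> 3 * B" using len_conj[OF eX hX] len_e by linarith
    then show ?thesis using len_g by linarith
  qed
  then show ?thesis unfolding O'_def by blast
qed

end

section \<open>Bounding length functions\<close>

lemma finite_uniform_bound:
  fixes Q :: "'b \<Rightarrow> real \<Rightarrow> bool"
  assumes "finite S" "\<And>x. x \<in> S \<Longrightarrow> \<exists>B. Q x B" "\<And>x B B'. Q x B \<Longrightarrow> B \<le> B' \<Longrightarrow> Q x B'"
  shows "\<exists>B\<ge>0. \<forall>x\<in>S. Q x B"
  using assms(1,2)
proof (induction S rule: finite_induct)
  case (insert x S)
  then obtain B B' where "B \<ge> 0" "\<forall>x\<in>S. Q x B" "Q x B'" by blast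
  then have "\<forall>y\<in>insert x S. Q y (max B B')" using assms(3) by (metis insert_iff max.cobounded1 max.cobounded2)
  then show ?case using \<open>B \<ge> 0\<close> by (meson max.coboundedI1)
qed auto

locale CB_colouring = CB_space X \<alpha> \<beta>
  for X :: "'a topology" and \<alpha> \<beta> :: "'o::wellorder" +
  fixes c :: "'a \<Rightarrow> 'a"
  assumes colour_in: "x \<in> topspace X \<Longrightarrow> c x \<in> CB_deriv X \<alpha>"
    and colour_top: "p \<in> CB_deriv X \<alpha> \<Longrightarrow> c p = p"
    and clopen_colour: "p \<in> CB_deriv X \<alpha> \<Longrightarrow> clopenin X {x \<in> topspace X. c x = p}"
begin

abbreviation "P \<equiv> CB_deriv X \<alpha>"

definition "Y p = {x \<in> topspace X. c x = p}"

definition "pure = {g \<in> homeos X. \<forall>p\<in>P. g p = p}"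

definition "colour_preserving = {g \<in> homeos X. \<forall>x\<in>topspace X. c (g x) = c x}"

definition "moved g = {x \<in> topspace X. c (g x) \<noteq> c x}"

lemma P_top: "P \<subseteq> topspace X" by (rule CB_deriv_subset)

lemma Y_clopen: "p \<in> P \<Longrightarrow> clopenin X (Y p)"
  using clopen_colour by (simp add: Y_def)

lemma Y_top: "Y p \<subseteq> topspace X" by (auto simp: Y_def)

lemma Y_P: "p \<in> P \<Longrightarrow> Y p \<inter> P = {p}"
  using P_top colour_top by (auto simp: Y_def)

lemma UN_Y: "(\<Union>p\<in>P. Y p) = topspace X"
  using colour_in by (auto simp: Y_def)

lemma Y_disj: "p \<noteq> q \<Longrightarrow> Y p \<inter> Y q = {}"
  by (auto simp: Y_def)

lemma homeos_by_colours:
  assumes "\<And>p. p \<in> P \<Longrightarrow> homeo_on X (Y p) (V p) f" "\<And>x. x \<notin> topspace X \<Longrightarrow> f x = x"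
    and "(\<Union>p\<in>P. V p) = topspace X" "\<And>p q. p \<in> P \<Longrightarrow> q \<in> P \<Longrightarrow> p \<noteq> q \<Longrightarrow> V p \<inter> V q = {}"
  shows "f \<in> homeos X"
proof -
  have "homeo_on X (\<Union>p\<in>P. Y p) (\<Union>p\<in>P. V p) f"
    using assms(1,4) Y_clopen by (intro homeo_on_disjoint_UN) (auto simp: clopenin_def)
  then show ?thesis using assms(2,3) UN_Y by (simp add: homeos_def)
qed

lemma homeo_on_Y:
  assumes g: "g \<in> colour_preserving"
  shows "homeo_on X (Y p) (Y p) g"
proof -
  have gX: "g \<in> homeos X" and gc: "\<And>x. x \<in> topspace X \<Longrightarrow> c (g x) = c x"
    using g by (auto simp: colour_preserving_def)
  have "g ` Y p = Y p"
  proof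
    show "g ` Y p \<subseteq> Y p" using gc homeos_topspace[OF gX] by (auto simp: Y_def)
    show "Y p \<subseteq> g ` Y p"
    proof
      fix y assume y: "y \<in> Y p"
      obtain x where x: "y = g x" using homeos_bij[OF gX] by (metis bij_pointE)
      then have "x \<in> Y p" using y gc homeos_topspace[OF gX] by (auto simp: Y_def)
      then show "y \<in> g ` Y p" using x by blast
    qed
  qed
  moreover have "homeo_on X (topspace X) (topspace X) g" using gX by (simp add: homeos_def)
  ultimately show ?thesis using homeo_on_sub Y_top by metis
qed

lemma colour_preserving_pure: "colour_preserving \<subseteq> pure"
proof
  fix g assume g: "g \<in> colour_preserving"
  then have gX: "g \<in> homeos X" and gc: "\<And>x. x \<in> topspace X \<Longrightarrow> c (g x) = c x"
    by (auto simp: colour_preserving_def)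
  have "g p = p" if p: "p \<in> P" for p
  proof -
    have "g p \<in> P" using homeos_CB_deriv[OF gX] p by blast
    then have "c (g p) = g p" by (rule colour_top)
    then show ?thesis using gc[of p] colour_top[OF p] p P_top by auto
  qed
  then show "g \<in> pure" using gX by (simp add: pure_def)
qed

text \<open>The points that keep their colour form a finite union of clopen sets, and it contains
  X^(\<alpha>) since \<open>g\<close> fixes the latter pointwise.\<close>

lemma finite_moved:
  assumes g: "g \<in> pure" shows "finite (moved g \<inter> CB_deriv X \<beta>)"
proof -
  have gX: "g \<in> homeos X" using g by (simp add: pure_def)
  note bij = homeos_bij[OF gX]
  have eq: "moved g = topspace X - (\<Union>p\<in>P. Y p \<inter> inv_into UNIV g ` Y p)"
  proof -
    have "x \<in> inv_into UNIV g ` Y p \<longleftrightarrow> g x \<in> Y p" for x p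
    proof
      assume "x \<in> inv_into UNIV g ` Y p"
      then show "g x \<in> Y p" using bij by (auto simp: bij_is_surj surj_f_inv_f)
    next
      assume "g x \<in> Y p"
      moreover have "inv_into UNIV g (g x) = x" using bij by (simp add: bij_is_inj)
      ultimately show "x \<in> inv_into UNIV g ` Y p" by (metis image_eqI)
    qed
    then show ?thesis using colour_in homeos_topspace[OF gX] by (auto simp: moved_def Y_def)
  qed
  have "clopenin X (moved g)"
    unfolding eq using Y_clopen homeos_clopenin[OF homeos_inv[OF gX]] finite_top
    by (intro clopenin_Diff clopenin_topspace clopenin_UN clopenin_Int) auto
  moreover have "moved g \<inter> P = {}"
    using g colour_top by (auto simp: moved_def pure_def)
  ultimately show ?thesis by (rule finite_CB_beta)
qed

lemma clopen_in_rank_beta: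
  assumes w: "w \<in> CB_deriv X \<beta>" "w \<notin> P" and U: "openin X U" "w \<in> U"
  obtains E where "clopenin X E" "w \<in> E" "E \<subseteq> U" "E \<inter> CB_deriv X \<beta> = {w}"
proof -
  have "has_rank X \<beta> w"
  proof -
    have "w \<notin> CB_derivative X (CB_deriv X \<beta>)"
      using w(2) by (simp add: CB_deriv_successor[OF successor])
    then show ?thesis using w(1) by (auto simp: CB_derivative_iff has_rank_def)
  qed
  then show ?thesis using has_rank_clopen[OF _ U, where \<delta> = \<beta>] that by metis
qed

lemma rank_beta_near:
  assumes p: "p \<in> P" and U: "openin X U" "p \<in> U"
  obtains w where "w \<in> U" "w \<in> CB_deriv X \<beta>" "w \<notin> P"
proof -
  have "p \<in> CB_deriv X \<beta>" using p CB_alpha_subset by blast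
  then have "\<exists>w\<in>U. has_rank X \<beta> w"
    using U less_imp_le[OF beta_less] by (intro has_rank_in)
  then obtain w where w: "w \<in> U" "has_rank X \<beta> w" ..
  have "w \<in> CB_deriv X \<beta>" using w(2) unfolding has_rank_def by auto
  then show ?thesis using that[OF w(1)] has_rank_imp_notin[OF w(2) beta_less] by simp
qed

end

locale CB_coloured_length = CB_colouring X \<alpha> \<beta> c + CB_length X \<alpha> \<beta> len
  for X :: "'a topology" and \<alpha> \<beta> :: "'o::wellorder" and c len
begin

text \<open>Induction over the set of colours on which \<open>g\<close> may act. The part of
  \<open>g\<close> in one class fixes the only top point there, so it is supported on a punctured
  piece, where lengths are bounded.\<close>

lemma colour_preserving_bounded: "\<exists>B. \<forall>g\<in>colour_preserving. len g \<le> B"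
proof -
  have "\<exists>B. \<forall>g\<in>colour_preserving. (\<forall>x\<in>topspace X. c x \<notin> S \<longrightarrow> g x = x) \<longrightarrow> len g \<le> B"
    if "finite S" "S \<subseteq> P" for S
    using that
  proof (induction S rule: finite_induct)
    case empty
    have "len g \<le> len id" if "g \<in> colour_preserving" "\<forall>x\<in>topspace X. g x = x" for g
    proof -
      have "g = id" using that by (auto simp: colour_preserving_def homeos_def fun_eq_iff)
      then show ?thesis by simp
    qed
    then show ?case by auto
  next
    case (insert p S)
    then obtain B where B: "\<And>g. g \<in> colour_preserving \<Longrightarrow> (\<forall>x\<in>topspace X. c x \<notin> S \<longrightarrow> g x = x) \<Longrightarrow> len g \<le> B"
      by auto
    have p: "p \<in> P" using insert by simp
    obtain B' where B': "\<And>g. g \<in> homeos_in X (Y p - {p}) \<Longrightarrow> len g \<le> B'"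
      using length_bounded_on_punctured[OF Y_clopen[OF p] Y_P[OF p]] by blast
    have "len g \<le> B' + B" if g: "g \<in> colour_preserving" and gS: "\<forall>x\<in>topspace X. c x \<notin> insert p S \<longrightarrow> g x = x" for g
    proof -
      have gX: "g \<in> homeos X" and gc: "\<And>x. x \<in> topspace X \<Longrightarrow> c (g x) = c x"
        using g by (auto simp: colour_preserving_def)
      have gp: "g p = p" using g colour_preserving_pure p by (auto simp: pure_def)
      define h where "h x = (if x \<in> Y p then g x else x)" for x
      have "homeo_on X (Y p) (Y p) h"
        using homeo_on_Y[OF g] by (rule homeo_on_cong) (simp add: h_def)
      then have h: "h \<in> homeos_in X (Y p)"
        using Y_clopen[OF p] by (intro homeos_inI_piecewise) (auto simp: clopenin_def h_def)
      then have hX: "h \<in> homeos X" by (simp add: homeos_in_def)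
      have "h \<in> homeos_in X (Y p - {p})" using h gp by (auto simp: homeos_in_def h_def)
      then have lh: "len h \<le> B'" by (rule B')
      have hc: "c (h x) = c x" if "x \<in> topspace X" for x using gc that by (simp add: h_def)
      note hbij = homeos_bij[OF hX]
      let ?k = "inv_into UNIV h \<circ> g"
      have kX: "?k \<in> homeos X" using hX gX by (intro homeos_comp homeos_inv)
      have hk: "h (?k x) = g x" for x using hbij by (simp add: bij_is_surj surj_f_inv_f)
      have "c (?k x) = c x" if "x \<in> topspace X" for x
        using hc[of "?k x"] hk gc[OF that] homeos_topspace[OF kX] that by metis
      then have kc: "?k \<in> colour_preserving" using kX by (simp add: colour_preserving_def)
      have "?k x = x" if "x \<in> topspace X" "c x \<notin> S" for x
      proof -
        have "g x = h x" using gS that by (auto simp: h_def Y_def)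
        then show ?thesis using hbij by (simp add: bij_is_inj)
      qed
      then have lk: "len ?k \<le> B" using B[OF kc] by blast
      have "g = h \<circ> ?k" using hk by (simp add: fun_eq_iff)
      then have "len g \<le> len h + len ?k" using len_comp[OF hX kX] by simp
      then show ?thesis using lh lk by linarith
    qed
    then show ?case by blast
  qed
  from this[OF finite_top order_refl] obtain B where
    "\<forall>g\<in>colour_preserving. (\<forall>x\<in>topspace X. c x \<notin> P \<longrightarrow> g x = x) \<longrightarrow> len g \<le> B" by blast
  then show ?thesis using colour_in by blast
qed

section \<open>Moving pieces between colour classes\<close>

text \<open>The elementary move, which recolours one piece and nothing else. The bound
  \<open>B\<close> precedes the choice of \<open>E\<close>, so one constant serves all pieces of a
  class.\<close>

definition movable :: "real \<Rightarrow> 'a \<Rightarrow> 'a \<Rightarrow> bool" where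
  "movable B p q \<longleftrightarrow> (\<forall>E z. clopenin X E \<and> E \<subseteq> Y p \<and> z \<notin> P \<and> E \<inter> CB_deriv X \<beta> = {z} \<longrightarrow>
    (\<exists>s\<in>homeos X. len s \<le> B \<and> (\<forall>x\<in>E. c (s x) = q) \<and> (\<forall>x\<in>topspace X - E. c (s x) = c x)))"

lemma movableE:
  assumes "movable B p q" "clopenin X E" "E \<subseteq> Y p" "z \<notin> P" "E \<inter> CB_deriv X \<beta> = {z}"
  obtains s where "s \<in> homeos X" "len s \<le> B" "\<And>x. x \<in> E \<Longrightarrow> c (s x) = q"
    "\<And>x. x \<in> topspace X - E \<Longrightarrow> c (s x) = c x"
proof -
  have "\<exists>s\<in>homeos X. len s \<le> B \<and> (\<forall>x\<in>E. c (s x) = q) \<and> (\<forall>x\<in>topspace X - E. c (s x) = c x)"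
    using assms(1)[unfolded movable_def, rule_format, of E z] assms(2-) by simp
  then show ?thesis using that by metis
qed

text \<open>One reference move \<open>s0\<close> suffices: any other admissible piece
  \<open>E\<close> is first carried to the reference piece \<open>E0\<close> by a colour preserving
  map \<open>u\<close>, whose length is bounded uniformly.\<close>

lemma movable_pair:
  assumes p: "p \<in> P" and q: "q \<in> P" "p \<noteq> q"
  shows "\<exists>B. movable B p q"
proof (cases "\<exists>E z. clopenin X E \<and> E \<subseteq> Y p \<and> z \<notin> P \<and> E \<inter> CB_deriv X \<beta> = {z}")
  case True
  then obtain E0 z0 where E0: "clopenin X E0" "E0 \<subseteq> Y p" "z0 \<notin> P" "E0 \<inter> CB_deriv X \<beta> = {z0}" by blast
  have oq: "openin X (Y q)" "q \<in> Y q"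
    using Y_clopen[OF q(1)] Y_P[OF q(1)] by (auto simp: clopenin_def)
  obtain w where w: "w \<in> Y q" "w \<in> CB_deriv X \<beta>" "w \<notin> P"
    by (rule rank_beta_near[OF q(1) oq])
  obtain D where D: "clopenin X D" "D \<subseteq> Y q" "D \<inter> CB_deriv X \<beta> = {w}"
    by (rule clopen_in_rank_beta[OF w(2,3) oq(1) w(1)])
  have compl: "clopenin X (Y r - E)" "(Y r - E) \<inter> P = {r}"
    if "r \<in> P" "clopenin X E" "z \<notin> P" "E \<inter> CB_deriv X \<beta> = {z}" for r E z
  proof -
    show "clopenin X (Y r - E)" using that Y_clopen by (intro clopenin_Diff)
    have "E \<inter> P \<subseteq> {z}" using that(4) CB_alpha_subset by blast
    then have "E \<inter> P = {}" using that(3) by blast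
    then show "(Y r - E) \<inter> P = {r}" using Y_P[OF that(1)] by blast
  qed
  note le = less_imp_le[OF beta_less] order_refl[of \<alpha>]
  obtain a where a: "homeo_on X E0 D a"
    using unique_piece[OF le(1) E0(1) D(1) E0(4) D(3)] by blast
  obtain a' where a': "homeo_on X (Y q) (Y q - D) a'"
    using unique_piece[OF le(2) Y_clopen[OF q(1)] compl(1)[OF q(1) D(1) w(3) D(3)] Y_P[OF q(1)] compl(2)[OF q(1) D(1) w(3) D(3)]]
    by blast
  obtain a'' where a'': "homeo_on X (Y p - E0) (Y p) a''"
    using unique_piece[OF le(2) compl(1)[OF p E0(1,3,4)] Y_clopen[OF p] compl(2)[OF p E0(1,3,4)] Y_P[OF p]] by blast
  \<comment> \<open>Class \<open>q\<close> makes room by shrinking to \<open>Y q - D\<close>, the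
    piece takes the place \<open>D\<close>, and the rest of class \<open>p\<close> expands to all of
    \<open>Y p\<close>. All three maps come from \<open>unique_piece\<close>.\<close>
  define s0 where "s0 x = (if x \<in> E0 then a x else if x \<in> Y q then a' x else if x \<in> Y p then a'' x else x)" for x
  have Ypq: "Y p \<inter> Y q = {}" using Y_disj q(2) by simp
  let ?R = "topspace X - Y p - Y q"
  have s0_parts: "homeo_on X E0 D s0" "homeo_on X (Y q) (Y q - D) s0" "homeo_on X (Y p - E0) (Y p) s0" "homeo_on X ?R ?R s0"
  proof -
    show "homeo_on X E0 D s0" by (rule homeo_on_cong[OF a]) (simp add: s0_def)
    show "homeo_on X (Y q) (Y q - D) s0"
      by (rule homeo_on_cong[OF a']) (use E0(2) Ypq in \<open>auto simp: s0_def\<close>)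
    show "homeo_on X (Y p - E0) (Y p) s0"
      by (rule homeo_on_cong[OF a'']) (use Ypq in \<open>auto simp: s0_def\<close>)
    show "homeo_on X ?R ?R s0"
      by (rule homeo_on_ident) (use E0(2) in \<open>auto simp: s0_def\<close>)
  qed
  have opens: "openin X E0" "openin X (Y q)" "openin X (Y p - E0)" "openin X ?R"
    using E0(1) Y_clopen[OF p] Y_clopen[OF q(1)] by (auto simp: clopenin_def)
  have "homeo_on X (((E0 \<union> Y q) \<union> (Y p - E0)) \<union> ?R) (((D \<union> (Y q - D)) \<union> Y p) \<union> ?R) s0"
    using opens s0_parts Ypq D(2) by (intro homeo_on_Un openin_Un) auto
  moreover have "((E0 \<union> Y q) \<union> (Y p - E0)) \<union> ?R = topspace X" "((D \<union> (Y q - D)) \<union> Y p) \<union> ?R = topspace X"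
    using E0(2) D(2) Y_top[of p] Y_top[of q] by blast+
  ultimately have s0X: "s0 \<in> homeos X"
    using E0(2) Y_top[of p] Y_top[of q] by (auto simp: homeos_def s0_def)
  have s0_E0: "c (s0 x) = q" if "x \<in> E0" for x
    using homeo_onD(4)[OF s0_parts(1) that] D(2) by (auto simp: Y_def)
  have s0_other: "c (s0 x) = c x" if x: "x \<in> topspace X - E0" for x
  proof -
    consider "x \<in> Y q" | "x \<in> Y p - E0" | "x \<in> ?R" using x by blast
    then show ?thesis
    proof cases
      case 1 then show ?thesis using homeo_onD(4)[OF s0_parts(2) 1] by (simp add: Y_def)
    next
      case 2 then show ?thesis using homeo_onD(4)[OF s0_parts(3) 2] by (simp add: Y_def)
    next
      case 3
      then have "s0 x = x" using E0(2) by (auto simp: s0_def)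
      then show ?thesis by simp
    qed
  qed
  obtain B where B: "\<And>g. g \<in> colour_preserving \<Longrightarrow> len g \<le> B" using colour_preserving_bounded by blast
  have "\<exists>s\<in>homeos X. len s \<le> len s0 + B \<and> (\<forall>x\<in>E. c (s x) = q) \<and> (\<forall>x\<in>topspace X - E. c (s x) = c x)"
    if E: "clopenin X E" "E \<subseteq> Y p" "z \<notin> P" "E \<inter> CB_deriv X \<beta> = {z}" for E z
  proof -
    obtain b where b: "homeo_on X E E0 b"
      using unique_piece[OF le(1) E(1) E0(1) E(4) E0(4)] by blast
    obtain b' where b': "homeo_on X (Y p - E) (Y p - E0) b'"
      using unique_piece[OF le(2) compl(1)[OF p E(1,3,4)] compl(1)[OF p E0(1,3,4)] compl(2)[OF p E(1,3,4)] compl(2)[OF p E0(1,3,4)]]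
      by blast
    define u where "u x = (if x \<in> E then b x else if x \<in> Y p then b' x else x)" for x
    have u_parts: "homeo_on X E E0 u" "homeo_on X (Y p - E) (Y p - E0) u"
    proof -
      show "homeo_on X E E0 u" by (rule homeo_on_cong[OF b]) (simp add: u_def)
      show "homeo_on X (Y p - E) (Y p - E0) u" by (rule homeo_on_cong[OF b']) (simp add: u_def)
    qed
    have "homeo_on X (E \<union> (Y p - E)) (E0 \<union> (Y p - E0)) u"
      using u_parts E(1) Y_clopen[OF p] by (intro homeo_on_Un) (auto simp: clopenin_def)
    moreover have "E \<union> (Y p - E) = Y p" "E0 \<union> (Y p - E0) = Y p" using E(2) E0(2) by auto
    ultimately have uY: "homeo_on X (Y p) (Y p) u" by simp
    then have "u \<in> homeos_in X (Y p)"
      using Y_clopen[OF p] E(2) by (intro homeos_inI_piecewise) (auto simp: clopenin_def u_def)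
    then have uX: "u \<in> homeos X" by (simp add: homeos_in_def)
    have uc: "c (u x) = c x" if "x \<in> topspace X" for x
    proof (cases "x \<in> Y p")
      case True
      then show ?thesis using homeo_onD(4)[OF uY True] by (simp add: Y_def)
    next
      case False
      then show ?thesis using E(2) by (auto simp: u_def)
    qed
    then have "len u \<le> B" using uX by (intro B) (simp add: colour_preserving_def)
    then have "len (s0 \<circ> u) \<le> len s0 + B" using len_comp[OF s0X uX] by linarith
    moreover have "c ((s0 \<circ> u) x) = q" if "x \<in> E" for x
      using s0_E0 homeo_onD(4)[OF u_parts(1) that] by simp
    moreover have "c ((s0 \<circ> u) x) = c x" if x: "x \<in> topspace X - E" for x
    proof -
      have "u x \<notin> E0"
      proof (cases "x \<in> Y p")
        case True
        then show ?thesis using homeo_onD(4)[OF u_parts(2), of x] x by simp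
      next
        case False
        then show ?thesis using x E0(2) by (auto simp: u_def)
      qed
      then show ?thesis using s0_other[of "u x"] uc x homeos_topspace[OF uX] by simp
    qed
    ultimately show ?thesis using homeos_comp[OF s0X uX] by blast
  qed
  then show ?thesis unfolding movable_def by blast
next
  case False
  then show ?thesis unfolding movable_def by blast
qed

lemma movable: "\<exists>B\<ge>0. \<forall>pq\<in>P \<times> P - Id. movable B (fst pq) (snd pq)"
proof (rule finite_uniform_bound)
  show "\<exists>B. movable B (fst pq) (snd pq)" if "pq \<in> P \<times> P - Id" for pq
    using that by (intro movable_pair) auto
  show "movable B' (fst pq) (snd pq)" if mv: "movable B (fst pq) (snd pq)" "B \<le> B'" for pq B B'
    unfolding movable_def
  proof (intro allI impI)
    fix E z
    assume E: "clopenin X E \<and> E \<subseteq> Y (fst pq) \<and> z \<notin> P \<and> E \<inter> CB_deriv X \<beta> = {z}"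
    obtain s where "s \<in> homeos X" "len s \<le> B" "\<And>x. x \<in> E \<Longrightarrow> c (s x) = snd pq"
        "\<And>x. x \<in> topspace X - E \<Longrightarrow> c (s x) = c x"
      by (rule movableE[OF mv(1), of E z]) (use E in auto)
    then show "\<exists>s\<in>homeos X. len s \<le> B' \<and> (\<forall>x\<in>E. c (s x) = snd pq) \<and> (\<forall>x\<in>topspace X - E. c (s x) = c x)"
      using mv(2) by (intro bexI[of _ s]) auto
  qed
qed (use finite_top in simp)

lemma homeos_fix_top:
  assumes "s \<in> homeos X" "p \<in> P" "c (s p) = c p" shows "s p = p"
proof -
  have "s p \<in> P" using homeos_CB_deriv[OF assms(1)] assms(2) by blast
  then show ?thesis using colour_top assms(2,3) by metis
qed

text \<open>Every decrease of the counter \<open>m\<close> is bought with one factor of length at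
  most \<open>B\<close>.\<close>

lemma length_descent:
  assumes S: "S \<subseteq> homeos X" and base: "\<And>g. g \<in> S \<Longrightarrow> m g = 0 \<Longrightarrow> len g \<le> C"
    and step: "\<And>g. g \<in> S \<Longrightarrow> m g \<noteq> 0 \<Longrightarrow> \<exists>s\<in>homeos X. len s \<le> B \<and> s \<circ> g \<in> S \<and> m (s \<circ> g) < m g"
    and B: "B \<ge> 0" and g: "g \<in> S"
  shows "len g \<le> B * real (m g) + C"
  using g
proof (induction "m g" arbitrary: g rule: less_induct)
  case less
  show ?case
  proof (cases "m g = 0")
    case True
    then show ?thesis using base[OF less.prems] by simp
  next
    case False
    then obtain s where s: "s \<in> homeos X" "len s \<le> B" "s \<circ> g \<in> S" "m (s \<circ> g) < m g"
      using step less.prems by blast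
    have IH: "len (s \<circ> g) \<le> B * real (m (s \<circ> g)) + C" using less.hyps s by blast
    have "inv_into UNIV s (s x) = x" for x using homeos_bij[OF s(1)] by (simp add: bij_is_inj)
    then have "g = inv_into UNIV s \<circ> (s \<circ> g)" by (simp add: fun_eq_iff)
    then have "len g = len (inv_into UNIV s \<circ> (s \<circ> g))" by (rule arg_cong)
    also have "\<dots> \<le> len (inv_into UNIV s) + len (s \<circ> g)"
      using S s by (intro len_comp homeos_inv) auto
    also have "\<dots> \<le> B + (B * real (m (s \<circ> g)) + C)"
      using IH s(2) len_inv[OF s(1)] by simp
    also have "B + B * real (m (s \<circ> g)) = B * real (Suc (m (s \<circ> g)))" by (simp add: algebra_simps)
    then have "B + (B * real (m (s \<circ> g)) + C) = B * real (Suc (m (s \<circ> g))) + C" by simp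
    also have "\<dots> \<le> B * real (m g) + C"
      using s(4) B by (intro add_right_mono mult_left_mono) auto
    finally show ?thesis .
  qed
qed

text \<open>Here only ranks below \<open>\<beta>\<close> change colour, possibly at infinitely many
  points. The descent therefore counts the pairs of colours between which something moves and clears
  one pair at a time, so the number of steps is at most \<open>card (P \<times> P)\<close>.\<close>

lemma bounded_if_unmoved:
  "\<exists>C. \<forall>g\<in>pure. moved g \<inter> CB_deriv X \<beta> = {} \<longrightarrow> len g \<le> C"
proof -
  obtain B where B: "B \<ge> 0" and "\<forall>pq\<in>P \<times> P - Id. movable B (fst pq) (snd pq)"
    using movable by blast
  then have mv: "movable B p q" if "p \<in> P" "q \<in> P" "p \<noteq> q" for p q using that by force
  obtain C where C: "\<And>g. g \<in> colour_preserving \<Longrightarrow> len g \<le> C" using colour_preserving_bounded by blast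
  define S where "S = {g \<in> pure. moved g \<inter> CB_deriv X \<beta> = {}}"
  define T where "T g = {(p, q). p \<in> P \<and> q \<in> P \<and> p \<noteq> q \<and> (\<exists>x\<in>topspace X. c x = p \<and> c (g x) = q)}" for g
  have T_sub: "T g \<subseteq> P \<times> P" for g by (auto simp: T_def)
  then have fin: "finite (T g)" for g using finite_top by (meson finite_SigmaI finite_subset)
  have "len g \<le> (2 * B) * real (card (T g)) + C" if "g \<in> S" for g
  proof (rule length_descent[where S = S and m = "\<lambda>g. card (T g)", OF _ _ _ _ that])
    show "S \<subseteq> homeos X" by (auto simp: S_def pure_def)
    show "2 * B \<ge> 0" using B by simp
  next
    fix g assume g: "g \<in> S" "card (T g) = 0"
    then have T: "T g = {}" using fin by simp
    have gX: "g \<in> homeos X" using g by (auto simp: S_def pure_def)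
    have "c (g x) = c x" if x: "x \<in> topspace X" for x
    proof (rule ccontr)
      assume "c (g x) \<noteq> c x"
      then have "(c x, c (g x)) \<in> T g"
        using colour_in x homeos_topspace[OF gX] by (auto simp: T_def)
      then show False using T by simp
    qed
    then show "len g \<le> C" using gX by (intro C) (simp add: colour_preserving_def)
  next
    fix g assume g: "g \<in> S" "card (T g) \<noteq> 0"
    then have gX: "g \<in> homeos X" and gp: "\<And>p. p \<in> P \<Longrightarrow> g p = p" and gm: "moved g \<inter> CB_deriv X \<beta> = {}"
      by (auto simp: S_def pure_def)
    have "T g \<noteq> {}" using g(2) by auto
    then obtain p q where pq: "(p, q) \<in> T g" by auto
    then have p: "p \<in> P" and q: "q \<in> P" and ne: "p \<noteq> q" by (auto simp: T_def)
    note gbij = homeos_bij[OF gX]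
    define A where "A = Y q \<inter> g ` Y p"
    have gA: "g x \<in> A \<longleftrightarrow> x \<in> topspace X \<and> c x = p \<and> c (g x) = q" for x
      unfolding A_def using inj_image_mem_iff[OF bij_is_inj[OF gbij], of x "Y p"] homeos_topspace[OF gX, of x]
      by (auto simp: Y_def)
    have Acl: "clopenin X A"
      unfolding A_def using Y_clopen p q homeos_clopenin[OF gX] by (intro clopenin_Int) auto
    have A\<beta>: "A \<inter> CB_deriv X \<beta> = {}"
    proof -
      have False if y: "y \<in> A" "y \<in> CB_deriv X \<beta>" for y
      proof -
        obtain x where x: "y = g x" using gbij by (metis bij_pointE)
        then have "x \<in> moved g" using gA[of x] y ne by (auto simp: moved_def)
        moreover have "x \<in> CB_deriv X \<beta>" using homeos_CB_deriv[OF gX] x y by blast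
        ultimately show False using gm by blast
      qed
      then show ?thesis by blast
    qed
    \<comment> \<open>\<open>D\<close> will consist of points of class \<open>q\<close> that also
      come from class \<open>q\<close>, so it is disjoint from \<open>A\<close>, whose points come
      from class \<open>p\<close>.\<close>
    define U where "U = Y q \<inter> g ` Y q"
    have "q \<in> Y q" using Y_P[OF q] by blast
    then have qU: "q \<in> U" using gp[OF q] by (metis IntI U_def image_eqI)
    have oU: "openin X U"
      using Y_clopen[OF q] homeos_openin[OF gX] by (auto simp: U_def clopenin_def)
    obtain w where w: "w \<in> U" "w \<in> CB_deriv X \<beta>" "w \<notin> P"
      by (rule rank_beta_near[OF q oU qU])
    obtain D where D: "clopenin X D" "w \<in> D" "D \<subseteq> U" "D \<inter> CB_deriv X \<beta> = {w}"
      by (rule clopen_in_rank_beta[OF w(2,3) oU w(1)])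
    have AD: "A \<inter> D = {}"
      using D(3) Y_disj[OF ne] image_Int[OF bij_is_inj[OF gbij], of "Y p" "Y q"] by (auto simp: A_def U_def)
    \<comment> \<open>\<open>A\<close> has no point of rank \<open>\<beta>\<close>: it is moved together with \<open>D\<close>, and then \<open>D\<close> is moved back.\<close>
    define E where "E = A \<union> D"
    have E: "clopenin X E" "E \<subseteq> Y q" "E \<inter> CB_deriv X \<beta> = {w}"
      using clopenin_Un[OF Acl D(1)] A\<beta> D(3,4) by (auto simp: E_def A_def U_def)
    obtain s1 where s1: "s1 \<in> homeos X" "len s1 \<le> B" "\<And>x. x \<in> E \<Longrightarrow> c (s1 x) = p"
      "\<And>x. x \<in> topspace X - E \<Longrightarrow> c (s1 x) = c x"
      by (rule movableE[OF mv[OF q p ne[symmetric]] E(1,2) w(3) E(3)]) blast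
    note s1inj = bij_is_inj[OF homeos_bij[OF s1(1)]]
    have s1D: "s1 x \<in> s1 ` D \<longleftrightarrow> x \<in> D" for x by (rule inj_image_mem_iff[OF s1inj])
    have F: "clopenin X (s1 ` D)" "s1 ` D \<subseteq> Y p" "s1 w \<notin> P"
      using homeos_clopenin[OF s1(1)] D(1) s1(3) clopenin_subset[OF D(1)] homeos_topspace[OF s1(1)]
        homeos_CB_deriv[OF s1(1), of w \<alpha>] w(3) by (auto simp: E_def Y_def)
    have F\<beta>: "s1 ` D \<inter> CB_deriv X \<beta> = {s1 w}"
    proof -
      have "s1 ` D \<inter> CB_deriv X \<beta> = s1 ` (D \<inter> CB_deriv X \<beta>)"
        using homeos_CB_deriv[OF s1(1), where \<gamma> = \<beta>] by auto
      then show ?thesis using D(4) by simp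
    qed
    obtain s2 where s2: "s2 \<in> homeos X" "len s2 \<le> B" "\<And>x. x \<in> s1 ` D \<Longrightarrow> c (s2 x) = q"
      "\<And>x. x \<in> topspace X - s1 ` D \<Longrightarrow> c (s2 x) = c x"
      by (rule movableE[OF mv[OF p q ne] F F\<beta>]) blast
    define s where "s = s2 \<circ> s1"
    have sX: "s \<in> homeos X" using s1(1) s2(1) by (simp add: s_def homeos_comp)
    have sc: "c (s y) = (if y \<in> A then p else c y)" if y: "y \<in> topspace X" for y
    proof (cases "y \<in> D")
      case True
      then have "c (s y) = q" using s2(3) by (simp add: s_def)
      moreover have "c y = q" using True D(3) by (auto simp: U_def Y_def)
      ultimately show ?thesis using True AD by auto
    next
      case False
      then have "s1 y \<in> topspace X - s1 ` D" using s1D y homeos_topspace[OF s1(1)] by simp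
      then have "c (s y) = c (s1 y)" using s2(4) by (simp add: s_def)
      then show ?thesis using False s1(3,4) y by (auto simp: E_def)
    qed
    have sgc: "c (s (g x)) = (if c x = p \<and> c (g x) = q then p else c (g x))" if "x \<in> topspace X" for x
      using sc[of "g x"] gA[of x] that homeos_topspace[OF gX] by auto
    have "s \<circ> g \<in> pure"
    proof -
      have "s r = r" if r: "r \<in> P" for r
      proof (rule homeos_fix_top[OF sX r])
        have "r \<notin> A" using A\<beta> r CB_alpha_subset by auto
        then show "c (s r) = c r" using sc r P_top by auto
      qed
      then show ?thesis using gp homeos_comp[OF sX gX] by (simp add: pure_def)
    qed
    moreover have "moved (s \<circ> g) \<subseteq> moved g"
    proof
      fix x assume "x \<in> moved (s \<circ> g)"
      then show "x \<in> moved g" using sgc[of x] by (auto simp: moved_def split: if_splits)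
    qed
    ultimately have "s \<circ> g \<in> S" using gm by (auto simp: S_def)
    moreover have "T (s \<circ> g) \<subset> T g"
    proof -
      have "T (s \<circ> g) \<subseteq> T g - {(p, q)}"
      proof
        fix r assume "r \<in> T (s \<circ> g)"
        then obtain x where x: "x \<in> topspace X" "r = (c x, c (s (g x)))" "fst r \<in> P" "snd r \<in> P" "fst r \<noteq> snd r"
          by (auto simp: T_def)
        then have "c (s (g x)) = c (g x)" "\<not> (c x = p \<and> c (g x) = q)"
          using sgc[OF x(1)] by (auto split: if_splits)
        then show "r \<in> T g - {(p, q)}" using x by (auto simp: T_def)
      qed
      then show ?thesis using pq by blast
    qed
    then have "card (T (s \<circ> g)) < card (T g)" by (rule psubset_card_mono[OF fin])
    moreover have "len s \<le> 2 * B"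
      using len_comp[OF s2(1) s1(1)] s1(2) s2(2) by (simp add: s_def)
    ultimately show "\<exists>s\<in>homeos X. len s \<le> 2 * B \<and> s \<circ> g \<in> S \<and> card (T (s \<circ> g)) < card (T g)"
      using sX by blast
  qed
  moreover have "(2 * B) * real (card (T g)) + C \<le> (2 * B) * real (card (P \<times> P)) + C" for g
  proof -
    have "card (T g) \<le> card (P \<times> P)" using T_sub finite_top by (intro card_mono) simp_all
    then show ?thesis using B by (intro add_right_mono mult_left_mono of_nat_mono) simp_all
  qed
  ultimately have "\<forall>g\<in>S. len g \<le> (2 * B) * real (card (P \<times> P)) + C" by (meson order_trans)
  then show ?thesis by (auto simp: S_def)
qed

text \<open>One elementary move restores the colour of one point of rank \<open>\<beta>\<close>. It
  may disturb lower ranks inside the piece, but the counter ignores these, and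
  \<open>bounded_if_unmoved\<close> settles them at the end at a bounded cost.\<close>

lemma length_le_moved:
  "\<exists>K\<ge>0. \<exists>C. \<forall>g\<in>pure. len g \<le> K * real (card (moved g \<inter> CB_deriv X \<beta>)) + C"
proof -
  obtain B where B: "B \<ge> 0" and "\<forall>pq\<in>P \<times> P - Id. movable B (fst pq) (snd pq)"
    using movable by blast
  then have mv: "movable B p q" if "p \<in> P" "q \<in> P" "p \<noteq> q" for p q using that by force
  obtain C where C: "\<And>g. g \<in> pure \<Longrightarrow> moved g \<inter> CB_deriv X \<beta> = {} \<Longrightarrow> len g \<le> C"
    using bounded_if_unmoved by blast
  have "len g \<le> B * real (card (moved g \<inter> CB_deriv X \<beta>)) + C" if "g \<in> pure" for g
  proof (rule length_descent[where S = pure and m = "\<lambda>g. card (moved g \<inter> CB_deriv X \<beta>)", OF _ _ _ B that])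
    show "pure \<subseteq> homeos X" by (auto simp: pure_def)
  next
    fix g assume g: "g \<in> pure" "card (moved g \<inter> CB_deriv X \<beta>) = 0"
    then have "moved g \<inter> CB_deriv X \<beta> = {}" using finite_moved by simp
    then show "len g \<le> C" by (rule C[OF g(1)])
  next
    fix g assume g: "g \<in> pure" "card (moved g \<inter> CB_deriv X \<beta>) \<noteq> 0"
    then have gX: "g \<in> homeos X" and gp: "\<And>p. p \<in> P \<Longrightarrow> g p = p" by (auto simp: pure_def)
    have "moved g \<inter> CB_deriv X \<beta> \<noteq> {}" using g(2) by auto
    then obtain z where z: "z \<in> moved g" "z \<in> CB_deriv X \<beta>" by blast
    then have zt: "z \<in> topspace X" and zc: "c (g z) \<noteq> c z" by (auto simp: moved_def)
    define q where "q = c (g z)"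
    have gzt: "g z \<in> topspace X" using zt homeos_topspace[OF gX] by simp
    have p: "c z \<in> P" and q: "q \<in> P" using colour_in zt gzt by (auto simp: q_def)
    have w: "g z \<in> CB_deriv X \<beta>" "g z \<notin> P"
    proof -
      show "g z \<in> CB_deriv X \<beta>" using homeos_CB_deriv[OF gX] z by blast
      have "z \<notin> P" using gp zc by auto
      then show "g z \<notin> P" using homeos_CB_deriv[OF gX] by blast
    qed
    have "openin X (Y q)" "g z \<in> Y q" using Y_clopen[OF q] gzt by (auto simp: clopenin_def Y_def q_def)
    then obtain E where E: "clopenin X E" "g z \<in> E" "E \<subseteq> Y q" "E \<inter> CB_deriv X \<beta> = {g z}"
      by (rule clopen_in_rank_beta[OF w])
    have "q \<noteq> c z" using zc by (simp add: q_def)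
    note mqp = mv[OF q p this]
    obtain s where s: "s \<in> homeos X" "len s \<le> B" "\<And>x. x \<in> E \<Longrightarrow> c (s x) = c z"
      "\<And>x. x \<in> topspace X - E \<Longrightarrow> c (s x) = c x"
      by (rule movableE[OF mqp E(1,3) w(2) E(4)]) blast
    have E_iff: "g x \<in> E \<longleftrightarrow> x = z" if "x \<in> CB_deriv X \<beta>" for x
    proof -
      have "g x \<in> CB_deriv X \<beta>" using homeos_CB_deriv[OF gX] that by blast
      then have "g x \<in> E \<longleftrightarrow> g x = g z" using E(4) by blast
      then show ?thesis using bij_is_inj[OF homeos_bij[OF gX]] by (simp add: inj_eq)
    qed
    have sg: "c (s (g x)) = (if x = z then c z else c (g x))" if x: "x \<in> CB_deriv X \<beta>" for x
    proof -
      have "g x \<in> topspace X" using x CB_deriv_subset[of X \<beta>] homeos_topspace[OF gX] by auto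
      then show ?thesis using E_iff[OF x] s(3,4)[of "g x"] by auto
    qed
    have "s r = r" if r: "r \<in> P" for r
    proof (rule homeos_fix_top[OF s(1) r])
      have "r \<noteq> g z" "r \<in> CB_deriv X \<beta>" using r w(2) CB_alpha_subset by auto
      then have "r \<notin> E" using E(4) by blast
      then show "c (s r) = c r" using s(4) r P_top by auto
    qed
    then have "s \<circ> g \<in> pure" using gp homeos_comp[OF s(1) gX] by (simp add: pure_def)
    moreover have "moved (s \<circ> g) \<inter> CB_deriv X \<beta> \<subset> moved g \<inter> CB_deriv X \<beta>"
    proof -
      have "moved (s \<circ> g) \<inter> CB_deriv X \<beta> \<subseteq> moved g \<inter> CB_deriv X \<beta> - {z}"
      proof
        fix x assume "x \<in> moved (s \<circ> g) \<inter> CB_deriv X \<beta>"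
        then show "x \<in> moved g \<inter> CB_deriv X \<beta> - {z}"
          using sg[of x] by (auto simp: moved_def split: if_splits)
      qed
      then show ?thesis using z by blast
    qed
    then have "card (moved (s \<circ> g) \<inter> CB_deriv X \<beta>) < card (moved g \<inter> CB_deriv X \<beta>)"
      by (rule psubset_card_mono[OF finite_moved[OF g(1)]])
    ultimately show "\<exists>s\<in>homeos X. len s \<le> B \<and> s \<circ> g \<in> pure \<and>
        card (moved (s \<circ> g) \<inter> CB_deriv X \<beta>) < card (moved g \<inter> CB_deriv X \<beta>)"
      using s(1,2) by blast
  qed
  then show ?thesis using B by blast
qed

end

section \<open>Hamming graphs of different alphabets\<close>

text \<open>\<open>card\<close> is 0 on infinite sets, so the metric laws are available only for
  sequences that differ in finitely many places.\<close>

definition hamming :: "('i \<Rightarrow> 'c) \<Rightarrow> ('i \<Rightarrow> 'c) \<Rightarrow> nat" where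
  "hamming x y = card {i. x i \<noteq> y i}"

definition words :: "nat \<Rightarrow> (nat \<Rightarrow> nat) set" where
  "words b = {x. (\<forall>i. x i < b) \<and> finite {i. x i \<noteq> 0}}"

lemma finite_words_diff: "x \<in> words a \<Longrightarrow> y \<in> words b \<Longrightarrow> finite {i. x i \<noteq> y i}"
  by (rule finite_subset[of _ "{i. x i \<noteq> 0} \<union> {i. y i \<noteq> 0}"]) (auto simp: words_def)

lemma hamming_commute: "hamming x y = hamming y x"
  by (simp add: hamming_def eq_commute)

lemma hamming_triangle:
  assumes "finite {i. x i \<noteq> y i}" "finite {i. y i \<noteq> z i}"
  shows "hamming x z \<le> hamming x y + hamming y z"
proof -
  have "hamming x z \<le> card ({i. x i \<noteq> y i} \<union> {i. y i \<noteq> z i})"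
    unfolding hamming_def using assms by (intro card_mono) auto
  also have "\<dots> \<le> hamming x y + hamming y z"
    unfolding hamming_def by (rule card_Un_le)
  finally show ?thesis .
qed

lemma hamming_pos: "finite {i. x i \<noteq> y i} \<Longrightarrow> x \<noteq> y \<Longrightarrow> 1 \<le> hamming x y"
  by (auto simp: hamming_def Suc_le_eq card_gt_0_iff fun_eq_iff)

definition support_bound :: "(nat \<Rightarrow> nat) \<Rightarrow> nat" where
  "support_bound x = (LEAST N. \<forall>i\<ge>N. x i = 0)"

lemma support_bound:
  assumes "x \<in> words b" "support_bound x \<le> i" shows "x i = 0"
proof -
  have "finite {i. x i \<noteq> 0}" using assms(1) by (simp add: words_def)
  then obtain N where "\<forall>i\<in>{i. x i \<noteq> 0}. i < N" using finite_nat_set_iff_bounded by blast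
  then have "\<forall>i\<ge>N. x i = 0" by (metis mem_Collect_eq not_le)
  then have "\<forall>i\<ge>support_bound x. x i = 0" unfolding support_bound_def by (rule LeastI)
  then show ?thesis using assms(2) by blast
qed

lemma length_le_list_encode: "length l \<le> list_encode l"
proof (induction l)
  case (Cons x l)
  then show ?case using le_prod_encode_2[of "list_encode l" x] by simp
qed simp

text \<open>
  A position beyond the support of \<open>x\<close> that encodes both \<open>k\<close> and \<open>x\<close>; setting the letter
  there to \<open>1\<close> gives an injection which moves words by distance \<open>1\<close>.
\<close>

definition mark :: "nat \<Rightarrow> (nat \<Rightarrow> nat) \<Rightarrow> nat" where
  "mark k x = prod_encode (k, list_encode (map x [0..<support_bound x]))"

lemma support_bound_le_mark: "support_bound x \<le> mark k x"
proof -
  have "support_bound x \<le> list_encode (map x [0..<support_bound x])"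
    using length_le_list_encode[of "map x [0..<support_bound x]"] by simp
  then show ?thesis unfolding mark_def using le_prod_encode_2 order_trans by blast
qed

lemma mark_inject:
  assumes x: "x \<in> words b" and y: "y \<in> words b" and e: "mark k x = mark l y"
  shows "k = l \<and> x = y"
proof -
  have m: "map x [0..<support_bound x] = map y [0..<support_bound y]" and kl: "k = l"
    using e by (auto simp: mark_def prod_encode_eq list_encode_eq)
  then have s: "support_bound x = support_bound y" by (metis length_map length_upt diff_zero)
  have "x i = y i" for i
  proof (cases "i < support_bound x")
    case True
    then show ?thesis using m s by (metis map_eq_conv atLeastLessThan_iff set_upt zero_le)
  next
    case False
    then show ?thesis using support_bound[OF x] support_bound[OF y] s by simp
  qed
  then show ?thesis using kl by blast
qed

text \<open>The mark is the last nonzero position of the new word, so it can be read off, and it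
  encodes the pair.\<close>

lemma inj_on_mark: "inj_on (\<lambda>(k, x). x(mark k x := 1)) (UNIV \<times> words b)"
proof (rule inj_onI)
  fix z z' assume zz': "z \<in> UNIV \<times> words b" "z' \<in> UNIV \<times> words b"
    and e: "(\<lambda>(k, x). x(mark k x := 1)) z = (\<lambda>(k, x). x(mark k x := 1)) z'"
  obtain k x l y where z: "z = (k, x)" "z' = (l, y)" by (cases z; cases z')
  have x: "x \<in> words b" and y: "y \<in> words b" using zz' z by auto
  have e: "x(mark k x := 1) = y(mark l y := 1)" using e z by simp
  have beyond: "(u(mark j u := 1)) i = 0" if "u \<in> words b" "i > mark j u" for u j i
    using support_bound[OF that(1), of i] support_bound_le_mark[of u j] that(2) by simp
  have "mark k x = mark l y"
  proof (rule linorder_cases)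
    assume "mark k x < mark l y"
    then show ?thesis using beyond[OF x] e by (metis fun_upd_same zero_neq_one)
  next
    assume "mark l y < mark k x"
    then show ?thesis using beyond[OF y] e by (metis fun_upd_same zero_neq_one)
  qed
  then show "z = z'" using mark_inject[OF x y] z by simp
qed

text \<open>Marking injects pairs into words and moves them by at most 1; pairing with the letter 0
  injects words into pairs without displacement. The Schroeder-Bernstein bijection takes only values
  of these two kinds.\<close>

lemma absorb_letter:
  fixes a b :: nat
  assumes a: "a \<ge> 1" and b: "b \<ge> 2"
  obtains \<psi> where "bij_betw \<psi> ({..<a} \<times> words b) (words b)" "\<psi> (0, \<lambda>_. 0) = (\<lambda>_. 0)"
    "\<And>k x. k < a \<Longrightarrow> x \<in> words b \<Longrightarrow> hamming (\<psi> (k, x)) x \<le> 1"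
proof -
  let ?z = "\<lambda>_. 0 :: nat"
  \<comment> \<open>The zero pair and the zero word are set aside and matched by hand, so that
    finite support survives when the bijection is applied in infinitely many rows.\<close>
  let ?A = "{..<a} \<times> words b - {(0 :: nat, ?z)}" and ?B = "words b - {?z}"
  let ?f = "\<lambda>(k, x). x(mark k x := 1)"
  have z: "?z \<in> words b" using b by (simp add: words_def)
  have fw: "x(mark k x := 1) \<in> words b" if "x \<in> words b" for k x
  proof -
    have "{i. (x(mark k x := 1)) i \<noteq> 0} \<subseteq> insert (mark k x) {i. x i \<noteq> 0}" by auto
    then have "finite {i. (x(mark k x := 1)) i \<noteq> 0}"
      by (rule finite_subset) (use that in \<open>simp add: words_def\<close>)
    moreover have "(x(mark k x := 1)) i < b" for i using that b by (simp add: words_def)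
    ultimately show ?thesis unfolding words_def by blast
  qed
  have "inj_on ?f ?A" by (rule inj_on_subset[OF inj_on_mark[of b]]) auto
  moreover have "?f ` ?A \<subseteq> ?B"
  proof -
    have "x(mark k x := 1) \<noteq> ?z" for k x by (metis fun_upd_same zero_neq_one)
    then show ?thesis using fw by auto
  qed
  moreover have "inj_on (Pair 0) ?B" "Pair 0 ` ?B \<subseteq> ?A" using a by (auto simp: inj_on_def)
  ultimately obtain h where h: "bij_betw h ?A ?B" "\<And>u. u \<in> ?A \<Longrightarrow> h u = ?f u \<or> u = (0, h u)"
    by (rule Schroeder_Bernstein_decomposition) blast
  define \<psi> where "\<psi> = h((0, ?z) := ?z)"
  have "bij_betw \<psi> ?A ?B" using h(1) by (rule bij_betw_cong[THEN iffD1, rotated]) (auto simp: \<psi>_def)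
  then have "bij_betw \<psi> (?A \<union> {(0, ?z)}) (?B \<union> {?z})"
    using notIn_Un_bij_betw[of "(0, ?z)" ?A \<psi> ?B] by (simp add: \<psi>_def)
  moreover have "?A \<union> {(0, ?z)} = {..<a} \<times> words b" "?B \<union> {?z} = words b" using z a by auto
  ultimately have "bij_betw \<psi> ({..<a} \<times> words b) (words b)" by simp
  moreover have "hamming (\<psi> (k, x)) x \<le> 1" if k: "k < a" and x: "x \<in> words b" for k x
  proof (cases "(k, x) = (0, ?z)")
    case True
    then show ?thesis by (simp add: \<psi>_def hamming_def)
  next
    case False
    then have "(k, x) \<in> ?A" using k x by simp
    then consider "\<psi> (k, x) = x(mark k x := 1)" | "\<psi> (k, x) = x"
      using h(2) False unfolding \<psi>_def by fastforce
    then show ?thesis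
    proof cases
      case 1
      have "{i. (x(mark k x := 1)) i \<noteq> x i} \<subseteq> {mark k x}" by auto
      then show ?thesis unfolding 1 hamming_def using card_mono[of "{mark k x}"] by fastforce
    qed (simp add: hamming_def)
  qed
  ultimately show ?thesis using that by (simp add: \<psi>_def)
qed

section \<open>Words as sequences of rows, and bilipschitz bijections\<close>

definition row_of :: "(nat \<Rightarrow> nat) \<Rightarrow> nat \<Rightarrow> nat \<Rightarrow> nat" where
  "row_of y i j = y (prod_encode (i, j))"

lemma row_words:
  assumes "y \<in> words b" shows "row_of y i \<in> words b"
proof -
  have "{j. row_of y i j \<noteq> 0} = (\<lambda>j. prod_encode (i, j)) -` {k. y k \<noteq> 0}" by (auto simp: row_of_def)
  moreover have "finite ((\<lambda>j. prod_encode (i, j)) -` {k. y k \<noteq> 0})"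
    using assms by (intro finite_vimageI) (auto simp: words_def inj_on_def prod_encode_eq)
  ultimately show ?thesis using assms by (simp add: words_def row_of_def)
qed

lemma row_inject: "row_of y = row_of y' \<Longrightarrow> y = y'"
proof
  fix k assume "row_of y = row_of y'"
  then have "row_of y (fst (prod_decode k)) (snd (prod_decode k)) = row_of y' (fst (prod_decode k)) (snd (prod_decode k))" by simp
  then show "y k = y' k" by (simp add: row_of_def)
qed

lemma words_by_rows:
  assumes r: "\<And>i. r i \<in> words b" and fin: "finite {i. r i \<noteq> (\<lambda>_. 0)}"
  obtains y where "y \<in> words b" "row_of y = r"
proof
  define y where "y k = r (fst (prod_decode k)) (snd (prod_decode k))" for k
  show "row_of y = r" by (simp add: y_def row_of_def fun_eq_iff)
  have "{k. y k \<noteq> 0} \<subseteq> prod_encode ` (SIGMA i:{i. r i \<noteq> (\<lambda>_. 0)}. {j. r i j \<noteq> 0})"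
  proof
    fix k assume "k \<in> {k. y k \<noteq> 0}"
    then have "prod_decode k \<in> (SIGMA i:{i. r i \<noteq> (\<lambda>_. 0)}. {j. r i j \<noteq> 0})"
      by (cases "prod_decode k") (auto simp: y_def)
    then show "k \<in> prod_encode ` (SIGMA i:{i. r i \<noteq> (\<lambda>_. 0)}. {j. r i j \<noteq> 0})"
      by (metis image_eqI prod_decode_inverse)
  qed
  moreover have "finite (SIGMA i:{i. r i \<noteq> (\<lambda>_. 0)}. {j. r i j \<noteq> 0})"
    using fin r by (intro finite_SigmaI) (auto simp: words_def)
  ultimately have "finite {k. y k \<noteq> 0}" by (meson finite_imageI finite_subset)
  moreover have "y k < b" for k using r by (simp add: words_def y_def)
  ultimately show "y \<in> words b" unfolding words_def by blast
qed

lemma finite_nonzero_rows: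
  assumes "y \<in> words b" shows "finite {i. row_of y i \<noteq> (\<lambda>_. 0)}"
proof -
  have "{i. row_of y i \<noteq> (\<lambda>_. 0)} \<subseteq> (fst \<circ> prod_decode) ` {k. y k \<noteq> 0}"
  proof
    fix i assume "i \<in> {i. row_of y i \<noteq> (\<lambda>_. 0)}"
    then obtain j where "y (prod_encode (i, j)) \<noteq> 0" by (auto simp: row_of_def fun_eq_iff)
    then show "i \<in> (fst \<circ> prod_decode) ` {k. y k \<noteq> 0}" by (force intro: image_eqI[of _ _ "prod_encode (i, j)"])
  qed
  moreover have "finite {k. y k \<noteq> 0}" using assms by (simp add: words_def)
  ultimately show ?thesis by (meson finite_imageI finite_subset)
qed

text \<open>Any finite \<open>F\<close> containing the differing rows is allowed, so that several
  distances can be summed over the same index set.\<close>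

lemma hamming_rows:
  assumes y: "y \<in> words b" "y' \<in> words b" and F: "finite F" "{i. row_of y i \<noteq> row_of y' i} \<subseteq> F"
  shows "hamming y y' = (\<Sum>i\<in>F. hamming (row_of y i) (row_of y' i))"
proof -
  let ?D = "\<lambda>i. (\<lambda>j. prod_encode (i, j)) ` {j. row_of y i j \<noteq> row_of y' i j}"
  have inj: "inj_on (\<lambda>j. prod_encode (i, j)) S" for i S by (auto simp: inj_on_def prod_encode_eq)
  have "{k. y k \<noteq> y' k} = (\<Union>i\<in>F. ?D i)"
  proof (intro subset_antisym subsetI)
    fix k assume k: "k \<in> {k. y k \<noteq> y' k}"
    obtain i j where ij: "k = prod_encode (i, j)" by (metis prod_decode_inverse surj_pair)
    then have "row_of y i j \<noteq> row_of y' i j" using k by (simp add: row_of_def)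
    moreover from this have "i \<in> F" using F(2) by (metis (mono_tags, lifting) mem_Collect_eq subsetD)
    ultimately show "k \<in> (\<Union>i\<in>F. ?D i)" using ij by blast
  qed (auto simp: row_of_def)
  moreover have "card (\<Union>i\<in>F. ?D i) = (\<Sum>i\<in>F. card (?D i))"
    using F(1) finite_words_diff[OF row_words[OF y(1)] row_words[OF y(2)]]
    by (intro card_UN_disjoint) (auto simp: prod_encode_eq)
  ultimately show ?thesis by (simp add: hamming_def card_image[OF inj])
qed

text \<open>There is no additive constant, since errors of that kind would add up over the
  rows.\<close>

definition bilipschitz :: "'s set \<Rightarrow> ('s \<Rightarrow> 's \<Rightarrow> nat) \<Rightarrow> 't set \<Rightarrow> ('t \<Rightarrow> 't \<Rightarrow> nat) \<Rightarrow> bool" where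
  "bilipschitz S d T e \<longleftrightarrow> (\<exists>f L. bij_betw f S T \<and> (\<forall>x\<in>S. \<forall>y\<in>S. e (f x) (f y) \<le> L * d x y \<and> d x y \<le> L * e (f x) (f y)))"

lemma bilipschitz_sym:
  assumes "bilipschitz S d T e" shows "bilipschitz T e S d"
proof -
  obtain f L where f: "bij_betw f S T" "\<And>x y. x \<in> S \<Longrightarrow> y \<in> S \<Longrightarrow> e (f x) (f y) \<le> L * d x y \<and> d x y \<le> L * e (f x) (f y)"
    using assms by (auto simp: bilipschitz_def)
  have "bij_betw (inv_into S f) T S" using f(1) by (rule bij_betw_inv_into)
  moreover have "d (inv_into S f x) (inv_into S f y) \<le> L * e x y \<and> e x y \<le> L * d (inv_into S f x) (inv_into S f y)"
    if "x \<in> T" "y \<in> T" for x y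
  proof -
    have "inv_into S f x \<in> S" "inv_into S f y \<in> S" "f (inv_into S f x) = x" "f (inv_into S f y) = y"
      using that f(1) by (auto simp: bij_betw_def inv_into_into f_inv_into_f)
    then show ?thesis using f(2)[of "inv_into S f x" "inv_into S f y"] by simp
  qed
  ultimately show ?thesis unfolding bilipschitz_def by blast
qed

lemma bilipschitz_trans:
  assumes "bilipschitz S d T e" "bilipschitz T e U h" shows "bilipschitz S d U h"
proof -
  obtain f L where f: "bij_betw f S T" "\<And>x y. x \<in> S \<Longrightarrow> y \<in> S \<Longrightarrow> e (f x) (f y) \<le> L * d x y \<and> d x y \<le> L * e (f x) (f y)"
    using assms(1) by (auto simp: bilipschitz_def)
  obtain g M where g: "bij_betw g T U" "\<And>x y. x \<in> T \<Longrightarrow> y \<in> T \<Longrightarrow> h (g x) (g y) \<le> M * e x y \<and> e x y \<le> M * h (g x) (g y)"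
    using assms(2) by (auto simp: bilipschitz_def)
  have "h (g (f x)) (g (f y)) \<le> (L * M) * d x y \<and> d x y \<le> (L * M) * h (g (f x)) (g (f y))" if "x \<in> S" "y \<in> S" for x y
  proof -
    have "f x \<in> T" "f y \<in> T" using f(1) that by (auto simp: bij_betw_def)
    then have *: "h (g (f x)) (g (f y)) \<le> M * e (f x) (f y)" "e (f x) (f y) \<le> M * h (g (f x)) (g (f y))"
      using g(2) by auto
    have "h (g (f x)) (g (f y)) \<le> M * (L * d x y)"
      using *(1) mult_le_mono2[OF conjunct1[OF f(2)[OF that]], of M] by (rule order_trans)
    moreover have "d x y \<le> L * (M * h (g (f x)) (g (f y)))"
      using conjunct2[OF f(2)[OF that]] mult_le_mono2[OF *(2), of L] by (rule order_trans)
    ultimately show ?thesis by (simp only: ac_simps)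
  qed
  moreover have "bij_betw (g \<circ> f) S U" using f(1) g(1) by (rule bij_betw_trans)
  ultimately show ?thesis unfolding bilipschitz_def by (metis comp_apply)
qed

definition pair_dist :: "(nat \<Rightarrow> nat) \<times> (nat \<Rightarrow> nat) \<Rightarrow> (nat \<Rightarrow> nat) \<times> (nat \<Rightarrow> nat) \<Rightarrow> nat" where
  "pair_dist u v = hamming (fst u) (fst v) + hamming (snd u) (snd v)"

text \<open>The letter \<open>x i\<close> is absorbed into row \<open>i\<close> of \<open>y\<close>.
  This displaces each row by at most 1, an additive error; but injectivity of \<open>\<psi>\<close>
  keeps different values at distance at least 1, so the error becomes a factor row by row.\<close>

lemma bilipschitz_absorb:
  assumes a: "a \<ge> 1" and b: "b \<ge> 2"
  shows "bilipschitz (words a \<times> words b) pair_dist (words b) hamming"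
proof -
  obtain \<psi> where \<psi>: "bij_betw \<psi> ({..<a} \<times> words b) (words b)" "\<psi> (0, \<lambda>_. 0) = (\<lambda>_. 0)"
    "\<And>k x. k < a \<Longrightarrow> x \<in> words b \<Longrightarrow> hamming (\<psi> (k, x)) x \<le> 1"
    using absorb_letter[OF a b] by blast
  have \<psi>w: "\<psi> (k, x) \<in> words b" if "k < a" "x \<in> words b" for k x
    using \<psi>(1) that by (auto simp: bij_betw_def)
  have \<psi>inj: "k = l \<and> x = y" if "\<psi> (k, x) = \<psi> (l, y)" "k < a" "x \<in> words b" "l < a" "y \<in> words b" for k l x y
    using inj_onD[OF bij_betw_imp_inj_on[OF \<psi>(1)] that(1)] that by auto
  have wa: "x i < a" if "x \<in> words a" for x i using that by (simp add: words_def)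
  have "\<exists>w\<in>words b. \<forall>i. row_of w i = \<psi> (x i, row_of y i)" if x: "x \<in> words a" and y: "y \<in> words b" for x y
  proof -
    have "{i. \<psi> (x i, row_of y i) \<noteq> (\<lambda>_. 0)} \<subseteq> {i. x i \<noteq> 0} \<union> {i. row_of y i \<noteq> (\<lambda>_. 0)}"
      using \<psi>(2) by auto
    moreover have "finite ({i. x i \<noteq> 0} \<union> {i. row_of y i \<noteq> (\<lambda>_. 0)})"
      using x finite_nonzero_rows[OF y] by (simp add: words_def)
    ultimately have "finite {i. \<psi> (x i, row_of y i) \<noteq> (\<lambda>_. 0)}" by (rule finite_subset)
    then obtain w where "w \<in> words b" "row_of w = (\<lambda>i. \<psi> (x i, row_of y i))"
      using words_by_rows[of "\<lambda>i. \<psi> (x i, row_of y i)" b] \<psi>w wa[OF x] row_words[OF y] by blast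
    then show ?thesis by (intro bexI[of _ w]) simp_all
  qed
  then obtain \<theta> where \<theta>: "\<And>x y. x \<in> words a \<Longrightarrow> y \<in> words b \<Longrightarrow> \<theta> x y \<in> words b"
    "\<And>x y i. x \<in> words a \<Longrightarrow> y \<in> words b \<Longrightarrow> row_of (\<theta> x y) i = \<psi> (x i, row_of y i)"
    by metis
  have bounds: "hamming (\<theta> x y) (\<theta> x' y') \<le> 4 * pair_dist (x, y) (x', y') \<and> pair_dist (x, y) (x', y') \<le> 4 * hamming (\<theta> x y) (\<theta> x' y')"
    if w: "x \<in> words a" "y \<in> words b" "x' \<in> words a" "y' \<in> words b" for x y x' y'
  proof -
    define F where "F = {i. x i \<noteq> x' i} \<union> {i. row_of y i \<noteq> (\<lambda>_. 0)} \<union> {i. row_of y' i \<noteq> (\<lambda>_. 0)}"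
    have F: "finite F"
      unfolding F_def using w finite_words_diff finite_nonzero_rows by blast
    define \<delta> where "\<delta> i = (if x i \<noteq> x' i then 1 else 0 :: nat)" for i
    have rF: "row_of y i = row_of y' i" if "i \<notin> F" for i using that by (simp add: F_def)
    have "hamming x x' = card {i \<in> F. x i \<noteq> x' i}"
      unfolding hamming_def by (rule arg_cong[of _ _ card]) (auto simp: F_def)
    also have "\<dots> = (\<Sum>i\<in>F. \<delta> i)"
      using F by (simp add: \<delta>_def sum.If_cases Int_def)
    finally have 1: "hamming x x' = (\<Sum>i\<in>F. \<delta> i)" .
    have 2: "hamming y y' = (\<Sum>i\<in>F. hamming (row_of y i) (row_of y' i))"
      using F rF by (intro hamming_rows[OF w(2,4)]) auto
    have "row_of (\<theta> x y) i = row_of (\<theta> x' y') i" if "i \<notin> F" for i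
      using that rF[OF that] \<theta>(2) w by (simp add: F_def)
    then have 3: "hamming (\<theta> x y) (\<theta> x' y') = (\<Sum>i\<in>F. hamming (\<psi> (x i, row_of y i)) (\<psi> (x' i, row_of y' i)))"
      using hamming_rows[OF \<theta>(1)[OF w(1,2)] \<theta>(1)[OF w(3,4)] F] \<theta>(2) w by auto
    have step: "hamming (\<psi> (x i, row_of y i)) (\<psi> (x' i, row_of y' i)) \<le> 4 * (\<delta> i + hamming (row_of y i) (row_of y' i)) \<and>
      \<delta> i + hamming (row_of y i) (row_of y' i) \<le> 4 * hamming (\<psi> (x i, row_of y i)) (\<psi> (x' i, row_of y' i))" for i
    proof (cases "x i = x' i \<and> row_of y i = row_of y' i")
      case True
      then show ?thesis by (simp add: \<delta>_def hamming_def)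
    next
      case False
      let ?u = "\<psi> (x i, row_of y i)" and ?v = "\<psi> (x' i, row_of y' i)"
      note r = row_words[OF w(2), of i] row_words[OF w(4), of i]
      have uv: "?u \<in> words b" "?v \<in> words b" using \<psi>w wa w r by auto
      have "?u \<noteq> ?v" using \<psi>inj[of "x i" "row_of y i" "x' i" "row_of y' i"] wa w r False by blast
      then have pos: "1 \<le> hamming ?u ?v" using finite_words_diff[OF uv] by (intro hamming_pos)
      have pos': "1 \<le> \<delta> i + hamming (row_of y i) (row_of y' i)"
        using False finite_words_diff[OF r] hamming_pos[of "row_of y i" "row_of y' i"] by (auto simp: \<delta>_def)
      have b1: "hamming ?u (row_of y i) \<le> 1" "hamming ?v (row_of y' i) \<le> 1" using \<psi>(3) wa w r by auto
      have "hamming ?u ?v \<le> hamming ?u (row_of y i) + (hamming (row_of y i) (row_of y' i) + hamming (row_of y' i) ?v)"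
        using finite_words_diff uv r
        by (intro order_trans[OF hamming_triangle[of _ "row_of y i"]] add_left_mono hamming_triangle) auto
      then have up: "hamming ?u ?v \<le> 2 + hamming (row_of y i) (row_of y' i)"
        using b1 hamming_commute[of ?v "row_of y' i"] by linarith
      have "hamming (row_of y i) (row_of y' i) \<le> hamming (row_of y i) ?u + (hamming ?u ?v + hamming ?v (row_of y' i))"
        using finite_words_diff uv r
        by (intro order_trans[OF hamming_triangle[of _ ?u]] add_left_mono hamming_triangle) auto
      then have low: "hamming (row_of y i) (row_of y' i) \<le> 2 + hamming ?u ?v"
        using b1 hamming_commute[of ?u "row_of y i"] by linarith
      have "\<delta> i \<le> 1" by (simp add: \<delta>_def)
      \<comment> \<open>The constant 4 comes from \<open>e + r \<le> 1 + (2 + u)\<close> and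
        \<open>1 \<le> u\<close>; the other inequality would hold with 3.\<close>
      moreover have "u \<le> 4 * (e + r) \<and> e + r \<le> 4 * u"
        if "u \<le> 2 + r" "r \<le> 2 + u" "1 \<le> u" "1 \<le> e + r" "e \<le> 1" for u r e :: nat
        using that by auto
      ultimately show ?thesis using up low pos pos' by blast
    qed
    have "hamming (\<theta> x y) (\<theta> x' y') \<le> (\<Sum>i\<in>F. 4 * (\<delta> i + hamming (row_of y i) (row_of y' i)))"
      unfolding 3 by (rule sum_mono) (use step in blast)
    moreover have "(\<Sum>i\<in>F. \<delta> i + hamming (row_of y i) (row_of y' i)) \<le> (\<Sum>i\<in>F. 4 * hamming (\<psi> (x i, row_of y i)) (\<psi> (x' i, row_of y' i)))"
      by (rule sum_mono) (use step in blast)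
    ultimately show ?thesis
      unfolding pair_dist_def fst_conv snd_conv using 1 2 3 by (simp add: sum.distrib sum_distrib_left)
  qed
  have "inj_on (\<lambda>(x, y). \<theta> x y) (words a \<times> words b)"
  proof (rule inj_onI, clarify)
    fix x y x' y' assume w: "x \<in> words a" "y \<in> words b" "x' \<in> words a" "y' \<in> words b" and e: "\<theta> x y = \<theta> x' y'"
    have "\<psi> (x i, row_of y i) = \<psi> (x' i, row_of y' i)" for i using e \<theta>(2) w by metis
    then have "x i = x' i \<and> row_of y i = row_of y' i" for i using \<psi>inj wa w row_words by blast
    then show "x = x' \<and> y = y'" using row_inject[of y y'] by blast
  qed
  moreover have "w \<in> (\<lambda>(x, y). \<theta> x y) ` (words a \<times> words b)" if w: "w \<in> words b" for w
  proof -
    have "\<exists>u. u \<in> {..<a} \<times> words b \<and> \<psi> u = row_of w i" for i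
      using \<psi>(1) row_words[OF w, of i] unfolding bij_betw_def by (metis imageE)
    then obtain u where u: "\<And>i. u i \<in> {..<a} \<times> words b" "\<And>i. \<psi> (u i) = row_of w i" by metis
    \<comment> \<open>Zero rows come from the zero pair, which gives the preimage finite
      support.\<close>
    have u0: "u i = (0, \<lambda>_. 0)" if "row_of w i = (\<lambda>_. 0)" for i
    proof -
      have "(0, \<lambda>_. 0) \<in> {..<a} \<times> words b" using a b by (auto simp: words_def)
      then show ?thesis
        using inj_onD[OF bij_betw_imp_inj_on[OF \<psi>(1)], of "u i" "(0, \<lambda>_. 0)"] u that \<psi>(2) by simp
    qed
    have "{i. fst (u i) \<noteq> 0} \<subseteq> {i. row_of w i \<noteq> (\<lambda>_. 0)}" "{i. snd (u i) \<noteq> (\<lambda>_. 0)} \<subseteq> {i. row_of w i \<noteq> (\<lambda>_. 0)}"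
      using u0 by fastforce+
    then have fin: "finite {i. fst (u i) \<noteq> 0}" "finite {i. snd (u i) \<noteq> (\<lambda>_. 0)}"
      using finite_nonzero_rows[OF w] finite_subset by blast+
    have "fst (u i) < a" "snd (u i) \<in> words b" for i using u(1)[of i] by (auto simp: mem_Times_iff)
    then obtain y where y: "y \<in> words b" "row_of y = (\<lambda>i. snd (u i))"
      using words_by_rows[of "\<lambda>i. snd (u i)" b] fin(2) by blast
    define x where "x i = fst (u i)" for i
    have x: "x \<in> words a" using fin(1) \<open>\<And>i. fst (u i) < a\<close> by (simp add: words_def x_def)
    have "row_of (\<theta> x y) = row_of w"
      using \<theta>(2)[OF x y(1)] u(2) y(2) by (auto simp: x_def fun_eq_iff)
    then have "\<theta> x y = w" by (rule row_inject)
    then show ?thesis using x y(1) by force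
  qed
  moreover have "(\<lambda>(x, y). \<theta> x y) ` (words a \<times> words b) \<subseteq> words b" using \<theta>(1) by auto
  ultimately have "bij_betw (\<lambda>(x, y). \<theta> x y) (words a \<times> words b) (words b)"
    unfolding bij_betw_def by blast
  then show ?thesis
    unfolding bilipschitz_def using bounds by (intro exI[of _ "\<lambda>(x, y). \<theta> x y"] exI[of _ 4]) auto
qed

lemma bilipschitz_swap:
  "bilipschitz (words a \<times> words b) pair_dist (words b \<times> words a) pair_dist"
  unfolding bilipschitz_def
proof (intro exI conjI ballI)
  show "bij_betw prod.swap (words a \<times> words b) (words b \<times> words a)"
    by (auto simp: bij_betw_def product_swap)
  show "pair_dist (prod.swap x) (prod.swap y) \<le> 1 * pair_dist x y" "pair_dist x y \<le> 1 * pair_dist (prod.swap x) (prod.swap y)" for x y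
    by (simp_all add: pair_dist_def)
qed

lemma bilipschitz_words:
  assumes "a \<ge> 2" "b \<ge> 2"
  shows "bilipschitz (words a) hamming (words b) hamming"
proof -
  have "bilipschitz (words a) hamming (words b \<times> words a) pair_dist"
    by (rule bilipschitz_sym[OF bilipschitz_absorb]) (use assms in auto)
  then have "bilipschitz (words a) hamming (words a \<times> words b) pair_dist"
    by (rule bilipschitz_trans[OF _ bilipschitz_swap])
  then show ?thesis
    by (rule bilipschitz_trans[OF _ bilipschitz_absorb]) (use assms in auto)
qed

section \<open>The path metric of the cube\<close>

lemma cube_walk_hamming:
  "(x, y) \<in> cube_edges ^^ n \<Longrightarrow> x \<in> cube_vertices \<Longrightarrow> y \<in> cube_vertices \<and> hamming x y \<le> n"
proof (induction n arbitrary: y)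
  case 0
  then show ?case by (simp add: hamming_def)
next
  case (Suc n)
  then obtain z where z: "(x, z) \<in> cube_edges ^^ n" "(z, y) \<in> cube_edges" by auto
  have IH: "z \<in> cube_vertices" "hamming x z \<le> n" using Suc.IH[OF z(1) Suc.prems(2)] by auto
  have y: "y \<in> cube_vertices" using z(2) by (simp add: cube_edges_def)
  obtain i where "{i. z i \<noteq> y i} = {i}" using z(2) by (auto simp: cube_edges_def)
  then have "hamming z y = 1" by (simp add: hamming_def)
  moreover have "finite {i. u i \<noteq> v i}" if "u \<in> cube_vertices" "v \<in> cube_vertices" for u v
    by (rule finite_subset[of _ "{i. u i} \<union> {i. v i}"]) (use that in \<open>auto simp: cube_vertices_def\<close>)
  ultimately show ?case
    using hamming_triangle[of x z y] IH Suc.prems(2) y by fastforce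
qed

lemma cube_walk_exists:
  "x \<in> cube_vertices \<Longrightarrow> y \<in> cube_vertices \<Longrightarrow> hamming x y = n \<Longrightarrow> (x, y) \<in> cube_edges ^^ n"
proof (induction n arbitrary: y)
  case (0 y)
  have "finite {i. x i \<noteq> y i}"
    by (rule finite_subset[of _ "{i. x i} \<union> {i. y i}"]) (use 0 in \<open>auto simp: cube_vertices_def\<close>)
  then have "x = y" using 0(3) hamming_pos[of x y] by (metis not_one_le_zero)
  then show ?case by simp
next
  case (Suc n y)
  have "x \<noteq> y" using Suc.prems(3) by (auto simp: hamming_def)
  then obtain i where i: "x i \<noteq> y i" by (auto simp: fun_eq_iff)
  define z where "z = y(i := x i)"
  have zd: "{j. x j \<noteq> z j} = {j. x j \<noteq> y j} - {i}" by (auto simp: z_def)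
  have "hamming x z = n" unfolding hamming_def zd using Suc.prems(3) i by (simp add: hamming_def card_Diff_singleton)
  moreover have z: "z \<in> cube_vertices"
  proof -
    have "{j. z j} \<subseteq> insert i {j. y j}" by (auto simp: z_def)
    moreover have "finite (insert i {j. y j})" using Suc.prems(2) by (simp add: cube_vertices_def)
    ultimately have "finite {j. z j}" by (rule finite_subset)
    then show ?thesis by (simp add: cube_vertices_def)
  qed
  ultimately have "(x, z) \<in> cube_edges ^^ n" using Suc by blast
  moreover have "(z, y) \<in> cube_edges"
    using z Suc.prems(2) i by (auto simp: cube_edges_def z_def)
  ultimately show ?case by auto
qed

lemma cube_dist_hamming:
  assumes "x \<in> cube_vertices" "y \<in> cube_vertices"
  shows "cube_dist x y = real (hamming x y)"
proof -
  have "graph_dist cube_edges x y = hamming x y"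
    unfolding graph_dist_def using assms cube_walk_exists cube_walk_hamming by (intro Least_equality) blast+
  then show ?thesis by (simp add: cube_dist_def)
qed

lemma bilipschitz_words_cube:
  "bilipschitz (words 2) hamming cube_vertices hamming"
  unfolding bilipschitz_def
proof (intro exI conjI ballI)
  let ?f = "\<lambda>x i. x i \<noteq> (0 :: nat)"
  show "bij_betw ?f (words 2) cube_vertices"
  proof (rule bij_betwI)
    show "?f \<in> words 2 \<rightarrow> cube_vertices" by (auto simp: words_def cube_vertices_def)
    show "(\<lambda>x i. if x i then 1 else 0) \<in> cube_vertices \<rightarrow> words 2" by (auto simp: words_def cube_vertices_def)
    show "(\<lambda>i. if x i \<noteq> 0 then 1 else 0) = x" if "x \<in> words 2" for x
    proof
      fix i
      have "x i = 0 \<or> x i = 1" using that by (auto simp: words_def less_2_cases_iff)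
      then show "(if x i \<noteq> 0 then 1 else 0) = x i" by auto
    qed
  qed auto
  fix x y assume "x \<in> words 2" "y \<in> words 2"
  then have "(x i = 0 \<or> x i = 1) \<and> (y i = 0 \<or> y i = 1)" for i
    by (simp add: words_def less_2_cases_iff)
  then have "((x i \<noteq> 0) \<noteq> (y i \<noteq> 0)) = (x i \<noteq> y i)" for i by (metis zero_neq_one)
  then show "hamming (?f x) (?f y) \<le> 1 * hamming x y" "hamming x y \<le> 1 * hamming (?f x) (?f y)"
    by (simp_all add: hamming_def)
qed

section \<open>The recolouring metric\<close>

context CB_colouring
begin

text \<open>The points of rank exactly \<open>\<beta>\<close>, the only ones that the metric
  sees.\<close>

definition "Z = CB_deriv X \<beta> - P"

text \<open>The colouring conjugated by \<open>g\<close>. The colours, being points of the space,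
  are moved as well; by \<open>recolour_comp\<close> this makes the distance invariant under left
  multiplication.\<close>

definition "recolour g w = g (c (inv_into UNIV g w))"

definition "recolour_dist g h = card {w \<in> Z. recolour g w \<noteq> recolour h w}"

lemma Z_top: "Z \<subseteq> topspace X"
  using CB_deriv_subset[of X \<beta>] by (auto simp: Z_def)

lemma homeos_Z: "g \<in> homeos X \<Longrightarrow> g w \<in> Z \<longleftrightarrow> w \<in> Z"
  using homeos_CB_deriv[of g X w \<alpha>] homeos_CB_deriv[of g X w \<beta>] by (simp add: Z_def)

lemma homeos_P: "g \<in> homeos X \<Longrightarrow> g w \<in> P \<longleftrightarrow> w \<in> P"
  by (rule homeos_CB_deriv)

lemma recolour_id: "recolour id w = c w"
proof -
  have "inv_into UNIV id w = w" by (metis id_apply inv_f_f inj_on_id)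
  then show ?thesis by (simp add: recolour_def)
qed

lemma recolour_in:
  assumes "g \<in> homeos X" "w \<in> topspace X" shows "recolour g w \<in> P"
proof -
  have "inv_into UNIV g w \<in> topspace X" using homeos_topspace[OF homeos_inv[OF assms(1)]] assms(2) by simp
  then show ?thesis using colour_in homeos_P[OF assms(1)] by (simp add: recolour_def)
qed

lemma recolour_comp:
  assumes "k \<in> homeos X" "g \<in> homeos X"
  shows "recolour (k \<circ> g) (k w) = k (recolour g w)"
proof -
  note b = homeos_bij[OF assms(1)] homeos_bij[OF assms(2)] homeos_bij[OF homeos_comp[OF assms]]
  have "inv_into UNIV (k \<circ> g) (k w) = inv_into UNIV g w"
  proof -
    have "(k \<circ> g) (inv_into UNIV g w) = k w" using b(2) by (simp add: bij_is_surj surj_f_inv_f)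
    then show ?thesis using b(3) by (metis bij_is_inj inv_f_f)
  qed
  then show ?thesis by (simp add: recolour_def)
qed

lemma finite_recolour_colour:
  assumes g: "g \<in> homeos X"
  shows "finite {w \<in> Z. recolour g w \<noteq> c w}"
proof -
  note gi = homeos_inv[OF g]
  note bij = homeos_bij[OF g]
  \<comment> \<open>On the set removed for \<open>p\<close> both colourings take the value
    \<open>p\<close>, so \<open>?A\<close> contains every point of disagreement.\<close>
  let ?A = "topspace X - (\<Union>p\<in>P. Y p \<inter> g ` Y (inv_into UNIV g p))"
  have mem: "w \<in> g ` Y r \<longleftrightarrow> w \<in> topspace X \<and> c (inv_into UNIV g w) = r" for w r
  proof -
    have "w \<in> g ` Y r \<longleftrightarrow> inv_into UNIV g w \<in> Y r"
    proof
      assume "w \<in> g ` Y r"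
      then show "inv_into UNIV g w \<in> Y r" using bij by (auto simp: bij_is_inj)
    next
      assume "inv_into UNIV g w \<in> Y r"
      moreover have "g (inv_into UNIV g w) = w" using bij by (simp add: bij_is_surj surj_f_inv_f)
      ultimately show "w \<in> g ` Y r" by (metis image_eqI)
    qed
    then show ?thesis using homeos_topspace[OF gi] by (simp add: Y_def)
  qed
  have rc: "recolour g w = p \<longleftrightarrow> c (inv_into UNIV g w) = inv_into UNIV g p" for w p
    unfolding recolour_def by (rule bij_inv_eq_iff[OF bij, symmetric])
  have "clopenin X ?A"
    using Y_clopen homeos_clopenin[OF g] homeos_P[OF gi] finite_top
    by (intro clopenin_Diff clopenin_topspace clopenin_UN clopenin_Int) auto
  moreover have "?A \<inter> P = {}"
  proof -
    have "p \<in> Y p \<inter> g ` Y (inv_into UNIV g p)" if p: "p \<in> P" for p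
    proof -
      have "inv_into UNIV g p \<in> P" using homeos_P[OF gi] p by simp
      then show ?thesis unfolding Int_iff mem using p P_top colour_top by (auto simp: Y_def)
    qed
    then show ?thesis by blast
  qed
  ultimately have "finite (?A \<inter> CB_deriv X \<beta>)" by (rule finite_CB_beta)
  moreover have "{w \<in> Z. recolour g w \<noteq> c w} \<subseteq> ?A \<inter> CB_deriv X \<beta>"
  proof
    fix w assume "w \<in> {w \<in> Z. recolour g w \<noteq> c w}"
    then have w: "w \<in> Z" "recolour g w \<noteq> c w" by auto
    have "w \<notin> g ` Y (inv_into UNIV g (c w))" unfolding mem using w(2) rc[of w "c w"] by simp
    then have "w \<notin> Y p \<inter> g ` Y (inv_into UNIV g p)" for p by (auto simp: Y_def)
    then show "w \<in> ?A \<inter> CB_deriv X \<beta>" using w(1) Z_top by (auto simp: Z_def)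
  qed
  ultimately show ?thesis by (rule finite_subset[rotated])
qed

lemma finite_recolour:
  assumes "g \<in> homeos X" "h \<in> homeos X"
  shows "finite {w \<in> Z. recolour g w \<noteq> recolour h w}"
  by (rule finite_subset[of _ "{w \<in> Z. recolour g w \<noteq> c w} \<union> {w \<in> Z. recolour h w \<noteq> c w}"])
    (use assms finite_recolour_colour in auto)

lemma recolour_dist_commute: "recolour_dist g h = recolour_dist h g"
  by (simp add: recolour_dist_def eq_commute)

lemma recolour_dist_self: "recolour_dist g g = 0"
  by (simp add: recolour_dist_def)

lemma recolour_dist_triangle:
  assumes "f \<in> homeos X" "g \<in> homeos X" "h \<in> homeos X"
  shows "recolour_dist f h \<le> recolour_dist f g + recolour_dist g h"
proof -
  have "recolour_dist f h \<le> card ({w \<in> Z. recolour f w \<noteq> recolour g w} \<union> {w \<in> Z. recolour g w \<noteq> recolour h w})"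
    unfolding recolour_dist_def using finite_recolour assms by (intro card_mono) auto
  also have "\<dots> \<le> recolour_dist f g + recolour_dist g h"
    unfolding recolour_dist_def by (rule card_Un_le)
  finally show ?thesis .
qed

lemma recolour_dist_left:
  assumes "k \<in> homeos X" "g \<in> homeos X" "h \<in> homeos X"
  shows "recolour_dist (k \<circ> g) (k \<circ> h) = recolour_dist g h"
proof -
  note bij = homeos_bij[OF assms(1)]
  have "{w \<in> Z. recolour (k \<circ> g) w \<noteq> recolour (k \<circ> h) w} = k ` {w \<in> Z. recolour g w \<noteq> recolour h w}"
  proof (intro subset_antisym subsetI)
    fix w assume w: "w \<in> {w \<in> Z. recolour (k \<circ> g) w \<noteq> recolour (k \<circ> h) w}"
    obtain v where v: "w = k v" using bij by (metis bij_pointE)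
    have "v \<in> Z" "recolour g v \<noteq> recolour h v"
      using w recolour_comp[OF assms(1,2), of v] recolour_comp[OF assms(1,3), of v] homeos_Z[OF assms(1), of v]
      unfolding v by auto
    then show "w \<in> k ` {w \<in> Z. recolour g w \<noteq> recolour h w}" using v by blast
  next
    fix w assume "w \<in> k ` {w \<in> Z. recolour g w \<noteq> recolour h w}"
    then obtain v where v: "w = k v" "v \<in> Z" "recolour g v \<noteq> recolour h v" by auto
    then show "w \<in> {w \<in> Z. recolour (k \<circ> g) w \<noteq> recolour (k \<circ> h) w}"
      using recolour_comp[OF assms(1,2)] recolour_comp[OF assms(1,3)] homeos_Z[OF assms(1)] bij
      by (simp add: bij_is_inj inj_eq)
  qed
  moreover have "inj_on k S" for S using bij bij_is_inj inj_on_subset by blast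
  ultimately show ?thesis by (simp add: recolour_dist_def card_image)
qed

text \<open>\<open>g\<close> carries the moved points to the places where the colourings disagree:
  for pure \<open>g\<close>, the value of \<open>recolour g\<close> at \<open>g x\<close> is
  \<open>c x\<close>.\<close>

lemma card_moved:
  assumes g: "g \<in> pure"
  shows "card (moved g \<inter> CB_deriv X \<beta>) = recolour_dist id g"
proof -
  have gX: "g \<in> homeos X" and gp: "\<And>p. p \<in> P \<Longrightarrow> g p = p" using g by (auto simp: pure_def)
  note bij = homeos_bij[OF gX]
  have rc: "recolour g (g x) = c x" if "x \<in> topspace X" for x
    using gp colour_in[OF that] bij by (simp add: recolour_def bij_is_inj)
  have "{w \<in> Z. recolour id w \<noteq> recolour g w} = g ` (moved g \<inter> CB_deriv X \<beta>)"
  proof (intro subset_antisym subsetI)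
    fix w assume w: "w \<in> {w \<in> Z. recolour id w \<noteq> recolour g w}"
    obtain v where v: "w = g v" using bij by (metis bij_pointE)
    have "v \<in> Z" using w homeos_Z[OF gX] v by auto
    then have "v \<in> topspace X" "v \<in> CB_deriv X \<beta>" using Z_top by (auto simp: Z_def)
    then show "w \<in> g ` (moved g \<inter> CB_deriv X \<beta>)"
      using w v rc[of v] by (auto simp: moved_def recolour_id)
  next
    fix w assume "w \<in> g ` (moved g \<inter> CB_deriv X \<beta>)"
    then obtain v where v: "w = g v" "v \<in> topspace X" "c (g v) \<noteq> c v" "v \<in> CB_deriv X \<beta>"
      by (auto simp: moved_def)
    have "v \<notin> P" using gp v(3) by auto
    then have "w \<in> Z" using v homeos_Z[OF gX] by (simp add: Z_def)
    then show "w \<in> {w \<in> Z. recolour id w \<noteq> recolour g w}"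
      using v rc[of v] by (simp add: recolour_id)
  qed
  moreover have "inj_on g S" for S using bij bij_is_inj inj_on_subset by blast
  ultimately show ?thesis by (simp add: recolour_dist_def card_image)
qed

lemma countable_Z: "countable Z"
  using countable Z_top countable_subset by blast

lemma infinite_Z:
  assumes "P \<noteq> {}" shows "infinite Z"
proof -
  obtain p where p: "p \<in> P" using assms by blast
  have h: "half (Y p - {p})" by (rule half_punctured[OF Y_clopen[OF p] Y_P[OF p]])
  have "(Y p - {p}) \<inter> CB_deriv X \<beta> \<subseteq> Z"
    using h by (auto simp: half_def Z_def)
  then show ?thesis using h finite_subset by (auto simp: half_def)
qed

text \<open>The new classes \<open>V p\<close> arise from the \<open>Y p\<close> by exchanging small
  pieces around the finitely many changed points. Each still has \<open>p\<close> as its only top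
  point, so \<open>unique_piece\<close> maps \<open>Y p\<close> onto \<open>V p\<close>, and these
  maps together form \<open>g\<close>.\<close>

lemma recolour_surj:
  assumes t: "\<And>w. w \<in> Z \<Longrightarrow> t w \<in> P" and fin: "finite {w \<in> Z. t w \<noteq> c w}"
  shows "\<exists>g\<in>homeos X. \<forall>w\<in>Z. recolour g w = t w"
proof -
  define W where "W = {w \<in> Z. t w \<noteq> c w}"
  have W: "finite W" "W \<subseteq> Z" using fin by (auto simp: W_def)
  have "\<exists>E. clopenin X E \<and> E \<inter> CB_deriv X \<beta> = {w}" if w: "w \<in> W" for w
  proof -
    have "w \<in> CB_deriv X \<beta>" "w \<notin> P" "w \<in> topspace X" using w W Z_top by (auto simp: Z_def)
    then obtain E where "clopenin X E" "w \<in> E" "E \<subseteq> topspace X" "E \<inter> CB_deriv X \<beta> = {w}"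
      by (rule clopen_in_rank_beta[OF _ _ openin_topspace])
    then show ?thesis by blast
  qed
  then obtain E where E: "\<And>w. w \<in> W \<Longrightarrow> clopenin X (E w)" "\<And>w. w \<in> W \<Longrightarrow> E w \<inter> CB_deriv X \<beta> = {w}" by metis
  \<comment> \<open>Subtracting the other pieces makes them disjoint and keeps \<open>w\<close>,
    which lies in none of the others.\<close>
  define E' where "E' w = E w - (\<Union>v\<in>W - {w}. E v)" for w
  have E': "clopenin X (E' w)" if "w \<in> W" for w
    unfolding E'_def using E(1) that W(1) by (intro clopenin_Diff clopenin_UN) auto
  have E'_disj: "E' v \<inter> E' w = {}" if "v \<in> W" "w \<in> W" "v \<noteq> w" for v w
    using that by (auto simp: E'_def)
  have E'_mem: "v \<in> E' w \<longleftrightarrow> v = w" if v: "v \<in> CB_deriv X \<beta>" and w: "w \<in> W" for v w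
  proof
    assume "v \<in> E' w"
    then show "v = w" using E(2)[OF w] v by (auto simp: E'_def)
  next
    assume vw: "v = w"
    have "w \<notin> E u" if "u \<in> W - {w}" for u
    proof -
      have "E u \<inter> CB_deriv X \<beta> = {u}" "w \<noteq> u" "w \<in> CB_deriv X \<beta>" using E(2)[of u] that v vw by auto
      then show ?thesis by blast
    qed
    moreover have "w \<in> E w" using E(2)[OF w] by blast
    ultimately show "v \<in> E' w" using vw by (auto simp: E'_def)
  qed
  define V where "V p = (Y p - (\<Union>w\<in>W. E' w)) \<union> (\<Union>w\<in>{w \<in> W. t w = p}. E' w)" for p
  have V: "clopenin X (V p)" if "p \<in> P" for p
    unfolding V_def using Y_clopen[OF that] E' W(1)
    by (intro clopenin_Un clopenin_Diff clopenin_UN) auto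
  have VP: "V p \<inter> P = {p}" if "p \<in> P" for p
  proof -
    have "r \<notin> E' w" if "r \<in> P" "w \<in> W" for r w
      using E'_mem[of r w] that CB_alpha_subset W(2) by (auto simp: Z_def)
    then show ?thesis using Y_P[OF that] unfolding V_def by blast
  qed
  have "\<exists>f. homeo_on X (Y p) (V p) f \<and> f p = p" if p: "p \<in> P" for p
    by (rule unique_piece[OF order_refl Y_clopen[OF p] V[OF p] Y_P[OF p] VP[OF p]])
  then obtain f where f: "\<And>p. p \<in> P \<Longrightarrow> homeo_on X (Y p) (V p) (f p)" "\<And>p. p \<in> P \<Longrightarrow> f p p = p" by metis
  define g where "g x = (if x \<in> topspace X then f (c x) x else x)" for x
  have gY: "homeo_on X (Y p) (V p) g" if "p \<in> P" for p
    by (rule homeo_on_cong[OF f(1)[OF that]]) (simp add: g_def Y_def)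
  have UV: "(\<Union>p\<in>P. V p) = topspace X"
  proof (intro subset_antisym subsetI)
    fix x assume "x \<in> (\<Union>p\<in>P. V p)"
    then show "x \<in> topspace X" using V clopenin_subset by blast
  next
    fix x assume x: "x \<in> topspace X"
    show "x \<in> (\<Union>p\<in>P. V p)"
    proof (cases "\<exists>w\<in>W. x \<in> E' w")
      case True
      then obtain w where w: "w \<in> W" "x \<in> E' w" by blast
      then have "x \<in> V (t w)" "t w \<in> P" using t W(2) by (auto simp: V_def)
      then show ?thesis by blast
    next
      case False
      then have "x \<in> V (c x)" using x by (auto simp: V_def Y_def)
      then show ?thesis using colour_in[OF x] by blast
    qed
  qed
  have V_disj: "V p \<inter> V q = {}" if "p \<noteq> q" for p q
  proof (rule ccontr)
    assume "V p \<inter> V q \<noteq> {}"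
    then obtain x where x: "x \<in> V p" "x \<in> V q" by blast
    show False
    proof (cases "\<exists>w\<in>W. x \<in> E' w")
      case True
      then obtain w where w: "w \<in> W" "x \<in> E' w" by blast
      have tv: "t v = t w" if "v \<in> W" "x \<in> E' v" for v
      proof (cases "v = w")
        case False
        then show ?thesis using E'_disj[OF that(1) w(1)] that w by blast
      qed simp
      have "r = t w" if "x \<in> V r" for r
        using that w tv unfolding V_def by blast
      then have "p = t w" "q = t w" using x by blast+
      then show False using that by simp
    next
      case False
      then have "x \<in> Y p" "x \<in> Y q" using x by (auto simp: V_def)
      then show False using that by (simp add: Y_def)
    qed
  qed
  have gX: "g \<in> homeos X"
    using gY UV V_disj by (intro homeos_by_colours[of V]) (auto simp: g_def)
  have gp: "g p = p" if "p \<in> P" for p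
    using f(2)[OF that] colour_top[OF that] P_top that by (auto simp: g_def)
  have "recolour g w = t w" if w: "w \<in> Z" for w
  proof -
    have wb: "w \<in> CB_deriv X \<beta>" "w \<in> topspace X" using w Z_top by (auto simp: Z_def)
    have "w \<in> V (t w)"
    proof (cases "w \<in> W")
      case True
      then show ?thesis using E'_mem[OF wb(1) True] by (auto simp: V_def)
    next
      case False
      then have "w \<notin> E' v" if "v \<in> W" for v using E'_mem[OF wb(1) that] that by auto
      moreover have "t w = c w" using False w by (simp add: W_def)
      ultimately show ?thesis using wb by (auto simp: V_def Y_def)
    qed
    then obtain x where x: "x \<in> Y (t w)" "w = g x"
      using homeo_onD(1)[OF gY[OF t[OF w]]] by blast
    have "inv_into UNIV g w = x" using x homeos_bij[OF gX] by (simp add: bij_is_inj)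
    then show ?thesis using x gp[OF t[OF w]] by (simp add: recolour_def Y_def)
  qed
  then show ?thesis using gX by blast
qed

end

text \<open>A homeomorphism may permute X^(\<alpha>), but only finitely many permutations occur.
  Dividing by a representative with the same action on X^(\<alpha>) leaves a pure map, and the
  finitely many representatives contribute only to the additive constant.\<close>

lemma (in CB_coloured_length) length_le_recolour_dist:
  "\<exists>K C. \<forall>g\<in>homeos X. len g \<le> K * real (recolour_dist id g) + C"
proof -
  obtain K C where K: "K \<ge> 0" and KC: "\<And>g. g \<in> pure \<Longrightarrow> len g \<le> K * real (recolour_dist id g) + C"
    using length_le_moved card_moved by metis
  let ?res = "\<lambda>g. restrict g P"
  have "?res ` homeos X \<subseteq> (P \<rightarrow>\<^sub>E P)" using homeos_P by auto
  then have fin: "finite (?res ` homeos X)"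
    by (rule finite_subset) (use finite_top in \<open>simp add: finite_PiE\<close>)
  define rep where "rep s = (SOME g. g \<in> homeos X \<and> ?res g = s)" for s
  have rep: "rep s \<in> homeos X \<and> ?res (rep s) = s" if s: "s \<in> ?res ` homeos X" for s
  proof -
    have "\<exists>g. g \<in> homeos X \<and> ?res g = s" using s by blast
    from someI_ex[OF this] show ?thesis unfolding rep_def .
  qed
  define R where "R = (\<lambda>s. len (rep s) + K * real (recolour_dist (rep s) id))"
  define M where "M = Max (R ` ?res ` homeos X)"
  have "len g \<le> K * real (recolour_dist id g) + (M + C)" if g: "g \<in> homeos X" for g
  proof -
    let ?r = "rep (?res g)"
    have r: "?r \<in> homeos X" "?res ?r = ?res g" using rep[of "?res g"] g by auto
    note bij = homeos_bij[OF r(1)]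
    let ?k = "inv_into UNIV ?r \<circ> g"
    have k: "?k \<in> homeos X" using r(1) g by (intro homeos_comp homeos_inv)
    have "?k p = p" if "p \<in> P" for p
    proof -
      have "g p = ?r p" using r(2) that by (metis restrict_apply')
      then show ?thesis using bij by (simp add: bij_is_inj)
    qed
    then have "?k \<in> pure" using k by (simp add: pure_def)
    then have lk: "len ?k \<le> K * real (recolour_dist id ?k) + C" by (rule KC)
    have rk: "?r \<circ> ?k = g" using bij by (simp add: fun_eq_iff bij_is_surj surj_f_inv_f)
    have "recolour_dist id ?k = recolour_dist ?r g"
      using recolour_dist_left[OF r(1) homeos_id k] rk by simp
    then have "real (recolour_dist id ?k) \<le> real (recolour_dist ?r id) + real (recolour_dist id g)"
      using recolour_dist_triangle[OF r(1) homeos_id g] by linarith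
    then have "K * real (recolour_dist id ?k) \<le> K * real (recolour_dist ?r id) + K * real (recolour_dist id g)"
      using K by (metis distrib_left mult_left_mono)
    moreover have "len g \<le> len ?r + len ?k" using len_comp[OF r(1) k] rk by simp
    moreover have "R (?res g) \<le> M"
      unfolding M_def using fin g by (intro Max_ge) auto
    ultimately show ?thesis using lk unfolding R_def by linarith
  qed
  then show ?thesis by blast
qed

section \<open>The quasi-isometry\<close>

text \<open>Translates from \<open>Homeo X\<close>, whose elements are \<open>undefined\<close>
  outside the space, to \<open>homeos X\<close>; \<open>restrict\<close> is the way back.\<close>

definition extend_id :: "'a topology \<Rightarrow> ('a \<Rightarrow> 'a) \<Rightarrow> 'a \<Rightarrow> 'a" where
  "extend_id X f x = (if x \<in> topspace X then f x else x)"

lemma extend_id_homeos: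
  assumes "f \<in> carrier (Homeo X)" shows "extend_id X f \<in> homeos X"
proof -
  have f: "homeomorphic_map X X f" using assms by (simp add: Homeo_def)
  have "bij_betw f (topspace X) (topspace X)"
    using homeomorphic_imp_injective_map[OF f] homeomorphic_imp_surjective_map[OF f] by (simp add: bij_betw_def)
  then have "homeo_on X (topspace X) (topspace X) f"
    using homeomorphic_map_openness[OF f] unfolding homeo_on_def by blast
  then have "homeo_on X (topspace X) (topspace X) (extend_id X f)"
    by (rule homeo_on_cong) (simp add: extend_id_def)
  then show ?thesis by (simp add: homeos_def extend_id_def)
qed

lemma restrict_homeos:
  assumes f: "f \<in> homeos X" shows "restrict f (topspace X) \<in> carrier (Homeo X)"
proof -
  note bij = homeos_bij[OF f]
  have "homeo_on X (topspace X) (topspace X) f" using f by (simp add: homeos_def)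
  then have img: "f ` topspace X = topspace X" "inj_on f (topspace X)" by (auto dest: homeo_onD)
  have "continuous_map X X f"
    unfolding continuous_map
  proof (intro conjI allI impI)
    fix U assume U: "openin X U"
    have "f ` {x \<in> topspace X. f x \<in> U} = U"
      using img(1) openin_subset[OF U] by auto
    then show "openin X {x \<in> topspace X. f x \<in> U}" using homeos_openin[OF f] U by metis
  qed (use img in simp)
  moreover have "open_map X X f" using homeos_openin[OF f] by (simp add: open_map_def)
  ultimately have "homeomorphic_map X X f" using img by (intro bijective_open_imp_homeomorphic_map)
  then have "homeomorphic_map X X (restrict f (topspace X))" by (rule homeomorphic_map_eq) simp
  then show ?thesis by (simp add: Homeo_def)
qed

lemma extend_id_restrict: "f \<in> homeos X \<Longrightarrow> extend_id X (restrict f (topspace X)) = f"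
  by (auto simp: extend_id_def homeos_def fun_eq_iff)

lemma restrict_extend_id: "f \<in> carrier (Homeo X) \<Longrightarrow> restrict (extend_id X f) (topspace X) = f"
  by (auto simp: extend_id_def Homeo_def extensional_def fun_eq_iff)

lemma restrict_comp:
  assumes "f \<in> homeos X" "g \<in> homeos X"
  shows "restrict (f \<circ> g) (topspace X) = restrict f (topspace X) \<otimes>\<^bsub>Homeo X\<^esub> restrict g (topspace X)"
  using homeos_topspace[OF assms(2)] by (auto simp: Homeo_def compose_def fun_eq_iff)

lemma one_Homeo: "\<one>\<^bsub>Homeo X\<^esub> = restrict id (topspace X)"
  by (auto simp: Homeo_def fun_eq_iff)

lemma mult_Homeo:
  assumes "f \<in> carrier (Homeo X)" "g \<in> carrier (Homeo X)"
  shows "f \<otimes>\<^bsub>Homeo X\<^esub> g = restrict (extend_id X f \<circ> extend_id X g) (topspace X)"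
  using restrict_comp[OF extend_id_homeos[OF assms(1)] extend_id_homeos[OF assms(2)]]
    restrict_extend_id[OF assms(1)] restrict_extend_id[OF assms(2)] by simp

context CB_colouring
begin

lemma maximal_recolour_dist:
  "maximal_pseudometric (Homeo X) (discrete_topology (carrier (Homeo X)))
     (\<lambda>g h. real (recolour_dist (extend_id X g) (extend_id X h)))"
  (is "maximal_pseudometric ?G ?T ?d")
  unfolding maximal_pseudometric_def
proof (intro conjI allI impI)
  interpret group ?G by (rule group_Homeo)
  have "pseudometric_on (carrier ?G) ?d"
    unfolding pseudometric_on_def
  proof (intro conjI ballI)
    fix f g h assume "f \<in> carrier ?G" "g \<in> carrier ?G" "h \<in> carrier ?G"
    then show "?d f h \<le> ?d f g + ?d g h"
      using recolour_dist_triangle[of "extend_id X f" "extend_id X g" "extend_id X h"] extend_id_homeos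
      by (metis of_nat_add of_nat_mono)
  qed (auto simp: recolour_dist_self recolour_dist_commute)
  moreover have "continuous_map (prod_topology ?T ?T) euclideanreal (\<lambda>(g, h). ?d g h)"
    by (simp add: prod_topology_discrete_topology[symmetric])
  moreover have "?d (k \<otimes>\<^bsub>?G\<^esub> g) (k \<otimes>\<^bsub>?G\<^esub> h) = ?d g h"
    if "k \<in> carrier ?G" "g \<in> carrier ?G" "h \<in> carrier ?G" for k g h
    using that by (simp add: mult_Homeo extend_id_restrict extend_id_homeos homeos_comp recolour_dist_left)
  ultimately show "cont_left_inv_pseudometric ?G ?T ?d"
    by (simp add: cont_left_inv_pseudometric_def)
  fix d' assume "cont_left_inv_pseudometric ?G ?T d'"
  then have pm: "pseudometric_on (carrier ?G) d'"
    and left: "\<And>k g h. k \<in> carrier ?G \<Longrightarrow> g \<in> carrier ?G \<Longrightarrow> h \<in> carrier ?G \<Longrightarrow> d' (k \<otimes>\<^bsub>?G\<^esub> g) (k \<otimes>\<^bsub>?G\<^esub> h) = d' g h"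
    by (auto simp: cont_left_inv_pseudometric_def)
  have sym: "d' x y = d' y x" and tri: "d' x z \<le> d' x y + d' y z" and nonneg: "0 \<le> d' x y"
    if "x \<in> carrier ?G" "y \<in> carrier ?G" "z \<in> carrier ?G" for x y z
    using pm that unfolding pseudometric_on_def by blast+
  let ?r = "\<lambda>f. restrict f (topspace X)"
  define len where "len f = d' \<one>\<^bsub>?G\<^esub> (?r f)" for f
  note r = restrict_homeos[where X = X]
  interpret length_function X len
  proof
    show "0 \<le> len f" if "f \<in> homeos X" for f
      using nonneg r[OF that] by (simp add: len_def)
    show "len (f \<circ> g) \<le> len f + len g" if f: "f \<in> homeos X" and g: "g \<in> homeos X" for f g
    proof -
      have "len (f \<circ> g) = d' \<one>\<^bsub>?G\<^esub> (?r f \<otimes>\<^bsub>?G\<^esub> ?r g)" by (simp only: len_def restrict_comp[OF f g])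
      also have "\<dots> \<le> d' \<one>\<^bsub>?G\<^esub> (?r f) + d' (?r f) (?r f \<otimes>\<^bsub>?G\<^esub> ?r g)"
        using r f g by (intro tri) auto
      also have "d' (?r f) (?r f \<otimes>\<^bsub>?G\<^esub> ?r g) = d' (?r f \<otimes>\<^bsub>?G\<^esub> \<one>\<^bsub>?G\<^esub>) (?r f \<otimes>\<^bsub>?G\<^esub> ?r g)"
        using r[OF f] by simp
      also have "\<dots> = len g" using left[OF r[OF f] one_closed r[OF g]] by (simp only: len_def)
      finally show ?thesis by (simp only: len_def)
    qed
    show "len (inv_into UNIV f) = len f" if f: "f \<in> homeos X" for f
    proof -
      note fi = homeos_inv[OF f]
      have "f \<circ> inv_into UNIV f = id"
        using homeos_bij[OF f] by (simp add: fun_eq_iff bij_is_surj surj_f_inv_f)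
      then have "?r f \<otimes>\<^bsub>?G\<^esub> ?r (inv_into UNIV f) = \<one>\<^bsub>?G\<^esub>"
        using restrict_comp[OF f fi] one_Homeo[of X] by simp
      then have "len (inv_into UNIV f) = d' (?r f \<otimes>\<^bsub>?G\<^esub> \<one>\<^bsub>?G\<^esub>) \<one>\<^bsub>?G\<^esub>"
        using left[OF r[OF f] one_closed r[OF fi]] by (simp only: len_def)
      also have "\<dots> = len f"
        unfolding r_one[OF r[OF f]] len_def by (rule sym[OF r[OF f] one_closed one_closed])
      finally show ?thesis .
    qed
  qed
  interpret CB_coloured_length X \<alpha> \<beta> c len ..
  obtain K C where KC: "\<And>g. g \<in> homeos X \<Longrightarrow> len g \<le> K * real (recolour_dist id g) + C"
    using length_le_recolour_dist by blast
  \<comment> \<open>By left invariance both distances depend only on the quotient \<open>?k\<close>,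
    to which the bound on lengths applies.\<close>
  have "d' g h \<le> K * ?d g h + C" if g: "g \<in> carrier ?G" and h: "h \<in> carrier ?G" for g h
  proof -
    let ?g = "extend_id X g" and ?h = "extend_id X h"
    have G: "?g \<in> homeos X" and H: "?h \<in> homeos X" using g h by (auto intro: extend_id_homeos)
    let ?k = "inv_into UNIV ?g \<circ> ?h"
    have k: "?k \<in> homeos X" using G H by (intro homeos_comp homeos_inv)
    have gk: "?g \<circ> ?k = ?h" using homeos_bij[OF G] by (simp add: fun_eq_iff bij_is_surj surj_f_inv_f)
    have "g \<otimes>\<^bsub>?G\<^esub> ?r ?k = h"
      using restrict_comp[OF G k] restrict_extend_id g h gk by metis
    then have "d' g h = d' (g \<otimes>\<^bsub>?G\<^esub> \<one>\<^bsub>?G\<^esub>) (g \<otimes>\<^bsub>?G\<^esub> ?r ?k)" using g by simp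
    also have "\<dots> = len ?k" using left[OF g one_closed r[OF k]] by (simp only: len_def)
    also have "\<dots> \<le> K * real (recolour_dist id ?k) + C" by (rule KC[OF k])
    also have "recolour_dist id ?k = recolour_dist ?g ?h"
      using recolour_dist_left[OF G homeos_id k] gk by simp
    finally show ?thesis .
  qed
  then show "\<exists>K C. \<forall>g\<in>carrier ?G. \<forall>h\<in>carrier ?G. d' g h \<le> K * ?d g h + C" by blast
qed

lemma quasi_isometric_cube:
  assumes card: "card P \<ge> 2"
  shows "quasi_isometric (carrier (Homeo X)) (\<lambda>g h. real (recolour_dist (extend_id X g) (extend_id X h)))
    cube_vertices cube_dist"
proof -
  let ?n = "card P"
  \<comment> \<open>The labelling of the colours depends on \<open>p\<close>, which itself gets the
    label 0. A point of colour \<open>p\<close> that keeps its colour thus contributes the letter 0,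
    and supports are finite.\<close>
  have "\<exists>l. bij_betw l P {..<?n} \<and> l p = 0" if p: "p \<in> P" for p
  proof -
    have "card (P - {p}) = card {1..<?n}" using p finite_top by simp
    then obtain l where l: "bij_betw l (P - {p}) {1..<?n}"
      using finite_same_card_bij[of "P - {p}" "{1..<?n}"] finite_top by auto
    then have "bij_betw (l(p := 0)) (P - {p}) {1..<?n}"
      by (rule bij_betw_cong[THEN iffD1, rotated]) auto
    then have "bij_betw (l(p := 0)) (P - {p} \<union> {p}) ({1..<?n} \<union> {0})"
      using notIn_Un_bij_betw[of p "P - {p}" "l(p := 0)" "{1..<?n}"] by simp
    moreover have "P - {p} \<union> {p} = P" "{1..<?n} \<union> {0} = {..<?n}" using p card by auto
    ultimately show ?thesis by (intro exI[of _ "l(p := 0)"]) simp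
  qed
  then obtain l where l: "\<And>p. p \<in> P \<Longrightarrow> bij_betw (l p) P {..<?n}" "\<And>p. p \<in> P \<Longrightarrow> l p p = 0" by metis
  have "P \<noteq> {}" using card by auto
  define e where "e = from_nat_into Z"
  have e: "bij_betw e UNIV Z"
    unfolding e_def by (rule bij_betw_from_nat_into[OF countable_Z infinite_Z[OF \<open>P \<noteq> {}\<close>]])
  have eZ: "e i \<in> Z" "e i \<in> topspace X" for i using e Z_top by (auto simp: bij_betw_def)
  have cP: "c (e i) \<in> P" for i using colour_in eZ by blast
  define \<omega> where "\<omega> g i = l (c (e i)) (recolour (extend_id X g) (e i))" for g i
  have rP: "recolour (extend_id X g) (e i) \<in> P" if "g \<in> carrier (Homeo X)" for g i
    by (rule recolour_in[OF extend_id_homeos[OF that] eZ(2)])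
  have \<omega>0: "\<omega> g i \<noteq> 0 \<longleftrightarrow> recolour (extend_id X g) (e i) \<noteq> c (e i)" if "g \<in> carrier (Homeo X)" for g i
  proof -
    have "\<omega> g i = l (c (e i)) (c (e i)) \<longleftrightarrow> recolour (extend_id X g) (e i) = c (e i)"
      unfolding \<omega>_def by (rule inj_on_eq_iff[OF bij_betw_imp_inj_on[OF l(1)[OF cP]] rP[OF that] cP])
    then show ?thesis using l(2)[OF cP] by simp
  qed
  have \<omega>: "\<omega> g \<in> words ?n" if g: "g \<in> carrier (Homeo X)" for g
  proof -
    have "{i. \<omega> g i \<noteq> 0} \<subseteq> e -` {w \<in> Z. recolour (extend_id X g) w \<noteq> c w}"
      using \<omega>0[OF g] eZ by auto
    moreover have "finite (e -` {w \<in> Z. recolour (extend_id X g) w \<noteq> c w})"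
      using finite_recolour_colour[OF extend_id_homeos[OF g]] bij_betw_imp_inj_on[OF e] by (rule finite_vimageI)
    ultimately have "finite {i. \<omega> g i \<noteq> 0}" by (rule finite_subset)
    moreover have "\<omega> g i < ?n" for i
      using l(1)[OF cP] rP[OF g] unfolding \<omega>_def bij_betw_def by blast
    ultimately show ?thesis by (simp add: words_def)
  qed
  have \<omega>_dist: "hamming (\<omega> g) (\<omega> h) = recolour_dist (extend_id X g) (extend_id X h)"
    if g: "g \<in> carrier (Homeo X)" and h: "h \<in> carrier (Homeo X)" for g h
  proof -
    let ?I = "{i. \<omega> g i \<noteq> \<omega> h i}"
    have "\<omega> g i = \<omega> h i \<longleftrightarrow> recolour (extend_id X g) (e i) = recolour (extend_id X h) (e i)" for i
      unfolding \<omega>_def by (rule inj_on_eq_iff[OF bij_betw_imp_inj_on[OF l(1)[OF cP]] rP[OF g] rP[OF h]])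
    then have "e ` ?I = {w \<in> Z. recolour (extend_id X g) w \<noteq> recolour (extend_id X h) w}"
      using e unfolding bij_betw_def by auto
    moreover have "card (e ` ?I) = card ?I"
      by (rule card_image) (rule inj_on_subset[OF bij_betw_imp_inj_on[OF e]], simp)
    ultimately show ?thesis by (simp add: hamming_def recolour_dist_def)
  qed
  have \<omega>_surj: "\<exists>g\<in>carrier (Homeo X). \<omega> g = x" if x: "x \<in> words ?n" for x
  proof -
    define t where "t w = inv_into P (l (c w)) (x (inv_into UNIV e w))" for w
    have xl: "x i \<in> l (c (e i)) ` P" for i
      using l(1)[OF cP[of i]] x by (simp add: bij_betw_def words_def)
    have te: "t (e i) \<in> P" "l (c (e i)) (t (e i)) = x i" for i
      using inv_into_into[OF xl] f_inv_into_f[OF xl] bij_betw_imp_inj_on[OF e] by (simp_all add: t_def)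
    have Ze: "\<exists>i. w = e i" if "w \<in> Z" for w using that e by (auto simp: bij_betw_def)
    have "{w \<in> Z. t w \<noteq> c w} \<subseteq> e ` {i. x i \<noteq> 0}"
    proof
      fix w assume w: "w \<in> {w \<in> Z. t w \<noteq> c w}"
      then obtain i where i: "w = e i" using Ze by blast
      have "x i \<noteq> l (c (e i)) (c (e i))"
        using te[of i] w i cP[of i] inj_onD[OF bij_betw_imp_inj_on[OF l(1)[OF cP[of i]]], of "t (e i)" "c (e i)"] by auto
      then show "w \<in> e ` {i. x i \<noteq> 0}" using l(2)[OF cP] i by auto
    qed
    moreover have "finite (e ` {i. x i \<noteq> 0})" using x by (simp add: words_def)
    ultimately have "finite {w \<in> Z. t w \<noteq> c w}" by (rule finite_subset)
    moreover have "t w \<in> P" if "w \<in> Z" for w using Ze[OF that] te by auto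
    ultimately obtain g where g: "g \<in> homeos X" "\<And>w. w \<in> Z \<Longrightarrow> recolour g w = t w"
      using recolour_surj[of t] by blast
    have "\<omega> (restrict g (topspace X)) = x"
      using g eZ te by (simp add: \<omega>_def extend_id_restrict fun_eq_iff)
    then show ?thesis using restrict_homeos[OF g(1)] by blast
  qed
  have "bilipschitz (words ?n) hamming cube_vertices hamming"
    using bilipschitz_trans[OF bilipschitz_words[OF card order_refl] bilipschitz_words_cube] .
  then obtain f L where f: "bij_betw f (words ?n) cube_vertices"
    and L: "\<And>x y. x \<in> words ?n \<Longrightarrow> y \<in> words ?n \<Longrightarrow> hamming (f x) (f y) \<le> L * hamming x y \<and> hamming x y \<le> L * hamming (f x) (f y)"
    by (auto simp: bilipschitz_def)
  \<comment> \<open>Adding 1 secures \<open>K \<ge> 1\<close> and a nonzero divisor.\<close>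
  define K where "K = real L + 1"
  have fv: "f x \<in> cube_vertices" if "x \<in> words ?n" for x using f that by (auto simp: bij_betw_def)
  show ?thesis
    unfolding quasi_isometric_def
  proof (rule exI[of _ "f \<circ> \<omega>"], rule exI[of _ K], rule exI[of _ 0], intro conjI ballI)
    show "f \<circ> \<omega> \<in> carrier (Homeo X) \<rightarrow> cube_vertices" using \<omega> fv by auto
    show "1 \<le> K" by (simp add: K_def)
  next
    fix g h assume g: "g \<in> carrier (Homeo X)" and h: "h \<in> carrier (Homeo X)"
    have d: "cube_dist ((f \<circ> \<omega>) g) ((f \<circ> \<omega>) h) = real (hamming (f (\<omega> g)) (f (\<omega> h)))"
      using cube_dist_hamming fv \<omega> g h by simp
    note b = L[OF \<omega>[OF g] \<omega>[OF h], unfolded \<omega>_dist[OF g h]]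
    let ?d = "recolour_dist (extend_id X g) (extend_id X h)" and ?e = "hamming (f (\<omega> g)) (f (\<omega> h))"
    have "real ?d \<le> real (L * ?e)" "real ?e \<le> real (L * ?d)" using b by (intro of_nat_mono; blast)+
    then have "real ?d \<le> K * real ?e" "real ?e \<le> K * real ?d"
      by (simp_all add: K_def distrib_right)
    then show "real ?d / K - 0 \<le> cube_dist ((f \<circ> \<omega>) g) ((f \<circ> \<omega>) h)"
      "cube_dist ((f \<circ> \<omega>) g) ((f \<circ> \<omega>) h) \<le> K * real ?d + 0"
      unfolding d by (simp_all add: K_def field_simps)
  next
    fix v assume v: "v \<in> cube_vertices"
    then obtain x where x: "x \<in> words ?n" "v = f x" using f by (auto simp: bij_betw_def)
    obtain g where "g \<in> carrier (Homeo X)" "\<omega> g = x" using \<omega>_surj[OF x(1)] by blast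
    then show "\<exists>g\<in>carrier (Homeo X). cube_dist ((f \<circ> \<omega>) g) v \<le> 0"
      using x v cube_dist_hamming[OF v v] by (intro bexI[of _ g]) (simp_all add: hamming_def)
  qed simp
qed

end

section \<open>Existence of the colouring, and the conclusion\<close>

text \<open>Disjoint clopen neighbourhoods of the top points need not cover the space; what is left
  over receives the colour of one chosen point \<open>p0\<close>.\<close>

lemma (in CB_space) colouring_exists:
  assumes "CB_deriv X \<alpha> \<noteq> {}"
  shows "\<exists>c. CB_colouring X \<alpha> \<beta> c"
proof -
  let ?P = "CB_deriv X \<alpha>"
  have PX: "?P \<subseteq> topspace X" by (rule CB_deriv_subset)
  obtain p0 where p0: "p0 \<in> ?P" using assms by blast
  have "\<exists>N. clopenin X N \<and> N \<inter> ?P = {p}" if p: "p \<in> ?P" for p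
  proof -
    have "closedin X (?P - {p})" using PX finite_top by (intro finite_closedin) auto
    then have "openin X (topspace X - (?P - {p}))" by auto
    moreover have "p \<in> topspace X - (?P - {p})" using p PX by blast
    ultimately obtain N where "clopenin X N" "p \<in> N" "N \<subseteq> topspace X - (?P - {p})"
      by (rule clopen_nbhd)
    then show ?thesis using p by (intro exI[of _ N]) auto
  qed
  then obtain N where N: "\<And>p. p \<in> ?P \<Longrightarrow> clopenin X (N p)" "\<And>p. p \<in> ?P \<Longrightarrow> N p \<inter> ?P = {p}" by metis
  \<comment> \<open>\<open>p\<close> itself is kept, as the other neighbourhoods contain no top
    point but their own.\<close>
  define N' where "N' p = N p - (\<Union>q\<in>?P - {p}. N q)" for p
  have N'cl: "clopenin X (N' p)" if "p \<in> ?P" for p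
    unfolding N'_def using N(1) that finite_top by (intro clopenin_Diff clopenin_UN) auto
  have N'P: "q \<in> N' p \<longleftrightarrow> q = p" if "p \<in> ?P" "q \<in> ?P" for p q
  proof -
    have "q \<in> N r \<longleftrightarrow> q = r" if "r \<in> ?P" for r using N(2)[OF that] \<open>q \<in> ?P\<close> by blast
    then show ?thesis using that unfolding N'_def by auto
  qed
  have N'disj: "p = q" if "x \<in> N' p" "x \<in> N' q" "p \<in> ?P" "q \<in> ?P" for p q x
    using that unfolding N'_def by blast
  define c where "c x = (if \<exists>p\<in>?P. x \<in> N' p then THE p. p \<in> ?P \<and> x \<in> N' p else p0)" for x
  have cN: "c x = p" if "x \<in> N' p" "p \<in> ?P" for x p
  proof -
    have "(THE q. q \<in> ?P \<and> x \<in> N' q) = p" using that N'disj by (intro the_equality) blast+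
    then show ?thesis using that by (auto simp: c_def)
  qed
  have c0: "c x = p0" if "\<And>p. p \<in> ?P \<Longrightarrow> x \<notin> N' p" for x using that by (auto simp: c_def)
  have "CB_colouring X \<alpha> \<beta> c"
  proof
    show "c x \<in> ?P" if "x \<in> topspace X" for x
    proof (cases "\<exists>p\<in>?P. x \<in> N' p")
      case True
      then show ?thesis using cN by auto
    next
      case False
      then have "c x = p0" by (intro c0) blast
      then show ?thesis using p0 by simp
    qed
    show "c p = p" if "p \<in> ?P" for p using N'P[OF that that] that by (intro cN) simp_all
    show "clopenin X {x \<in> topspace X. c x = p}" if p: "p \<in> ?P" for p
    proof -
      have sub: "N' q \<subseteq> topspace X" if "q \<in> ?P" for q using clopenin_subset[OF N'cl[OF that]] .
      have "{x \<in> topspace X. c x = p} = (if p = p0 then topspace X - (\<Union>q\<in>?P - {p0}. N' q) else N' p)"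
      proof (rule Set.set_eqI)
        fix x
        show "x \<in> {x \<in> topspace X. c x = p} \<longleftrightarrow> x \<in> (if p = p0 then topspace X - (\<Union>q\<in>?P - {p0}. N' q) else N' p)"
        proof (cases "\<exists>q\<in>?P. x \<in> N' q")
          case True
          then obtain q where q: "q \<in> ?P" "x \<in> N' q" by blast
          have "c x = q" using q by (intro cN)
          moreover have "x \<in> N' r \<longleftrightarrow> r = q" if "r \<in> ?P" for r
            using N'disj[of x r q] q that by auto
          moreover have "x \<in> topspace X" using sub q by blast
          ultimately show ?thesis using p p0 q(1) by auto
        next
          case False
          then show ?thesis using c0[of x] p by auto
        qed
      qed
      moreover have "clopenin X (topspace X - (\<Union>q\<in>?P - {p0}. N' q))"
        using N'cl finite_top by (intro clopenin_Diff clopenin_topspace clopenin_UN) auto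
      ultimately show ?thesis using N'cl[OF p] by simp
    qed
  qed
  then show ?thesis by (rule exI[of _ c])
qed

theorem corollaryD:
  fixes \<alpha> :: "'o::wellorder" and n :: nat and X :: "'a topology"
  assumes "countable_ordinal \<alpha>"
    and "\<not> zero_ordinal \<alpha>"
    and "successor_ordinal \<alpha>"
    and "n > 1"
    and "is_X \<alpha> n X"
  shows "group_quasi_isometric_to (Homeo X) (discrete_topology (carrier (Homeo X)))
           cube_vertices cube_dist"
proof -
  obtain \<beta> where \<beta>: "successor_of \<beta> \<alpha>" using assms(3) by (auto simp: successor_ordinal_def)
  have X: "compact_space X" "Hausdorff_space X" "countable (topspace X)"
    "finite (CB_deriv X \<alpha>)" "card (CB_deriv X \<alpha>) = n"
    using assms(5) by (auto simp: is_X_def Stone_space_def)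
  interpret CB_space X \<alpha> \<beta> by unfold_locales (use X \<beta> in auto)
  have "CB_deriv X \<alpha> \<noteq> {}" using X(5) assms(4) by auto
  then obtain c where "CB_colouring X \<alpha> \<beta> c" using colouring_exists by blast
  then interpret CB_colouring X \<alpha> \<beta> c .
  show ?thesis
    unfolding group_quasi_isometric_to_def
    using maximal_recolour_dist quasi_isometric_cube X(5) assms(4) by auto
qed

end
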